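(* Let $h$ be a complex-valued measurable function on $\mathbb{R}_+$ such that $\int_0^\infty|h(t+s)|^2\,ds<\infty$ for all $t>0$. (i) The operator $\Gamma_h$ is closed. (ii) We have $C^\infty_{\mathrm{comp}}(\mathbb{R}_+)\subset\operatorname{Dom}\Gamma_h$, and $C^\infty_{\mathrm{comp}}(\mathbb{R}_+)$ is dense in $\operatorname{Dom}\Gamma_h$ with respect to the graph norm of $\Gamma_h$. (iii) The adjoint of $\Gamma_h$ is given by $\Gamma_h^*=\Gamma_{\overline{h}}$.
   Context: $\mathbb{R}_+=(0,\infty)$. For a complex-valued measurable function $h$ on $\mathbb{R}_+$ with $\int_0^\infty|h(t+s)|^2\,ds<\infty$ for all $t>0$ and for $f\in L^2(\mathbb{R}_+)$, set $F(t)=\int_0^\infty h(t+s)f(s)\,ds$, $t>0$ (absolutely convergent by Cauchy–Schwarz). The operator $\Gamma_h$ on $L^2(\mathbb{R}_+)$ is defined by $\Gamma_hf=F$ with domain $\operatorname{Dom}\Gamma_h=\{f\in L^2(\mathbb{R}_+): F\in L^2(\mathbb{R}_+)\}$. The operator $\Gamma_{\overline h}$ is defined in the same way with the complex conjugate function $\overline{h}$ in place of $h$. $C^\infty_{\mathrm{comp}}(\mathbb{R}_+)$ is the set of infinitely smooth functions with compact support in $(0,\infty)$. The graph norm of an operator $A$ is $(\|f\|^2+\|Af\|^2)^{1/2}$. *)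

theory Defs
  imports "HOL-Analysis.Analysis"
begin

subsection \<open>The space \<open>L\<^sup>2(0,\<infinity>)\<close>\<close>

abbreviation Rpos :: "real measure" where
  "Rpos \<equiv> lebesgue_on {0<..}"

text \<open>Only the values on \<open>(0,\<infinity>)\<close> matter.\<close>

definition square_integrable :: "(real \<Rightarrow> complex) \<Rightarrow> bool" where
  "square_integrable f \<longleftrightarrow>
     f \<in> borel_measurable Rpos \<and> integrable Rpos (\<lambda>x. (cmod (f x))\<^sup>2)"

definition l2rel :: "(real \<Rightarrow> complex) \<Rightarrow> (real \<Rightarrow> complex) \<Rightarrow> bool" where
  "l2rel f g \<longleftrightarrow> square_integrable f \<and> square_integrable g \<and> (AE x in Rpos. f x = g x)"

lemma square_integrable_zero: "square_integrable (\<lambda>x. 0)"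
  by (simp add: square_integrable_def)

lemma square_integrable_add:
  assumes "square_integrable f" "square_integrable g"
  shows "square_integrable (\<lambda>x. f x + g x)"
proof -
  have m[measurable]: "f \<in> borel_measurable Rpos" "g \<in> borel_measurable Rpos"
    and i: "integrable Rpos (\<lambda>x. (cmod (f x))\<^sup>2)" "integrable Rpos (\<lambda>x. (cmod (g x))\<^sup>2)"
    using assms by (auto simp: square_integrable_def)
  have le: "(cmod (f x + g x))\<^sup>2 \<le> 2 * (cmod (f x))\<^sup>2 + 2 * (cmod (g x))\<^sup>2" for x
  proof -
    have "(cmod (f x + g x))\<^sup>2 \<le> (cmod (f x) + cmod (g x))\<^sup>2"
      by (rule power_mono[OF norm_triangle_ineq norm_ge_zero])
    moreover have "0 \<le> (cmod (f x) - cmod (g x))\<^sup>2" by simp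
    ultimately show ?thesis unfolding power2_diff power2_sum by linarith
  qed
  have "integrable Rpos (\<lambda>x. (cmod (f x + g x))\<^sup>2)"
  proof (rule Bochner_Integration.integrable_bound)
    show "integrable Rpos (\<lambda>x. 2 * (cmod (f x))\<^sup>2 + 2 * (cmod (g x))\<^sup>2)"
      using i by (intro Bochner_Integration.integrable_add integrable_mult_right) auto
    show "AE x in Rpos. norm ((cmod (f x + g x))\<^sup>2) \<le> norm (2 * (cmod (f x))\<^sup>2 + 2 * (cmod (g x))\<^sup>2)"
      by (rule AE_I2) (use le in \<open>simp only: real_norm_def abs_of_nonneg zero_le_power2 add_nonneg_nonneg mult_nonneg_nonneg zero_le_numeral\<close>)
  qed measurable
  then show ?thesis by (simp add: square_integrable_def)
qed

lemma square_integrable_scaleR: "square_integrable f \<Longrightarrow> square_integrable (\<lambda>x. c *\<^sub>R f x)"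
  by (auto simp: square_integrable_def power_mult_distrib)

lemma square_integrable_uminus: "square_integrable f \<Longrightarrow> square_integrable (\<lambda>x. - f x)"
  using square_integrable_scaleR[of f "-1"] by simp

lemma square_integrable_diff:
  "square_integrable f \<Longrightarrow> square_integrable g \<Longrightarrow> square_integrable (\<lambda>x. f x - g x)"
  using square_integrable_add[of f "\<lambda>x. - g x"] square_integrable_uminus[of g] by simp

lemma square_integrable_cnj: "square_integrable f \<Longrightarrow> square_integrable (\<lambda>x. cnj (f x))"
  by (auto simp: square_integrable_def
      intro!: measurable_compose[OF _ borel_measurable_continuous_onI[OF continuous_on_cnj[OF continuous_on_id]]])

lemma square_integrable_mult:
  assumes "square_integrable f" "square_integrable g"
  shows "integrable Rpos (\<lambda>x. f x * g x)"
proof -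
  have m[measurable]: "f \<in> borel_measurable Rpos" "g \<in> borel_measurable Rpos"
    and i: "integrable Rpos (\<lambda>x. (cmod (f x))\<^sup>2)" "integrable Rpos (\<lambda>x. (cmod (g x))\<^sup>2)"
    using assms by (auto simp: square_integrable_def)
  have le: "cmod (f x * g x) \<le> norm ((cmod (f x))\<^sup>2 + (cmod (g x))\<^sup>2)" for x
  proof -
    have "0 \<le> (cmod (f x) - cmod (g x))\<^sup>2" "0 \<le> cmod (f x) * cmod (g x)" by simp_all
    then have "cmod (f x) * cmod (g x) \<le> (cmod (f x))\<^sup>2 + (cmod (g x))\<^sup>2"
      unfolding power2_diff by linarith
    then show ?thesis by (simp add: norm_mult)
  qed
  show ?thesis
    by (rule Bochner_Integration.integrable_bound[OF Bochner_Integration.integrable_add[OF i]])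
      (use le in auto)
qed

quotient_type l2 = "real \<Rightarrow> complex" / partial: l2rel
proof (rule part_equivpI)
  show "\<exists>f. l2rel f f"
    by (rule exI[of _ "\<lambda>x. 0"]) (simp add: l2rel_def square_integrable_zero)
  show "symp l2rel"
    by (rule sympI) (auto simp: l2rel_def)
  show "transp l2rel"
    by (rule transpI) (auto simp: l2rel_def)
qed

text \<open>The class of a square integrable function, and an arbitrary representative.\<close>

definition l2_class :: "(real \<Rightarrow> complex) \<Rightarrow> l2" where
  "l2_class f = abs_l2 f"

definition l2_fun :: "l2 \<Rightarrow> (real \<Rightarrow> complex)" where
  "l2_fun u = rep_l2 u"

lemma square_integrable_l2_fun: "square_integrable (l2_fun u)"
  using Quotient3_rep_reflp[OF Quotient3_l2] by (auto simp: l2_fun_def l2rel_def)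

lemma l2_class_l2_fun: "l2_class (l2_fun u) = u"
  by (simp add: l2_class_def l2_fun_def Quotient3_abs_rep[OF Quotient3_l2])

lemma l2_class_eq_iff:
  "square_integrable f \<Longrightarrow> square_integrable g \<Longrightarrow>
     l2_class f = l2_class g \<longleftrightarrow> (AE x in Rpos. f x = g x)"
  using Quotient3_rel[OF Quotient3_l2, of f g] by (auto simp: l2_class_def l2rel_def)

lemma l2_fun_l2_class: "square_integrable f \<Longrightarrow> AE x in Rpos. l2_fun (l2_class f) x = f x"
  using l2_class_eq_iff[OF square_integrable_l2_fun, of f "l2_class f"] by (simp add: l2_class_l2_fun)

lift_definition cinner :: "l2 \<Rightarrow> l2 \<Rightarrow> complex" is
  "\<lambda>f g. integral\<^sup>L Rpos (\<lambda>x. f x * cnj (g x))"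
proof -
  fix f f' g g' assume a: "l2rel f f'" "l2rel g g'"
  have "integrable Rpos (\<lambda>x. f x * cnj (g x))" "integrable Rpos (\<lambda>x. f' x * cnj (g' x))"
    using a by (auto simp: l2rel_def intro!: square_integrable_mult square_integrable_cnj)
  moreover have "AE x in Rpos. f x * cnj (g x) = f' x * cnj (g' x)"
    using a unfolding l2rel_def by auto
  ultimately show "integral\<^sup>L Rpos (\<lambda>x. f x * cnj (g x)) = integral\<^sup>L Rpos (\<lambda>x. f' x * cnj (g' x))"
    by (intro integral_cong_AE borel_measurable_integrable)
qed

instantiation l2 :: real_inner
begin

lift_definition zero_l2 :: l2 is "\<lambda>x. 0"
  by (simp add: l2rel_def square_integrable_zero)

lift_definition plus_l2 :: "l2 \<Rightarrow> l2 \<Rightarrow> l2" is "\<lambda>f g x. f x + g x"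
  by (auto simp: l2rel_def square_integrable_add)

lift_definition minus_l2 :: "l2 \<Rightarrow> l2 \<Rightarrow> l2" is "\<lambda>f g x. f x - g x"
  by (auto simp: l2rel_def square_integrable_diff)

lift_definition uminus_l2 :: "l2 \<Rightarrow> l2" is "\<lambda>f x. - f x"
  by (auto simp: l2rel_def square_integrable_uminus)

lift_definition scaleR_l2 :: "real \<Rightarrow> l2 \<Rightarrow> l2" is "\<lambda>c f x. c *\<^sub>R f x"
  by (auto simp: l2rel_def square_integrable_scaleR)

definition inner_l2 :: "l2 \<Rightarrow> l2 \<Rightarrow> real" where
  "inner_l2 u v = Re (cinner u v)"

lift_definition norm_l2 :: "l2 \<Rightarrow> real" is "\<lambda>f. sqrt (integral\<^sup>L Rpos (\<lambda>x. (cmod (f x))\<^sup>2))"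
proof -
  fix f g assume a: "l2rel f g"
  then have "AE x in Rpos. (cmod (f x))\<^sup>2 = (cmod (g x))\<^sup>2" unfolding l2rel_def by auto
  then have "integral\<^sup>L Rpos (\<lambda>x. (cmod (f x))\<^sup>2) = integral\<^sup>L Rpos (\<lambda>x. (cmod (g x))\<^sup>2)"
    using a by (intro integral_cong_AE borel_measurable_integrable)
      (auto simp: l2rel_def square_integrable_def)
  then show "sqrt (integral\<^sup>L Rpos (\<lambda>x. (cmod (f x))\<^sup>2)) = sqrt (integral\<^sup>L Rpos (\<lambda>x. (cmod (g x))\<^sup>2))"
    by simp
qed

definition dist_l2 :: "l2 \<Rightarrow> l2 \<Rightarrow> real" where
  "dist_l2 u v = norm (u - v)"

definition sgn_l2 :: "l2 \<Rightarrow> l2" where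
  "sgn_l2 u = inverse (norm u) *\<^sub>R u"

definition uniformity_l2 :: "(l2 \<times> l2) filter" where
  "uniformity_l2 = (INF e\<in>{0<..}. principal {(u, v). dist u v < e})"

definition open_l2 :: "l2 set \<Rightarrow> bool" where
  "open_l2 U \<longleftrightarrow> (\<forall>u\<in>U. eventually (\<lambda>(u', v). u' = u \<longrightarrow> v \<in> U) uniformity)"

instance
proof
  fix u v w :: l2 and a b :: real
  show "u + v + w = u + (v + w)"
    by transfer (auto simp: l2rel_def add.assoc square_integrable_add)
  show "u + v = v + u"
    by transfer (auto simp: l2rel_def add.commute square_integrable_add)
  show "0 + u = u"
    by transfer (auto simp: l2rel_def)
  show "- u + u = 0"
    by transfer (auto simp: l2rel_def square_integrable_zero)
  show "u - v = u + - v"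
    by transfer (auto simp: l2rel_def square_integrable_diff)
  show "a *\<^sub>R (u + v) = a *\<^sub>R u + a *\<^sub>R v"
    by transfer (auto simp: l2rel_def scaleR_add_right square_integrable_add square_integrable_scaleR)
  show "(a + b) *\<^sub>R u = a *\<^sub>R u + b *\<^sub>R u"
    by transfer (auto simp: l2rel_def scaleR_add_left square_integrable_add square_integrable_scaleR)
  show "a *\<^sub>R b *\<^sub>R u = (a * b) *\<^sub>R u"
    by transfer (auto simp: l2rel_def square_integrable_scaleR)
  show "1 *\<^sub>R u = u"
    by transfer (auto simp: l2rel_def)
  show "dist u v = norm (u - v)" by (rule dist_l2_def)
  show "sgn u = inverse (norm u) *\<^sub>R u" by (rule sgn_l2_def)
  show "uniformity = (INF e\<in>{0<..}. principal {(u, v). dist (u::l2) v < e})"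
    by (rule uniformity_l2_def)
  show "open U \<longleftrightarrow> (\<forall>u\<in>U. \<forall>\<^sub>F (u', v) in uniformity. u' = u \<longrightarrow> v \<in> U)" for U :: "l2 set"
    by (rule open_l2_def)
  show "u \<bullet> v = v \<bullet> u"
  proof -
    have "cinner u v = cnj (cinner v u)"
      by transfer (subst Bochner_Integration.integral_cnj[symmetric], simp add: mult.commute)
    then show ?thesis by (simp add: inner_l2_def)
  qed
  show "(u + v) \<bullet> w = u \<bullet> w + v \<bullet> w"
  proof -
    have "cinner (u + v) w = cinner u w + cinner v w"
      by transfer (auto simp: l2rel_def distrib_right square_integrable_cnj square_integrable_mult
          intro!: Bochner_Integration.integral_add)
    then show ?thesis by (simp add: inner_l2_def)
  qed
  show "(a *\<^sub>R u) \<bullet> v = a * (u \<bullet> v)"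
  proof -
    have "cinner (a *\<^sub>R u) v = a *\<^sub>R cinner u v"
      by transfer simp
    then show ?thesis by (simp add: inner_l2_def)
  qed
  have self: "cinner u u = of_real ((norm u)\<^sup>2)" for u
  proof transfer
    fix f assume "l2rel f f"
    have "f x * cnj (f x) = complex_of_real ((cmod (f x))\<^sup>2)" for x
      by (rule complex_norm_square[symmetric])
    then have "(\<integral>x. f x * cnj (f x) \<partial>Rpos) = complex_of_real (\<integral>x. (cmod (f x))\<^sup>2 \<partial>Rpos)"
      by (simp only: integral_complex_of_real)
    also have "(\<integral>x. (cmod (f x))\<^sup>2 \<partial>Rpos) = (sqrt (\<integral>x. (cmod (f x))\<^sup>2 \<partial>Rpos))\<^sup>2"
      by simp
    finally show "(\<integral>x. f x * cnj (f x) \<partial>Rpos) = complex_of_real ((sqrt (\<integral>x. (cmod (f x))\<^sup>2 \<partial>Rpos))\<^sup>2)" .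
  qed
  show "0 \<le> u \<bullet> u" by (simp add: inner_l2_def self)
  show "norm u = sqrt (u \<bullet> u)"
  proof -
    have "0 \<le> norm u" by transfer simp
    then show ?thesis by (simp add: inner_l2_def self)
  qed
  have "norm u = 0 \<longleftrightarrow> u = 0"
    by transfer (auto simp: l2rel_def square_integrable_def integral_nonneg_eq_0_iff_AE)
  then show "u \<bullet> u = 0 \<longleftrightarrow> u = 0" by (simp add: inner_l2_def self)
qed

end

subsection \<open>Unbounded operators\<close>

text \<open>An operator with a domain is a partial map; two operators are equal iff they have the same
  domain and agree there.  The graph carries the product topology of the library.\<close>

definition closed_operator :: "('a::real_normed_vector \<rightharpoonup> 'b::real_normed_vector) \<Rightarrow> bool" where
  "closed_operator T \<longleftrightarrow> closed (Map.graph T)"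

text \<open>Meaningful on \<open>dom T\<close> only; for linear \<open>T\<close> the difference of two domain elements
  lies in the domain again.\<close>

definition graph_norm :: "('a::real_normed_vector \<rightharpoonup> 'b::real_normed_vector) \<Rightarrow> 'a \<Rightarrow> real" where
  "graph_norm T u = sqrt ((norm u)\<^sup>2 + (norm (the (T u)))\<^sup>2)"

definition graph_norm_dense :: "('a::real_normed_vector \<rightharpoonup> 'b::real_normed_vector) \<Rightarrow> 'a set \<Rightarrow> bool" where
  "graph_norm_dense T S \<longleftrightarrow>
     (\<forall>u\<in>dom T. \<forall>\<epsilon>>0. \<exists>v\<in>S. graph_norm T (u - v) < \<epsilon>)"

text \<open>For densely defined \<open>T\<close> the vector \<open>w\<close> below is unique as soon as it exists, so the domain
  is the usual one.  If \<open>T\<close> is not densely defined, \<open>w\<close> is never unique, and the adjoint is the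
  nowhere defined map (which differs from every linear operator).\<close>

definition adjoint_operator :: "(l2 \<rightharpoonup> l2) \<Rightarrow> (l2 \<rightharpoonup> l2)" where
  "adjoint_operator T v =
     (if \<exists>!w. \<forall>u\<in>dom T. cinner (the (T u)) v = cinner u w
      then Some (THE w. \<forall>u\<in>dom T. cinner (the (T u)) v = cinner u w)
      else None)"

subsection \<open>Hankel operators and test functions\<close>

definition hankel_integral :: "(real \<Rightarrow> complex) \<Rightarrow> (real \<Rightarrow> complex) \<Rightarrow> real \<Rightarrow> complex" where
  "hankel_integral h f t = integral\<^sup>L Rpos (\<lambda>s. h (t + s) * f s)"

definition hankel :: "(real \<Rightarrow> complex) \<Rightarrow> (l2 \<rightharpoonup> l2)" where
  "hankel h u =
     (let F = hankel_integral h (l2_fun u) in if square_integrable F then Some (l2_class F) else None)"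

text \<open>The choice of the representative is immaterial.\<close>

lemma hankel_l2_class:
  assumes h: "\<And>t. t > 0 \<Longrightarrow> square_integrable (\<lambda>s. h (t + s))" and f: "square_integrable f"
  shows "hankel h (l2_class f) =
    (if square_integrable (hankel_integral h f) then Some (l2_class (hankel_integral h f)) else None)"
proof -
  let ?g = "l2_fun (l2_class f)"
  have eq: "hankel_integral h ?g t = hankel_integral h f t" if "t > 0" for t
    unfolding hankel_integral_def
    by (intro integral_cong_AE borel_measurable_integrable square_integrable_mult h that f
        square_integrable_l2_fun) (use l2_fun_l2_class[OF f] in auto)
  have si: "square_integrable (hankel_integral h ?g) \<longleftrightarrow> square_integrable (hankel_integral h f)"
    unfolding square_integrable_def using eq
    by (intro arg_cong2[where f = conj] measurable_cong Bochner_Integration.integrable_cong) auto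
  have "AE t in Rpos. hankel_integral h ?g t = hankel_integral h f t"
    by (rule AE_I2) (auto intro: eq)
  then show ?thesis
    using si by (auto simp: hankel_def Let_def l2_class_eq_iff)
qed

definition smooth :: "(real \<Rightarrow> complex) \<Rightarrow> bool" where
  "smooth f \<longleftrightarrow> (\<exists>D :: nat \<Rightarrow> real \<Rightarrow> complex. D 0 = f \<and>
     (\<forall>n x. (D n has_vector_derivative D (Suc n) x) (at x)))"

text \<open>Functions on \<open>(0,\<infinity>)\<close> with compact support are identified with their extension by zero.\<close>

definition Ccomp_fun :: "(real \<Rightarrow> complex) set" where
  "Ccomp_fun = {f. smooth f \<and> compact (closure {x. f x \<noteq> 0}) \<and> closure {x. f x \<noteq> 0} \<subseteq> {0<..}}"

definition Ccomp :: "l2 set" where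
  "Ccomp = l2_class ` Ccomp_fun"

lemma square_integrable_Ccomp_fun:
  assumes "f \<in> Ccomp_fun" shows "square_integrable f"
proof -
  let ?K = "closure {x. f x \<noteq> 0}"
  have K: "compact ?K" "?K \<subseteq> {0<..}" and s: "smooth f"
    using assms by (auto simp: Ccomp_fun_def)
  have c: "continuous_on UNIV f"
    using s unfolding smooth_def
    by (metis continuous_at_imp_continuous_on has_vector_derivative_continuous)
  have m: "f \<in> borel_measurable Rpos"
    using continuous_on_subset[OF c]
    by (intro continuous_imp_measurable_on_sets_lebesgue) auto
  have i: "integrable lborel (\<lambda>x. indicator ?K x *\<^sub>R (cmod (f x))\<^sup>2)"
    by (intro borel_integrable_compact K continuous_intros continuous_on_subset[OF c]) auto
  then have "integrable lebesgue (\<lambda>x. indicator ?K x *\<^sub>R (cmod (f x))\<^sup>2)"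
    using integrable_completion[of "\<lambda>x. indicator ?K x *\<^sub>R (cmod (f x))\<^sup>2" lborel]
      borel_measurable_integrable[OF i] by blast
  also have "(\<lambda>x. indicator ?K x *\<^sub>R (cmod (f x))\<^sup>2) = (\<lambda>x. indicator {0<..} x *\<^sub>R (cmod (f x))\<^sup>2)"
    using K closure_subset[of "{x. f x \<noteq> 0}"] by (force simp: indicator_def fun_eq_iff)
  finally show ?thesis
    using m by (simp add: square_integrable_def integrable_restrict_space)
qed

end

(* The hard point is the symmetry int F g = int f G for F = Gamma_h f, G = Gamma_h g with f, g, F, G
   in L^2, where Fubini does not apply.  Given f and eps > 0, project (0, eps f) onto the graph
   {(l, eps l * f)} and let k be the first component of the projection.  The residual is
   (-k, eps p) with p = f - k * f, and its orthogonality to the graph says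
   |phi - phi * k|^2 + eps^2 |phi * p|^2 = |phi|^2 for all test functions phi: on the Fourier side
   1 - k^ is the outer function with modulus (1 + eps^2 |f^|^2)^(-1/2).  So W = 1 - k* is a
   contraction, convolution with p = W f is bounded, and k -> 0 as eps -> 0.  For h in L^2 one gets
   int F (W q) = int h (p * q) for all q, and the same for g with W' and p' = W' g; both sides being
   int h (p * p'), int F (W W' g) = int G (W' W f), and eps -> 0.  A general h is shifted into L^2
   first.  The adjoint of the restriction of Gamma_h to test functions is Gamma of the conjugate
   of h by Fubini; with the symmetry this gives (iii), and it gives (ii) because a vector of the
   graph of Gamma_h orthogonal to the graph of the restriction must vanish. *)

theory Submission
  imports Defs
begin

subsection \<open>Completeness of \<open>L\<^sup>2\<close> and orthogonal projections\<close>

text \<open>For \<open>f\<close> and \<open>g\<close> in the domain, the function h(x+y) f(y) g(x)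
  need not be absolutely integrable on the quadrant; this is the obstacle behind the symmetry. The
  way around it rests on the fact that the form with kernel h sees its arguments a, b only through a
  * b, while causal convolutions commute: a multiplier may pass from one argument to the other. The
  factors p and p' have bounded convolution operators, so p * p' is square integrable and pairs with
  a square integrable h. The orthogonality relation of the projection is tested at \<psi> - \<psi> *
  k, where \<psi> is the autocorrelation of \<phi> cut to (0,\<infinity>). The cut keeps the test
  element on the half-line, and the other half of the autocorrelation returns with the real part,
  which is why orthogonality for the real inner product suffices there. Shifting a general h by
  \<tau> > 0 shifts F and G by the same amount, so they stay square integrable; continuity of
  translations then gives \<tau> \<rightarrow> 0.\<close>

lemma norm_l2_class:
  assumes "square_integrable f"
  shows "norm (l2_class f) = sqrt (\<integral>x. (cmod (f x))\<^sup>2 \<partial>Rpos)"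
proof -
  have "l2rel f f" using assms by (simp add: l2rel_def)
  then show ?thesis
    unfolding l2_class_def by (simp add: norm_l2.abs_eq)
qed

lemma cinner_l2_class:
  assumes "square_integrable f" "square_integrable g"
  shows "cinner (l2_class f) (l2_class g) = (\<integral>x. f x * cnj (g x) \<partial>Rpos)"
  unfolding l2_class_def using assms by (intro cinner.abs_eq) (auto simp: l2rel_def)

lemma l2_class_add:
  assumes "square_integrable f" "square_integrable g"
  shows "l2_class f + l2_class g = l2_class (\<lambda>x. f x + g x)"
  unfolding l2_class_def using assms by (intro plus_l2.abs_eq) (auto simp: l2rel_def)

lemma l2_class_diff:
  assumes "square_integrable f" "square_integrable g"
  shows "l2_class f - l2_class g = l2_class (\<lambda>x. f x - g x)"
  unfolding l2_class_def using assms by (intro minus_l2.abs_eq) (auto simp: l2rel_def)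

lemma l2_class_scaleR:
  assumes "square_integrable f"
  shows "c *\<^sub>R l2_class f = l2_class (\<lambda>x. c *\<^sub>R f x)"
  unfolding l2_class_def using assms by (intro scaleR_l2.abs_eq) (auto simp: l2rel_def)

lemma l2_class_zero: "l2_class (\<lambda>x. 0) = 0"
  by (simp add: l2_class_def zero_l2_def)

section \<open>Fatou's lemma and the Riesz-Fischer theorem\<close>

lemma nn_integral_l2_class:
  assumes "square_integrable f"
  shows "(\<integral>\<^sup>+x. ennreal ((cmod (f x))\<^sup>2) \<partial>Rpos) = ennreal ((norm (l2_class f))\<^sup>2)"
  using assms by (simp add: norm_l2_class square_integrable_def nn_integral_eq_integral)

lemma square_integrable_iff_nn:
  "square_integrable f \<longleftrightarrow>
     f \<in> borel_measurable Rpos \<and> (\<integral>\<^sup>+x. ennreal ((cmod (f x))\<^sup>2) \<partial>Rpos) < \<infinity>"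
  unfolding square_integrable_def by (auto simp: integrable_iff_bounded)

text \<open>Fatou's lemma delivers membership in the space and the norm bound together. The bound is
  assumed only eventually, because it is applied to tails of convergent sequences.\<close>

lemma fatou_l2:
  assumes f: "\<And>n. square_integrable (f n)" and g: "g \<in> borel_measurable Rpos"
    and lim: "AE x in Rpos. (\<lambda>n. f n x) \<longlonglongrightarrow> g x"
    and b: "eventually (\<lambda>n. norm (l2_class (f n)) \<le> C) sequentially"
  shows "square_integrable g" "norm (l2_class g) \<le> C"
proof -
  have [measurable]: "f n \<in> borel_measurable Rpos" for n
    using f by (auto simp: square_integrable_def)
  obtain n where "norm (l2_class (f n)) \<le> C" using b by (auto simp: eventually_sequentially)
  then have C: "0 \<le> C" using norm_ge_zero order_trans by blast
  have "AE x in Rpos. ennreal ((cmod (g x))\<^sup>2) = liminf (\<lambda>n. ennreal ((cmod (f n x))\<^sup>2))"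
    using lim
  proof eventually_elim
    case (elim x)
    then have "(\<lambda>n. ennreal ((cmod (f n x))\<^sup>2)) \<longlonglongrightarrow> ennreal ((cmod (g x))\<^sup>2)"
      by (intro tendsto_intros)
    then show ?case by (rule lim_imp_Liminf[OF trivial_limit_sequentially, symmetric])
  qed
  then have "(\<integral>\<^sup>+x. ennreal ((cmod (g x))\<^sup>2) \<partial>Rpos) = (\<integral>\<^sup>+x. liminf (\<lambda>n. ennreal ((cmod (f n x))\<^sup>2)) \<partial>Rpos)"
    by (rule nn_integral_cong_AE)
  also have "\<dots> \<le> liminf (\<lambda>n. \<integral>\<^sup>+x. ennreal ((cmod (f n x))\<^sup>2) \<partial>Rpos)"
    by (rule nn_integral_liminf) measurable
  also have "\<dots> \<le> limsup (\<lambda>n. \<integral>\<^sup>+x. ennreal ((cmod (f n x))\<^sup>2) \<partial>Rpos)"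
    by (rule Liminf_le_Limsup) simp
  also have "\<dots> \<le> ennreal (C\<^sup>2)"
    by (rule Limsup_bounded, rule eventually_mono[OF b])
      (auto simp: nn_integral_l2_class[OF f] intro!: ennreal_leI power_mono)
  finally have le: "(\<integral>\<^sup>+x. ennreal ((cmod (g x))\<^sup>2) \<partial>Rpos) \<le> ennreal (C\<^sup>2)" .
  show si: "square_integrable g"
    unfolding square_integrable_iff_nn using le g by (auto intro: le_less_trans)
  show "norm (l2_class g) \<le> C"
    using le unfolding nn_integral_l2_class[OF si] using C by (auto simp: power2_le_iff_abs_le)
qed

text \<open>Fatou is applied to the differences \<open>f n x - v x\<close>, whose norms eventually
  lie below every e > 0. This is how limits are identified later: for convolution operators and for
  \<open>hankel\<close>, norm convergence of the arguments gives pointwise convergence of the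
  images.\<close>

lemma l2_lim_AE_unique:
  assumes f: "\<And>n. square_integrable (f n)" and g: "g \<in> borel_measurable Rpos"
    and v: "square_integrable v"
    and lim: "AE x in Rpos. (\<lambda>n. f n x) \<longlonglongrightarrow> g x"
    and conv: "(\<lambda>n. l2_class (f n)) \<longlonglongrightarrow> l2_class v"
  shows "square_integrable g" "l2_class g = l2_class v"
proof -
  have [measurable]: "g \<in> borel_measurable Rpos" "v \<in> borel_measurable Rpos"
    using g v by (auto simp: square_integrable_def)
  have d: "square_integrable (\<lambda>x. f n x - v x)" for n
    by (intro square_integrable_diff f v)
  have dl: "AE x in Rpos. (\<lambda>n. f n x - v x) \<longlonglongrightarrow> g x - v x"
    using lim by eventually_elim (intro tendsto_intros)
  have e: "eventually (\<lambda>n. norm (l2_class (\<lambda>x. f n x - v x)) \<le> e) sequentially" if "e > 0" for e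
    using tendstoD[OF conv that] 
    by (rule eventually_mono) (simp add: dist_l2_def l2_class_diff f v)
  have gv: "square_integrable (\<lambda>x. g x - v x)"
    by (rule fatou_l2(1)[OF d _ dl e[of 1]]) auto
  have "norm (l2_class (\<lambda>x. g x - v x)) \<le> 0 + e" if "e > 0" for e
    using fatou_l2(2)[OF d _ dl e[OF that]] by simp
  then have z: "l2_class (\<lambda>x. g x - v x) = 0"
    using field_le_epsilon norm_le_zero_iff by blast
  have "square_integrable (\<lambda>x. (g x - v x) + v x)"
    by (rule square_integrable_add[OF gv v])
  then show "square_integrable g" by simp
  then show "l2_class g = l2_class v"
    using z l2_class_diff[of g v] v by simp
qed

text \<open>A fast subsequence converges almost everywhere, Fatou makes its pointwise limit a norm
  limit, and the Cauchy property extends this to the whole sequence.\<close>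

lemma l2_Cauchy_convergent:
  fixes X :: "nat \<Rightarrow> l2"
  assumes C: "Cauchy X"
  shows "convergent X"
proof -
  have "\<exists>r :: nat \<Rightarrow> nat. strict_mono r \<and> (\<forall>n. \<forall>m\<ge>r n. norm (X m - X (r n)) \<le> (1/2)^n)"
  proof -
    have ex: "\<exists>M. \<forall>m\<ge>M. \<forall>k\<ge>M. norm (X m - X k) < (1/2)^n" for n
      using C by (intro CauchyD) auto
    then obtain M where M: "\<And>n m k. m \<ge> M n \<Longrightarrow> k \<ge> M n \<Longrightarrow> norm (X m - X k) < (1/2)^n"
      by metis
    \<comment> \<open>Partial sums of \<open>Suc (M i)\<close> are strictly increasing and dominate
      \<open>M n\<close>.\<close>
    define r where "r n = (\<Sum>i\<le>n. Suc (M i))" for n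
    have "strict_mono r" by (rule strict_mono_Suc_iff[THEN iffD2]) (simp add: r_def)
    moreover have "r n \<ge> M n" for n
      using member_le_sum[of n "{..n}" "\<lambda>i. Suc (M i)"] by (simp add: r_def)
    ultimately show ?thesis using M by (meson less_imp_le order_trans)
  qed
  then obtain r :: "nat \<Rightarrow> nat" where r: "strict_mono r"
    and rb: "\<And>n m. m \<ge> r n \<Longrightarrow> norm (X m - X (r n)) \<le> (1/2)^n" by blast
  define f where "f n = l2_fun (X (r n))" for n
  have f: "square_integrable (f n)" and fX: "l2_class (f n) = X (r n)" for n
    by (simp_all add: f_def square_integrable_l2_fun l2_class_l2_fun)
  have [measurable]: "f n \<in> borel_measurable Rpos" for n
    using f by (auto simp: square_integrable_def)
  have step: "norm (X (r (Suc n)) - X (r n)) \<le> (1/2)^n" for n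
    using r by (intro rb) (simp add: strict_mono_less_eq)
  \<comment> \<open>The squared norms of the steps are at most 4^(-n), so the weight 2^n still
    leaves a summable series. A finite sum at x forces the squared steps below 2^(-n) eventually,
    and the telescoping series is dominated by a geometric one.\<close>
  have "(\<integral>\<^sup>+x. (\<Sum>n. ennreal (2^n * (cmod (f (Suc n) x - f n x))\<^sup>2)) \<partial>Rpos)
      = (\<Sum>n. \<integral>\<^sup>+x. ennreal (2^n * (cmod (f (Suc n) x - f n x))\<^sup>2) \<partial>Rpos)"
    by (rule nn_integral_suminf) measurable
  also have "\<dots> \<le> (\<Sum>n. ennreal ((1/2)^n))"
  proof (rule suminf_le)
    fix n
    have "(\<integral>\<^sup>+x. ennreal (2^n * (cmod (f (Suc n) x - f n x))\<^sup>2) \<partial>Rpos)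
      = ennreal (2^n) * ennreal ((norm (l2_class (\<lambda>x. f (Suc n) x - f n x)))\<^sup>2)"
      by (subst nn_integral_l2_class[symmetric])
        (auto simp: ennreal_mult nn_integral_cmult f intro!: square_integrable_diff)
    also have "\<dots> = ennreal (2^n * (norm (X (r (Suc n)) - X (r n)))\<^sup>2)"
      by (simp add: l2_class_diff[symmetric] f fX ennreal_mult)
    also have "\<dots> \<le> ennreal (2^n * ((1/2)^n)\<^sup>2)"
      by (intro ennreal_leI mult_left_mono power_mono step) auto
    also have "\<dots> = ennreal ((1/2)^n)"
      by (simp add: power2_eq_square power_one_over)
    finally show "(\<integral>\<^sup>+x. ennreal (2^n * (cmod (f (Suc n) x - f n x))\<^sup>2) \<partial>Rpos) \<le> ennreal ((1/2)^n)" .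
  qed auto
  also have "\<dots> < \<infinity>"
    by (subst suminf_ennreal2) (auto simp: summable_geometric)
  finally have "AE x in Rpos. (\<Sum>n. ennreal (2^n * (cmod (f (Suc n) x - f n x))\<^sup>2)) \<noteq> \<infinity>"
    by (intro nn_integral_PInf_AE) (auto simp: less_top)
  then have cv: "AE x in Rpos. convergent (\<lambda>n. f n x)"
  proof eventually_elim
    case (elim x)
    then have s: "summable (\<lambda>n. 2^n * (cmod (f (Suc n) x - f n x))\<^sup>2)"
      by (intro summable_suminf_not_top) auto
    then have "(\<lambda>n. 2^n * (cmod (f (Suc n) x - f n x))\<^sup>2) \<longlonglongrightarrow> 0" by (rule summable_LIMSEQ_zero)
    then have "eventually (\<lambda>n. 2^n * (cmod (f (Suc n) x - f n x))\<^sup>2 < 1) sequentially"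
      by (rule order_tendstoD(2)) simp
    then have "eventually (\<lambda>n. norm (f (Suc n) x - f n x) \<le> (sqrt (1/2))^n) sequentially"
    proof eventually_elim
      case (elim n)
      have "(cmod (f (Suc n) x - f n x))\<^sup>2 \<le> (1/2)^n"
        using elim by (simp add: field_simps power_one_over)
      also have "\<dots> = ((sqrt (1/2))^n)\<^sup>2"
        by (subst power_mult[symmetric], subst mult.commute, subst power_mult) (simp add: real_sqrt_pow2)
      finally show ?case using power2_le_imp_le by (metis zero_le_power real_sqrt_ge_zero zero_le_divide_1_iff zero_le_numeral)
    qed
    then have "summable (\<lambda>n. f (Suc n) x - f n x)"
      by (rule summable_comparison_test_ev) (auto simp: summable_geometric)
    then have "convergent (\<lambda>n. f n x - f 0 x)"
      by (simp add: summable_iff_convergent sum_lessThan_telescope[of "\<lambda>n. f n x"])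
    then show ?case by (rule convergent_diff_const_right_iff[THEN iffD1])
  qed
  define g where "g x = lim (\<lambda>n. f n x)" for x
  have g[measurable]: "g \<in> borel_measurable Rpos"
    unfolding g_def by measurable
  have lim: "AE x in Rpos. (\<lambda>n. f n x) \<longlonglongrightarrow> g x"
    using cv by eventually_elim (simp add: g_def convergent_LIMSEQ_iff)
  have fn: "square_integrable (\<lambda>x. g x - f n x) \<and> norm (l2_class (\<lambda>x. g x - f n x)) \<le> (1/2)^n" for n
  proof -
    have l: "AE x in Rpos. (\<lambda>m. f m x - f n x) \<longlonglongrightarrow> g x - f n x"
      using lim by eventually_elim (intro tendsto_intros)
    have "eventually (\<lambda>m. norm (l2_class (\<lambda>x. f m x - f n x)) \<le> (1/2)^n) sequentially"
      using eventually_ge_at_top[of n] 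
      by (rule eventually_mono)
        (use r in \<open>auto simp: l2_class_diff[symmetric] f fX strict_mono_less_eq intro!: rb\<close>)
    from fatou_l2[OF square_integrable_diff[OF f f] _ l this] show ?thesis by simp
  qed
  have sg: "square_integrable g"
    using square_integrable_add[OF conjunct1[OF fn[of 0]] f[of 0]] by simp
  have "(\<lambda>n. X (r n) - l2_class g) \<longlonglongrightarrow> 0"
  proof (rule Lim_null_comparison)
    have "norm (X (r n) - l2_class g) \<le> (1/2)^n" for n
      using fn[of n] by (simp add: l2_class_diff[symmetric] f fX sg norm_minus_commute)
    then show "\<forall>\<^sub>F n in sequentially. norm (X (r n) - l2_class g) \<le> (1/2)^n" by simp
    show "(\<lambda>n. (1/2)^n :: real) \<longlonglongrightarrow> 0" by (simp add: LIMSEQ_realpow_zero)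
  qed
  then have "(X \<circ> r) \<longlonglongrightarrow> l2_class g" by (simp add: LIM_zero_iff o_def)
  then show ?thesis
    using Cauchy_converges_subseq[OF C r] convergentI by blast
qed

instance l2 :: complete_space
  by standard (rule l2_Cauchy_convergent)

text \<open>A minimising sequence for the distance is Cauchy by the parallelogram law. For
  \<open>l2\<close> the orthogonality is that of the real inner product, the real part of
  \<open>cinner\<close>.\<close>

lemma closed_subspace_projection:
  fixes M :: "'a::{real_inner, complete_space} set"
  assumes M: "subspace M" "closed M"
  shows "\<exists>y\<in>M. \<forall>z\<in>M. (x - y) \<bullet> z = 0"
proof -
  define d where "d = Inf ((\<lambda>y. (norm (x - y))\<^sup>2) ` M)"
  have ne: "M \<noteq> {}" using subspace_0[OF M(1)] by auto
  have bdd: "bdd_below ((\<lambda>y. (norm (x - y))\<^sup>2) ` M)" by (rule bdd_belowI2[where m = 0]) simp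
  have dle: "d \<le> (norm (x - y))\<^sup>2" if "y \<in> M" for y
    unfolding d_def by (rule cINF_lower[OF bdd that])
  have "\<exists>y\<in>M. (norm (x - y))\<^sup>2 < d + 1 / Suc n" for n
    using cINF_less_iff[OF ne bdd, of "d + 1 / Suc n"] by (simp add: d_def)
  then obtain y where y: "\<And>n. y n \<in> M" and yd: "\<And>n. (norm (x - y n))\<^sup>2 < d + 1 / Suc n"
    by metis
  have par: "(norm (y m - y n))\<^sup>2 \<le> 2 / Suc m + 2 / Suc n" for m n
  proof -
    \<comment> \<open>The midpoint lies in \<open>M\<close>, so its squared distance to
      \<open>x\<close> is at least \<open>d\<close>; this is the lower bound that the parallelogram
      law needs.\<close>
    have "(1/2) *\<^sub>R (y m + y n) \<in> M"
      using M(1) y by (intro subspace_scale subspace_add)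
    then have "4 * d \<le> 4 * (norm (x - (1/2) *\<^sub>R (y m + y n)))\<^sup>2" using dle by simp
    also have "\<dots> = (norm (2 *\<^sub>R (x - (1/2) *\<^sub>R (y m + y n))))\<^sup>2"
      by (simp only: norm_scaleR power_mult_distrib) simp
    also have "2 *\<^sub>R (x - (1/2) *\<^sub>R (y m + y n)) = (x - y m) + (x - y n)"
      by (simp add: algebra_simps scaleR_2)
    finally have "4 * d \<le> (norm ((x - y m) + (x - y n)))\<^sup>2" .
    moreover have "(norm ((x - y m) + (x - y n)))\<^sup>2 + (norm ((x - y n) - (x - y m)))\<^sup>2
        = 2 * (norm (x - y m))\<^sup>2 + 2 * (norm (x - y n))\<^sup>2"
      by (simp add: power2_norm_eq_inner algebra_simps inner_commute)
    ultimately have "(norm (y m - y n))\<^sup>2 \<le> 2 * (1 / Suc m) + 2 * (1 / Suc n)"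
      using yd[of m] yd[of n] by simp
    then show ?thesis by simp
  qed
  have "Cauchy y"
  proof (rule metric_CauchyI)
    fix e :: real assume e: "e > 0"
    obtain N where N: "4 / e\<^sup>2 < real N" using reals_Archimedean2 by blast
    have "dist (y m) (y n) < e" if "m \<ge> N" "n \<ge> N" for m n
    proof -
      have N0: "0 < real N" by (rule le_less_trans[OF _ N]) simp
      have "2 / Suc m \<le> 2 / N" "2 / Suc n \<le> 2 / N"
        using that N0 by (auto simp: field_simps)
      then have "(norm (y m - y n))\<^sup>2 \<le> 4 / N" using par[of m n] by simp
      also have "\<dots> < e\<^sup>2" using N N0 e by (simp add: field_simps)
      finally show ?thesis using e by (simp add: dist_norm power_less_imp_less_base)
    qed
    then show "\<exists>N. \<forall>m\<ge>N. \<forall>n\<ge>N. dist (y m) (y n) < e" by blast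
  qed
  then obtain p where p: "y \<longlonglongrightarrow> p" using Cauchy_convergent convergent_def by blast
  have pM: "p \<in> M" using M(2) y p by (metis closed_sequentially)
  have "(\<lambda>n. (norm (x - y n))\<^sup>2) \<longlonglongrightarrow> (norm (x - p))\<^sup>2" by (intro tendsto_intros p)
  moreover have "(\<lambda>n. d + 1 / Suc n) \<longlonglongrightarrow> d + 0"
    by (intro tendsto_intros LIMSEQ_Suc[OF lim_1_over_n])
  ultimately have pd: "(norm (x - p))\<^sup>2 \<le> d"
    using yd by (intro LIMSEQ_le[where Y = "\<lambda>n. d + 1 / Suc n"]) (auto intro: less_imp_le)
  have "(x - p) \<bullet> z = 0" if z: "z \<in> M" for z
  proof (cases "z = 0")
    case False
    \<comment> \<open>The minimiser of the quadratic function s \<mapsto> |x - p - s z|^2;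
      minimality at s = 0 forces it to vanish.\<close>
    define t where "t = ((x - p) \<bullet> z) / (z \<bullet> z)"
    have "p + t *\<^sub>R z \<in> M" using M(1) pM z by (intro subspace_add subspace_scale)
    then have "(norm (x - p))\<^sup>2 \<le> (norm (x - (p + t *\<^sub>R z)))\<^sup>2" using dle pd order_trans by blast
    also have "x - (p + t *\<^sub>R z) = (x - p) - t *\<^sub>R z" by simp
    also have "(norm ((x - p) - t *\<^sub>R z))\<^sup>2 = (norm (x - p))\<^sup>2 - 2 * t * ((x - p) \<bullet> z) + t\<^sup>2 * (z \<bullet> z)"
    proof -
      have "(norm (w - t *\<^sub>R z))\<^sup>2 = (norm w)\<^sup>2 - 2 * t * (w \<bullet> z) + t\<^sup>2 * (z \<bullet> z)" for w
        unfolding power2_norm_eq_inner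
        by (simp add: inner_diff_left inner_diff_right inner_commute power2_eq_square algebra_simps)
      then show ?thesis by blast
    qed
    finally have "2 * t * ((x - p) \<bullet> z) \<le> t\<^sup>2 * (z \<bullet> z)" by simp
    moreover have "(x - p) \<bullet> z = t * (z \<bullet> z)" using False by (simp add: t_def)
    ultimately have "t\<^sup>2 * (z \<bullet> z) \<le> 0" by (simp add: power2_eq_square mult.assoc)
    moreover have "0 < z \<bullet> z" using False by simp
    ultimately have "t\<^sup>2 \<le> 0" by (metis mult_le_0_iff not_le)
    then have "t = 0" by simp
    then show ?thesis using \<open>(x - p) \<bullet> z = t * (z \<bullet> z)\<close> by simp
  qed simp
  then show ?thesis using pM by blast
qed

subsection \<open>Borel representatives\<close>

lemma AE_Rpos_iff: "(AE x in Rpos. P x) \<longleftrightarrow> (AE x in lborel. 0 < x \<longrightarrow> P x)"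
  by (subst AE_restrict_space_iff) (auto simp: AE_completion_iff)

lemma borel_imp_measurable_Rpos:
  "g \<in> borel_measurable borel \<Longrightarrow> g \<in> borel_measurable Rpos"
  by (intro measurable_restrict_space1 measurable_completion) simp

lemma
  fixes g :: "real \<Rightarrow> 'a::{banach, second_countable_topology}"
  assumes g: "g \<in> borel_measurable borel" and z: "\<And>x. x \<le> 0 \<Longrightarrow> g x = 0"
  shows integral_Rpos_eq_lborel: "integral\<^sup>L Rpos g = integral\<^sup>L lborel g"
    and integrable_Rpos_iff_lborel: "integrable Rpos g \<longleftrightarrow> integrable lborel g"
proof -
  have eq: "(\<lambda>x. indicator {0<..} x *\<^sub>R g x) = g"
    by (rule ext) (auto simp: indicator_def z)
  show "integral\<^sup>L Rpos g = integral\<^sup>L lborel g"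
    using g by (simp add: integral_restrict_space eq integral_completion)
  show "integrable Rpos g \<longleftrightarrow> integrable lborel g"
    using g by (simp add: integrable_restrict_space eq integrable_completion)
qed

text \<open>Functions measurable for the completed measure agree almost everywhere with Borel ones;
  the real and the imaginary part are treated separately. The value 0 on the left half-line turns
  integrals over (0,\<infinity>) into integrals over the line.\<close>

lemma borel_representative:
  fixes f :: "real \<Rightarrow> complex"
  assumes "f \<in> borel_measurable Rpos"
  shows "\<exists>g. g \<in> borel_measurable borel \<and> (\<forall>x\<le>0. g x = 0) \<and> (AE x in lborel. 0 < x \<longrightarrow> f x = g x)"
proof -
  have m: "(\<lambda>x. indicator {0<..} x *\<^sub>R f x) \<in> borel_measurable lebesgue"
    using assms by (subst (asm) borel_measurable_restrict_space_iff) auto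
  have "(\<lambda>x. Re (indicator {0<..} x *\<^sub>R f x)) \<in> borel_measurable (completion lborel)"
    "(\<lambda>x. Im (indicator {0<..} x *\<^sub>R f x)) \<in> borel_measurable (completion lborel)"
    using m by measurable
  then obtain g1 g2 where [measurable]: "g1 \<in> borel_measurable borel" "g2 \<in> borel_measurable borel"
    and ae: "AE x in lborel. Re (indicator {0<..} x *\<^sub>R f x) = g1 x"
      "AE x in lborel. Im (indicator {0<..} x *\<^sub>R f x) = g2 x"
    by (auto dest!: completion_ex_borel_measurable_real)
  let ?g = "\<lambda>x. indicator {0<..} x *\<^sub>R Complex (g1 x) (g2 x)"
  have "?g \<in> borel_measurable borel" unfolding Complex_eq by measurable
  moreover have "AE x in lborel. 0 < x \<longrightarrow> f x = ?g x"
    using ae by eventually_elim (auto simp: complex_eq_iff)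
  ultimately show ?thesis by (intro exI[of _ ?g]) auto
qed

definition L2_line :: "(real \<Rightarrow> complex) \<Rightarrow> bool" where
  "L2_line f \<longleftrightarrow> f \<in> borel_measurable borel \<and> integrable lborel (\<lambda>x. (cmod (f x))\<^sup>2)"

text \<open>Borel functions extended by zero: products of Borel functions are measurable on the plane
  for the product measure, which fails for Lebesgue measurable ones.\<close>

definition L2_half :: "(real \<Rightarrow> complex) \<Rightarrow> bool" where
  "L2_half f \<longleftrightarrow> L2_line f \<and> (\<forall>x\<le>0. f x = 0)"

lemma L2_half_L2_line: "L2_half f \<Longrightarrow> L2_line f" by (simp add: L2_half_def)
lemma L2_half_nonpos: "L2_half f \<Longrightarrow> x \<le> 0 \<Longrightarrow> f x = 0" by (simp add: L2_half_def)
lemma L2_line_borel: "L2_line f \<Longrightarrow> f \<in> borel_measurable borel" by (simp add: L2_line_def)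
lemma L2_half_borel: "L2_half f \<Longrightarrow> f \<in> borel_measurable borel"
  by (simp add: L2_line_def L2_half_def)

lemma L2_half_iff:
  "L2_half f \<longleftrightarrow> f \<in> borel_measurable borel \<and> (\<forall>x\<le>0. f x = 0) \<and> square_integrable f"
  unfolding L2_half_def L2_line_def square_integrable_def
  by (auto simp: integrable_Rpos_iff_lborel borel_imp_measurable_Rpos)

lemma L2_half_square_integrable: "L2_half f \<Longrightarrow> square_integrable f"
  by (simp add: L2_half_iff)

lemma L2_half_add: "L2_half f \<Longrightarrow> L2_half g \<Longrightarrow> L2_half (\<lambda>x. f x + g x)"
  by (auto simp: L2_half_iff square_integrable_add)
lemma L2_half_diff: "L2_half f \<Longrightarrow> L2_half g \<Longrightarrow> L2_half (\<lambda>x. f x - g x)"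
  by (auto simp: L2_half_iff square_integrable_diff)
lemma L2_half_scaleR: "L2_half f \<Longrightarrow> L2_half (\<lambda>x. c *\<^sub>R f x)"
  by (auto simp: L2_half_iff square_integrable_scaleR)
lemma borel_measurable_cnj [measurable (raw)]:
  "f \<in> borel_measurable M \<Longrightarrow> (\<lambda>x. cnj (f x)) \<in> borel_measurable M"
  by (rule measurable_compose[OF _ borel_measurable_continuous_onI[OF continuous_on_cnj[OF continuous_on_id]]])
lemma L2_line_cnj: "L2_line f \<Longrightarrow> L2_line (\<lambda>x. cnj (f x))"
  by (auto simp: L2_line_def)
lemma L2_half_cnj: "L2_half f \<Longrightarrow> L2_half (\<lambda>x. cnj (f x))"
  by (auto simp: L2_half_def L2_line_cnj)

lemma L2_half_representative:
  obtains f where "L2_half f" "l2_class f = u"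
proof -
  have m: "l2_fun u \<in> borel_measurable Rpos"
    using square_integrable_l2_fun[of u] by (simp add: square_integrable_def)
  obtain g where g: "g \<in> borel_measurable borel" "\<forall>x\<le>0. g x = 0"
    and ae: "AE x in lborel. 0 < x \<longrightarrow> l2_fun u x = g x"
    using borel_representative[OF m] by blast
  have ae': "AE x in Rpos. l2_fun u x = g x" using ae by (simp add: AE_Rpos_iff)
  have gm: "g \<in> borel_measurable Rpos" using g by (simp add: borel_imp_measurable_Rpos)
  have "AE x in Rpos. (cmod (l2_fun u x))\<^sup>2 = (cmod (g x))\<^sup>2"
    using ae' by eventually_elim simp
  then have "integrable Rpos (\<lambda>x. (cmod (g x))\<^sup>2)"
    using square_integrable_l2_fun[of u] gm m
    by (subst integrable_cong_AE[symmetric]) (auto simp: square_integrable_def)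
  then have si: "square_integrable g" using gm by (simp add: square_integrable_def)
  have "l2_class (l2_fun u) = l2_class g"
    using ae' by (simp add: l2_class_eq_iff square_integrable_l2_fun si)
  then show ?thesis
    using g si by (intro that[of g]) (auto simp: L2_half_iff l2_class_l2_fun)
qed

lemma norm_l2_class_half:
  assumes "L2_half f"
  shows "norm (l2_class f) = sqrt (\<integral>x. (cmod (f x))\<^sup>2 \<partial>lborel)"
proof -
  have "(\<lambda>x. (cmod (f x))\<^sup>2) \<in> borel_measurable borel"
    using L2_half_borel[OF assms] by measurable
  then show ?thesis
    using assms by (simp add: norm_l2_class L2_half_square_integrable integral_Rpos_eq_lborel L2_half_nonpos)
qed

lemma cinner_l2_class_half:
  assumes "L2_half f" "L2_half g"
  shows "cinner (l2_class f) (l2_class g) = (\<integral>x. f x * cnj (g x) \<partial>lborel)"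
proof -
  have "(\<lambda>x. f x * cnj (g x)) \<in> borel_measurable borel"
    using assms[THEN L2_half_borel] by measurable
  then show ?thesis
    using assms by (simp add: cinner_l2_class L2_half_square_integrable integral_Rpos_eq_lborel L2_half_nonpos)
qed

text \<open>Square integrability of \<open>g\<close> is part of the conclusion. This serves a Hankel
  integral that is known only to agree almost everywhere with a square integrable function.\<close>

lemma L2_half_cong_AE:
  assumes f: "L2_half f" and g: "g \<in> borel_measurable borel" "\<And>x. x \<le> 0 \<Longrightarrow> g x = 0"
    and ae: "AE x in lborel. f x = g x"
  shows "L2_half g" "l2_class g = l2_class f"
proof -
  note fm = L2_half_borel[OF f]
  have "AE x in lborel. (cmod (f x))\<^sup>2 = (cmod (g x))\<^sup>2"
    using ae by eventually_elim simp
  then have "integrable lborel (\<lambda>x. (cmod (g x))\<^sup>2)"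
    using f fm g(1) by (subst integrable_cong_AE[symmetric, where f = "\<lambda>x. (cmod (f x))\<^sup>2"])
      (simp_all add: L2_half_def L2_line_def del: power2_eq_iff_nonneg)
  then show gh: "L2_half g" using g by (simp add: L2_half_def L2_line_def)
  show "l2_class g = l2_class f"
    using ae by (subst l2_class_eq_iff) (auto simp: L2_half_square_integrable f gh AE_Rpos_iff)
qed

subsection \<open>Density of test functions\<close>

text \<open>These functions are flat at 0. The polynomial factor makes the family closed under
  differentiation: for x > 0 the derivative of p(1/x) exp(-1/x) is x^(-2) (p - p')(1/x)
  exp(-1/x).\<close>

definition exp_inv :: "real poly \<Rightarrow> real \<Rightarrow> real" where
  "exp_inv p x = (if x > 0 then poly p (1 / x) * exp (- (1 / x)) else 0)"

lemma poly_exp_tendsto_0: "((\<lambda>z::real. poly p z * exp (- z)) \<longlongrightarrow> 0) at_top"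
proof -
  have "((\<lambda>z. \<Sum>i\<le>degree p. coeff p i * (z ^ i / exp z)) \<longlongrightarrow> (\<Sum>i\<le>degree p. coeff p i * 0)) at_top"
    by (intro tendsto_intros tendsto_power_div_exp_0)
  then show ?thesis
    by (simp add: poly_altdef exp_minus sum_distrib_right divide_inverse mult.assoc)
qed

text \<open>Only x = 0 needs an argument: the difference quotient vanishes on the left, and on the
  right it is z p(z) exp(-z) at z = 1/x, which tends to 0.\<close>

lemma exp_inv_has_derivative:
  "(exp_inv p has_real_derivative exp_inv ([:0, 0, 1:] * (p - pderiv p)) x) (at x)"
proof -
  consider "x > 0" | "x < 0" | "x = 0" by linarith
  then show ?thesis
  proof cases
    case 1
    have "((\<lambda>x. poly p (1 / x) * exp (- (1 / x))) has_real_derivative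
        exp_inv ([:0, 0, 1:] * (p - pderiv p)) x) (at x)"
      using 1 by (auto intro!: derivative_eq_intros
          simp: exp_inv_def field_simps power2_eq_square)
    then show ?thesis
    proof (rule DERIV_cong_ev[THEN iffD1, rotated 3])
      show "\<forall>\<^sub>F y in nhds x. poly p (1 / y) * exp (- (1 / y)) = exp_inv p y"
        using eventually_gt_at_top order_tendstoD(1)[OF filterlim_ident 1]
        by (auto simp: exp_inv_def elim!: eventually_mono)
    qed simp_all
  next
    case 2
    have "((\<lambda>x. 0) has_real_derivative exp_inv ([:0, 0, 1:] * (p - pderiv p)) x) (at x)"
      using 2 by (simp add: exp_inv_def)
    then show ?thesis
    proof (rule DERIV_cong_ev[THEN iffD1, rotated 3])
      show "\<forall>\<^sub>F y in nhds x. 0 = exp_inv p y"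
        using order_tendstoD(2)[OF filterlim_ident 2]
        by (auto simp: exp_inv_def elim!: eventually_mono)
    qed simp_all
  next
    case 3
    have l: "((\<lambda>y. exp_inv p y / y) \<longlongrightarrow> 0) (at_left 0)"
      by (rule Lim_transform_eventually[OF tendsto_const])
        (auto simp: exp_inv_def eventually_at_filter)
    have "((\<lambda>y. poly ([:0, 1:] * p) (inverse y) * exp (- inverse y)) \<longlongrightarrow> 0) (at_right (0::real))"
      by (rule filterlim_compose[OF poly_exp_tendsto_0 filterlim_inverse_at_top_right])
    then have r: "((\<lambda>y. exp_inv p y / y) \<longlongrightarrow> 0) (at_right 0)"
      by (rule Lim_transform_eventually)
        (auto simp: exp_inv_def eventually_at_filter inverse_eq_divide)
    have "((\<lambda>y. exp_inv p y / y) \<longlongrightarrow> 0) (at 0)"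
      using l r by (simp add: filterlim_split_at)
    then show ?thesis
      using 3 by (simp add: has_field_derivative_iff exp_inv_def)
  qed
qed

text \<open>Iterating a choice of derivative inside the class \<open>P\<close> yields the whole
  sequence that \<open>smooth\<close> demands, so a formula for the n-th derivative is replaced by
  closure under one differentiation.\<close>

lemma smooth_coinduct:
  assumes P: "P f"
    and step: "\<And>g. P g \<Longrightarrow> \<exists>g'. P g' \<and> (\<forall>x. (g has_vector_derivative g' x) (at x))"
  shows "smooth f"
proof -
  obtain d where d: "\<And>g. P g \<Longrightarrow> P (d g) \<and> (\<forall>x. (g has_vector_derivative d g x) (at x))"
    using step by metis
  define D where "D n = (d ^^ n) f" for n :: nat
  have "P (D n)" for n by (induction n) (use P d in \<open>auto simp: D_def\<close>)
  then have "(D n has_vector_derivative D (Suc n) x) (at x)" for n x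
    using d[of "D n"] by (simp add: D_def)
  moreover have "D 0 = f" by (simp add: D_def)
  ultimately show ?thesis unfolding smooth_def by blast
qed

text \<open>The smallest class that contains the bumps and is closed under derivatives. The product
  rule gives two summands, and the inner derivatives \<open>n\<close> and \<open>- n\<close> are
  absorbed into the polynomial of the first factor, so \<open>a\<close>, \<open>b\<close>,
  \<open>n\<close>, \<open>c\<close> can stay fixed.\<close>

inductive_set bump_algebra :: "real \<Rightarrow> real \<Rightarrow> real \<Rightarrow> complex \<Rightarrow> (real \<Rightarrow> complex) set"
  for a b n c where
  bump: "(\<lambda>x. c * of_real (exp_inv p (n * (x - a)) * exp_inv q (n * (b - x)))) \<in> bump_algebra a b n c"
| add: "f \<in> bump_algebra a b n c \<Longrightarrow> g \<in> bump_algebra a b n c \<Longrightarrow>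
    (\<lambda>x. f x + g x) \<in> bump_algebra a b n c"

lemma smooth_bump_algebra:
  assumes "f \<in> bump_algebra a b n c"
  shows "smooth f"
proof (rule smooth_coinduct[of "\<lambda>f. f \<in> bump_algebra a b n c", OF assms])
  fix g assume "g \<in> bump_algebra a b n c"
  then show "\<exists>g'. g' \<in> bump_algebra a b n c \<and> (\<forall>x. (g has_vector_derivative g' x) (at x))"
  proof induction
    case (bump p q)
    let ?d = "\<lambda>p. [:0, 0, 1:] * (p - pderiv p)"
    let ?g' = "\<lambda>x. c * of_real (exp_inv (smult n (?d p)) (n * (x - a)) * exp_inv q (n * (b - x)))
      + c * of_real (exp_inv (smult (- n) p) (n * (x - a)) * exp_inv (?d q) (n * (b - x)))"
    have sm: "exp_inv (smult r p) y = r * exp_inv p y" for r p y by (simp add: exp_inv_def)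
    have "((\<lambda>x. exp_inv p (n * (x - a)) * exp_inv q (n * (b - x))) has_real_derivative
        exp_inv (smult n (?d p)) (n * (x - a)) * exp_inv q (n * (b - x)) +
        exp_inv (smult (- n) p) (n * (x - a)) * exp_inv (?d q) (n * (b - x))) (at x)" for x
    proof -
      have "((\<lambda>x. exp_inv p (n * (x - a))) has_real_derivative exp_inv (?d p) (n * (x - a)) * n) (at x)"
        by (rule DERIV_chain2[OF exp_inv_has_derivative]) (auto intro!: derivative_eq_intros)
      moreover have "((\<lambda>x. exp_inv q (n * (b - x))) has_real_derivative exp_inv (?d q) (n * (b - x)) * (- n)) (at x)"
        by (rule DERIV_chain2[OF exp_inv_has_derivative]) (auto intro!: derivative_eq_intros)
      ultimately show ?thesis
        by (rule DERIV_cong[OF DERIV_mult]) (simp only: sm, simp add: algebra_simps)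
    qed
    then have "((\<lambda>x. c * of_real (exp_inv p (n * (x - a)) * exp_inv q (n * (b - x)))) has_vector_derivative ?g' x) (at x)" for x
      by (intro has_vector_derivative_eq_rhs[OF has_vector_derivative_mult_right[OF has_vector_derivative_of_real]])
        (auto simp: has_real_derivative_iff_has_vector_derivative distrib_left)
    moreover have "?g' \<in> bump_algebra a b n c" by (intro bump_algebra.intros)
    ultimately show ?case by blast
  next
    case (add f g)
    then obtain f' g' where "f' \<in> bump_algebra a b n c" "g' \<in> bump_algebra a b n c"
      "\<And>x. (f has_vector_derivative f' x) (at x)" "\<And>x. (g has_vector_derivative g' x) (at x)"
      by blast
    then show ?case
      by (intro exI[of _ "\<lambda>x. f' x + g' x"]) (auto intro: bump_algebra.intros has_vector_derivative_add)
  qed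
qed

lemma Ccomp_funI:
  assumes "smooth f" "0 < a" "\<And>x. x \<notin> {a..b} \<Longrightarrow> f x = 0"
  shows "f \<in> Ccomp_fun"
proof -
  have "{x. f x \<noteq> 0} \<subseteq> {a..b}" using assms(3) by blast
  then have c: "closure {x. f x \<noteq> 0} \<subseteq> {a..b}" by (intro closure_minimal) auto
  then have "bounded (closure {x. f x \<noteq> 0})" by (rule bounded_subset[OF bounded_closed_interval])
  then have "compact (closure {x. f x \<noteq> 0})" by (simp only: compact_eq_bounded_closed closed_closure simp_thms)
  moreover have "{a..b} \<subseteq> {0<..}" using assms(2) by auto
  ultimately show ?thesis
    unfolding Ccomp_fun_def using subset_trans[OF c] assms(1) by blast
qed

lemma Ccomp_funE:
  assumes "f \<in> Ccomp_fun"
  obtains a b where "0 < a" "a < b" "\<And>x. x \<notin> {a..b} \<Longrightarrow> f x = 0"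
proof -
  let ?K = "closure {x. f x \<noteq> 0}"
  have K: "compact ?K" "?K \<subseteq> {0<..}" using assms by (auto simp: Ccomp_fun_def)
  have sub: "x \<in> ?K" if "f x \<noteq> 0" for x
    by (rule subsetD[OF closure_subset]) (simp add: that)
  show ?thesis
  proof (cases "?K = {}")
    case True
    then show ?thesis using sub by (intro that[of 1 2]) auto
  next
    case False
    obtain a where a: "a \<in> ?K" "\<And>x. x \<in> ?K \<Longrightarrow> a \<le> x"
      using compact_attains_inf[OF K(1) False] by blast
    obtain b where b: "b \<in> ?K" "\<And>x. x \<in> ?K \<Longrightarrow> x \<le> b"
      using compact_attains_sup[OF K(1) False] by blast
    have "x \<in> {a..b+1}" if "f x \<noteq> 0" for x using a(2) b(2) sub[OF that] by fastforce
    then show ?thesis using a(1) b(2)[OF a(1)] K(2) by (intro that[of a "b + 1"]) auto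
  qed
qed

lemma bump_in_Ccomp_fun:
  assumes "0 < a" "0 < n"
  shows "(\<lambda>x. c * of_real (exp_inv 1 (n * (x - a)) * exp_inv 1 (n * (b - x)))) \<in> Ccomp_fun"
proof (rule Ccomp_funI[OF smooth_bump_algebra[OF bump_algebra.bump] assms(1)])
  fix x assume "x \<notin> {a..b}"
  then have "n * (x - a) \<le> 0 \<or> n * (b - x) \<le> 0" using assms(2) by (auto simp: mult_le_0_iff)
  then show "c * of_real (exp_inv 1 (n * (x - a)) * exp_inv 1 (n * (b - x))) = 0"
    by (auto simp: exp_inv_def)
qed

lemma exp_inv_1_bounds: "0 \<le> exp_inv 1 x" "exp_inv 1 x \<le> 1"
  by (auto simp: exp_inv_def)

text \<open>The product of two such dilations, at \<open>x - a\<close> and at \<open>b - x\<close>,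
  is a test function tending boundedly to the indicator of the open interval from a to b.
  \<open>Suc\<close> keeps the dilation factor positive.\<close>

lemma exp_inv_1_tendsto_indicator:
  "(\<lambda>n. exp_inv 1 (real (Suc n) * y)) \<longlonglongrightarrow> indicator {0<..} y"
proof (cases "y > 0")
  case True
  have "(\<lambda>n. exp (- (1 / real (Suc n) * (1 / y)))) \<longlonglongrightarrow> exp (- (0 * (1 / y)))"
    by (intro tendsto_intros LIMSEQ_Suc[OF lim_1_over_n])
  then show ?thesis using True by (simp add: exp_inv_def)
next
  case False
  then have "exp_inv 1 (real (Suc n) * y) = 0" for n by (simp add: exp_inv_def zero_less_mult_iff)
  then show ?thesis using False by simp
qed

lemma Ccomp_fun_continuous: "f \<in> Ccomp_fun \<Longrightarrow> continuous_on UNIV f"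
  unfolding Ccomp_fun_def smooth_def
  by (auto simp: continuous_on_eq_continuous_at intro: has_vector_derivative_continuous)

lemma Ccomp_fun_L2_half: 
  assumes "f \<in> Ccomp_fun" shows "L2_half f"
proof -
  obtain a b where "0 < a" "\<And>x. x \<notin> {a..b} \<Longrightarrow> f x = 0" using assms by (rule Ccomp_funE) blast
  then show ?thesis
    using square_integrable_Ccomp_fun[OF assms] borel_measurable_continuous_onI[OF Ccomp_fun_continuous[OF assms]]
    by (auto simp: L2_half_iff)
qed

lemma Ccomp_fun_bounded:
  assumes "f \<in> Ccomp_fun" obtains B where "\<And>x. cmod (f x) \<le> B"
proof -
  obtain a b where ab: "0 < a" "a < b" "\<And>x. x \<notin> {a..b} \<Longrightarrow> f x = 0" using assms by (rule Ccomp_funE) blast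
  have "compact (f ` {a..b})"
    by (intro compact_continuous_image continuous_on_subset[OF Ccomp_fun_continuous[OF assms]]) auto
  then obtain B where B: "\<And>x. x \<in> {a..b} \<Longrightarrow> cmod (f x) \<le> B"
    using compact_imp_bounded by (force simp: bounded_iff)
  have "0 \<le> B" using B[of a] ab by (auto intro: order_trans[OF norm_ge_zero])
  then have "cmod (f x) \<le> B" for x using B ab(3) by (cases "x \<in> {a..b}") auto
  then show ?thesis by (rule that)
qed

lemma Ccomp_fun_integrable:
  assumes "f \<in> Ccomp_fun" shows "integrable lborel f"
proof -
  obtain a b where ab: "0 < a" "a < b" "\<And>x. x \<notin> {a..b} \<Longrightarrow> f x = 0" using assms by (rule Ccomp_funE) blast
  have "integrable lborel (\<lambda>x. indicator {a..b} x *\<^sub>R f x)"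
    by (intro borel_integrable_compact continuous_on_subset[OF Ccomp_fun_continuous[OF assms]]) auto
  also have "(\<lambda>x. indicator {a..b} x *\<^sub>R f x) = f"
    using ab(3) by (auto simp: indicator_def fun_eq_iff)
  finally show ?thesis .
qed

lemma smooth_add: "smooth f \<Longrightarrow> smooth g \<Longrightarrow> smooth (\<lambda>x. f x + g x)"
proof -
  assume "smooth f" "smooth g"
  then obtain D E where D: "D 0 = f" "\<And>n x. (D n has_vector_derivative D (Suc n) x) (at x)"
    and E: "E 0 = g" "\<And>n x. (E n has_vector_derivative E (Suc n) x) (at x)"
    unfolding smooth_def by blast
  then show ?thesis unfolding smooth_def
    by (intro exI[of _ "\<lambda>n x. D n x + E n x"]) (auto intro: has_vector_derivative_add)
qed

lemma smooth_mult_left: "smooth f \<Longrightarrow> smooth (\<lambda>x. c * f x)"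
  unfolding smooth_def
  by (elim exE, rule_tac x = "\<lambda>n x. c * D n x" in exI) (auto intro: has_vector_derivative_mult_right)

lemma Ccomp_fun_add:
  assumes "f \<in> Ccomp_fun" "g \<in> Ccomp_fun" shows "(\<lambda>x. f x + g x) \<in> Ccomp_fun"
proof -
  obtain a b where ab: "0 < a" "\<And>x. x \<notin> {a..b} \<Longrightarrow> f x = 0" using assms(1) by (rule Ccomp_funE) blast
  obtain c d where cd: "0 < c" "\<And>x. x \<notin> {c..d} \<Longrightarrow> g x = 0" using assms(2) by (rule Ccomp_funE) blast
  have "smooth (\<lambda>x. f x + g x)" using assms by (intro smooth_add) (auto simp: Ccomp_fun_def)
  moreover have "f x + g x = 0" if "x \<notin> {min a c..max b d}" for x
  proof -
    have "x \<notin> {a..b}" "x \<notin> {c..d}" using that by auto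
    then show ?thesis using ab(2) cd(2) by simp
  qed
  ultimately show ?thesis using ab(1) cd(1) by (intro Ccomp_funI[of _ "min a c" "max b d"]) auto
qed

lemma Ccomp_fun_mult_left:
  assumes "f \<in> Ccomp_fun" shows "(\<lambda>x. c * f x) \<in> Ccomp_fun"
proof -
  obtain a b where ab: "0 < a" "\<And>x. x \<notin> {a..b} \<Longrightarrow> f x = 0" using assms(1) by (rule Ccomp_funE) blast
  have "smooth (\<lambda>x. c * f x)" using assms by (intro smooth_mult_left) (auto simp: Ccomp_fun_def)
  then show ?thesis using ab by (intro Ccomp_funI[of _ a b]) auto
qed

section \<open>The fundamental lemma of the calculus of variations on the half-line\<close>

text \<open>Open intervals form an intersection-stable generator of the Borel sets, and sets with
  vanishing integral form a Dynkin system; the assumption \<open>total\<close> supplies the step to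
  complements.\<close>

lemma AE_zero_if_interval_integrals_zero:
  fixes f :: "real \<Rightarrow> complex"
  assumes f: "integrable lborel f"
    and z: "\<And>a b. (LINT x:{a<..<b}|lborel. f x) = 0"
    and total: "(LINT x|lborel. f x) = 0"
  shows "AE x in lborel. f x = 0"
proof (rule sigma_finite_measure.density_zero[OF sigma_finite_lborel f])
  have si: "set_integrable lborel A f" if "A \<in> sets borel" for A
    using that f by (auto simp: set_integrable_def intro: integrable_mult_indicator)
  let ?G = "range (\<lambda>(a, b). {a<..<b::real})"
  have G: "sets borel = sigma_sets UNIV ?G"
    using borel_eq_box[where 'a=real] by (metis (no_types, lifting) box_real(1) image_cong sets_measure_of subset_UNIV Pow_UNIV case_prod_beta)
  fix A :: "real set" assume "A \<in> sets lborel"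
  then have A: "A \<in> sigma_sets UNIV ?G" by (simp add: G)
  have IS: "Int_stable ?G"
  proof -
    have "{a<..<b} \<inter> {c<..<d} = {max a c<..<min b d}" for a b c d :: real by auto
    then show ?thesis unfolding Int_stable_def by fastforce
  qed
  have sub: "?G \<subseteq> Pow UNIV" by simp
  show "(LINT x:A|lborel. f x) = 0"
    using IS sub A
  proof (induction rule: sigma_sets_induct_disjoint)
    case (basic A) then show ?case using z by auto
  next
    case empty then show ?case by (simp add: set_lebesgue_integral_def)
  next
    case (compl A)
    then have A: "A \<in> sets borel" by (simp add: G)
    have "(LINT x:A \<union> (UNIV - A)|lborel. f x) = (LINT x:A|lborel. f x) + (LINT x:UNIV - A|lborel. f x)"
      using A by (intro set_integral_Un si) auto
    also have "A \<union> (UNIV - A) = UNIV" by auto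
    finally show ?case using compl total by (simp add: set_lebesgue_integral_def)
  next
    case (union A)
    then have A: "A i \<in> sets borel" for i by (auto simp: G)
    have "(LINT x:(\<Union>i. A i)|lborel. f x) = (\<Sum>i. (LINT x:(A i)|lborel. f x))"
      using A union(1) by (intro lebesgue_integral_countable_add si) (auto simp: disjoint_family_on_def)
    then show ?case using union by simp
  qed
qed

text \<open>Dominated convergence along the bumps turns the hypothesis into vanishing integrals over
  intervals. Only local integrability on (0,\<infinity>) is assumed, because a Hankel integral may
  be singular at 0. Only real parts are assumed to vanish, because the inner product of
  \<open>l2\<close> is a real part.\<close>

lemma fundamental_lemma:
  fixes u :: "real \<Rightarrow> complex"
  assumes [measurable]: "u \<in> borel_measurable borel"
    and int: "\<And>a b. 0 < a \<Longrightarrow> a < b \<Longrightarrow> set_integrable lborel {a..b} u"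
    and orth: "\<And>\<phi>. \<phi> \<in> Ccomp_fun \<Longrightarrow> Re (\<integral>x. \<phi> x * u x \<partial>lborel) = 0"
  shows "AE x in lborel. 0 < x \<longrightarrow> u x = 0"
proof -
  have zero: "(LINT x:{a<..<b}|lborel. u x) = 0" if ab: "0 < a" "a < b" for a b
  proof -
    have "Re (c * (LINT x:{a<..<b}|lborel. u x)) = 0" for c
    proof -
      define \<beta> where "\<beta> n x = c * of_real (exp_inv 1 (real (Suc n) * (x - a)) * exp_inv 1 (real (Suc n) * (b - x)))" for n x
      have \<beta>: "\<beta> n \<in> Ccomp_fun" for n
        unfolding \<beta>_def by (rule bump_in_Ccomp_fun) (use ab in auto)
      have [measurable]: "\<beta> n \<in> borel_measurable borel" for n
        by (rule L2_half_borel[OF Ccomp_fun_L2_half[OF \<beta>]])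
      have "(\<lambda>n. \<integral>x. \<beta> n x * u x \<partial>lborel) \<longlonglongrightarrow> (\<integral>x. c * (indicator {a<..<b} x *\<^sub>R u x) \<partial>lborel)"
      proof (rule integral_dominated_convergence)
        show "integrable lborel (\<lambda>x. cmod c * norm (indicator {a..b} x *\<^sub>R u x))"
          using int[OF ab] unfolding set_integrable_def
          by (intro integrable_mult_right integrable_norm)
        show "AE x in lborel. (\<lambda>n. \<beta> n x * u x) \<longlonglongrightarrow> c * (indicator {a<..<b} x *\<^sub>R u x)"
        proof (rule AE_I2)
          fix x
          have "(\<lambda>n. \<beta> n x * u x) \<longlonglongrightarrow> c * of_real (indicator {0<..} (x - a) * indicator {0<..} (b - x)) * u x"
            unfolding \<beta>_def by (intro tendsto_intros exp_inv_1_tendsto_indicator)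
          also have "c * of_real (indicator {0<..} (x - a) * indicator {0<..} (b - x)) * u x
              = c * (indicator {a<..<b} x *\<^sub>R u x)"
            by (auto simp: indicator_def)
          finally show "(\<lambda>n. \<beta> n x * u x) \<longlonglongrightarrow> c * (indicator {a<..<b} x *\<^sub>R u x)" .
        qed
        show "AE x in lborel. norm (\<beta> n x * u x) \<le> cmod c * norm (indicator {a..b} x *\<^sub>R u x)" for n
        proof (rule AE_I2)
          fix x
          have "norm (\<beta> n x) \<le> cmod c * indicator {a..b} x"
          proof (cases "x \<in> {a..b}")
            case True
            have "cmod c * \<bar>exp_inv 1 (real (Suc n) * (x - a)) * exp_inv 1 (real (Suc n) * (b - x))\<bar> \<le> cmod c * 1"
              by (intro mult_left_mono) (auto simp: abs_mult exp_inv_1_bounds intro!: mult_le_one)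
            then show ?thesis using True unfolding \<beta>_def norm_mult norm_of_real by simp
          next
            case False
            then have "real (Suc n) * (x - a) \<le> 0 \<or> real (Suc n) * (b - x) \<le> 0"
              by (auto simp: mult_le_0_iff)
            then show ?thesis by (auto simp: \<beta>_def exp_inv_def)
          qed
          then show "norm (\<beta> n x * u x) \<le> cmod c * norm (indicator {a..b} x *\<^sub>R u x)"
            by (simp add: norm_mult mult_right_mono flip: mult.assoc)
        qed
      qed measurable
      then have "(\<lambda>n. Re (\<integral>x. \<beta> n x * u x \<partial>lborel)) \<longlonglongrightarrow> Re (\<integral>x. c * (indicator {a<..<b} x *\<^sub>R u x) \<partial>lborel)"
        by (rule tendsto_Re)
      then have "Re (\<integral>x. c * (indicator {a<..<b} x *\<^sub>R u x) \<partial>lborel) = 0"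
        using orth[OF \<beta>] by (simp add: LIMSEQ_const_iff)
      moreover have "(\<integral>x. c * (indicator {a<..<b} x *\<^sub>R u x) \<partial>lborel) = c * (LINT x:{a<..<b}|lborel. u x)"
        unfolding set_lebesgue_integral_def by (rule integral_mult_right_zero)
      ultimately show ?thesis by simp
    qed
    \<comment> \<open>Multiplying the test functions by 1 and by the imaginary unit recovers both
      parts of the integral.\<close>
    from this[of 1] this[of \<i>] show ?thesis by (simp add: complex_eq_iff)
  qed
  \<comment> \<open>These intervals exhaust (0,\<infinity>). The double \<open>Suc\<close> makes the
    first of them, from 1 to 2, nonempty.\<close>
  have "AE x in lborel. x \<in> {1 / Suc n<..<Suc (Suc n)} \<longrightarrow> u x = 0" for n :: nat
  proof -
    let ?l = "1 / real (Suc n)" and ?r = "real (Suc (Suc n))"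
    have "?l \<le> 1" by simp
    then have lr: "0 < ?l" "?l < ?r" by (simp, linarith)
    let ?f = "\<lambda>x. indicator {?l<..<?r} x *\<^sub>R u x"
    have "set_integrable lborel {?l<..<?r} u"
      by (rule set_integrable_subset[OF int[OF lr]]) auto
    then have f: "integrable lborel ?f" by (simp add: set_integrable_def)
    have eq: "(LINT x:{a<..<b}|lborel. ?f x) = (LINT x:{max a ?l<..<min b ?r}|lborel. u x)" for a b
      unfolding set_lebesgue_integral_def
      by (rule Bochner_Integration.integral_cong) (auto simp: indicator_def)
    have "AE x in lborel. ?f x = 0"
    proof (rule AE_zero_if_interval_integrals_zero[OF f])
      show "(LINT x:{a<..<b}|lborel. ?f x) = 0" for a b
      proof (cases "max a ?l < min b ?r")
        case True
        then show ?thesis unfolding eq using less_le_trans[OF lr(1) max.cobounded2] by (intro zero)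
      next
        case False
        then have "{max a ?l<..<min b ?r} = {}" by auto
        then show ?thesis unfolding eq by (simp add: set_lebesgue_integral_def)
      qed
      show "(LINT x|lborel. ?f x) = 0" using zero[OF lr] by (simp add: set_lebesgue_integral_def)
    qed
    then show ?thesis by eventually_elim (auto simp: indicator_def split: if_splits)
  qed
  then have "AE x in lborel. \<forall>n::nat. x \<in> {1 / Suc n<..<Suc (Suc n)} \<longrightarrow> u x = 0"
    by (intro AE_all_countable[THEN iffD2] allI)
  then show ?thesis
  proof eventually_elim
    case (elim x)
    show ?case
    proof
      assume x: "0 < x"
      obtain n where n: "1 / x < real n" using reals_Archimedean2 by blast
      obtain m where m: "x < real m" using reals_Archimedean2 by blast
      have "0 < real n" using n x by (intro le_less_trans[OF _ n]) simp
      have "1 / x < real (Suc (n + m))" using n by simp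
      then have "1 / real (Suc (n + m)) < x" using x by (simp add: field_simps)
      moreover have "x < real (Suc (Suc (n + m)))" using m by simp
      ultimately show "u x = 0" using elim[rule_format, of "n + m"] by simp
    qed
  qed
qed

subsection \<open>Convolution\<close>

definition line_norm :: "(real \<Rightarrow> complex) \<Rightarrow> real" where
  "line_norm f = sqrt (\<integral>x. (cmod (f x))\<^sup>2 \<partial>lborel)"

lemma line_norm_nonneg: "0 \<le> line_norm f"
  by (simp add: line_norm_def)

lemma norm_l2_class_eq_line_norm: "L2_half f \<Longrightarrow> norm (l2_class f) = line_norm f"
  by (simp add: line_norm_def norm_l2_class_half)

text \<open>Cauchy-Schwarz from the nonnegative quadratic function t \<mapsto> |(|f| - t |g|)|^2.
  The moduli stand inside the integral so that the bound can be used in Tonelli arguments.\<close>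

lemma
  assumes "L2_line f" "L2_line g"
  shows L2_line_mult_integrable: "integrable lborel (\<lambda>x. f x * g x)"
    and L2_line_mult_bound: "(\<integral>x. cmod (f x) * cmod (g x) \<partial>lborel) \<le> line_norm f * line_norm g"
proof -
  have m[measurable]: "f \<in> borel_measurable borel" "g \<in> borel_measurable borel"
    and i: "integrable lborel (\<lambda>x. (cmod (f x))\<^sup>2)" "integrable lborel (\<lambda>x. (cmod (g x))\<^sup>2)"
    using assms by (auto simp: L2_line_def)
  have le: "cmod (f x) * cmod (g x) \<le> (cmod (f x))\<^sup>2 + (cmod (g x))\<^sup>2" for x
  proof -
    have "0 \<le> (cmod (f x) - cmod (g x))\<^sup>2" "0 \<le> cmod (f x) * cmod (g x)" by simp_all
    then show ?thesis unfolding power2_diff by linarith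
  qed
  show fg: "integrable lborel (\<lambda>x. f x * g x)"
    by (rule Bochner_Integration.integrable_bound[OF Bochner_Integration.integrable_add[OF i]])
      (use le in \<open>auto simp: norm_mult\<close>)
  have I: "integrable lborel (\<lambda>x. cmod (f x) * cmod (g x))"
    using integrable_norm[OF fg] by (simp add: norm_mult)
  define A B I where "A = (\<integral>x. (cmod (f x))\<^sup>2 \<partial>lborel)" and "B = (\<integral>x. (cmod (g x))\<^sup>2 \<partial>lborel)"
    and "I = (\<integral>x. cmod (f x) * cmod (g x) \<partial>lborel)"
  have q: "0 \<le> A - 2 * t * I + t\<^sup>2 * B" for t
  proof -
    have "0 \<le> (\<integral>x. (cmod (f x) - t * cmod (g x))\<^sup>2 \<partial>lborel)" by simp
    also have "\<dots> = (\<integral>x. (cmod (f x))\<^sup>2 - 2 * t * (cmod (f x) * cmod (g x)) + t\<^sup>2 * (cmod (g x))\<^sup>2 \<partial>lborel)"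
      by (simp add: power2_diff power_mult_distrib algebra_simps)
    also have "\<dots> = A - 2 * t * I + t\<^sup>2 * B"
      unfolding A_def B_def I_def using i \<open>integrable lborel (\<lambda>x. cmod (f x) * cmod (g x))\<close> by simp
    finally show ?thesis .
  qed
  have AB: "0 \<le> A" "0 \<le> B" by (auto simp: A_def B_def)
  have "I\<^sup>2 \<le> A * B"
  proof (cases "B = 0")
    case True
    have "I = 0"
    proof (rule ccontr)
      assume "I \<noteq> 0"
      \<comment> \<open>With B = 0 the quadratic is linear in t; this t makes its value A - (A + 1)
        = -1.\<close>
      then show False using q[of "(A + 1) / (2 * I)"] True by (simp add: field_simps)
    qed
    then show ?thesis using AB by simp
  next
    case False
    then have "0 \<le> A - I\<^sup>2 / B" using q[of "I / B"] by (simp add: power2_eq_square field_simps)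
    then show ?thesis using False AB by (simp add: field_simps)
  qed
  then have "I \<le> sqrt (A * B)" by (rule real_le_rsqrt)
  then show "(\<integral>x. cmod (f x) * cmod (g x) \<partial>lborel) \<le> line_norm f * line_norm g"
    by (simp add: I_def A_def B_def line_norm_def real_sqrt_mult)
qed

lemma L2_line_mult_integral_bound:
  assumes "L2_line f" "L2_line g"
  shows "cmod (\<integral>x. f x * g x \<partial>lborel) \<le> line_norm f * line_norm g"
  using integral_norm_bound[of lborel "\<lambda>x. f x * g x"] L2_line_mult_bound[OF assms]
  by (simp add: norm_mult)

lemma L2_line_mult_nn_bound:
  assumes "L2_line f" "L2_line g"
  shows "(\<integral>\<^sup>+x. ennreal (cmod (f x) * cmod (g x)) \<partial>lborel) \<le> ennreal (line_norm f * line_norm g)"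
  using integrable_norm[OF L2_line_mult_integrable[OF assms]] L2_line_mult_bound[OF assms]
  by (subst nn_integral_eq_integral) (auto simp: norm_mult intro!: ennreal_leI)

text \<open>The case c = 1 is translation, and c = -1 is the reflection y \<mapsto> t - y that
  occurs in a convolution.\<close>

lemma
  assumes f: "L2_line f" and c: "\<bar>c\<bar> = 1"
  shows L2_line_affine: "L2_line (\<lambda>x. f (t + c * x))"
    and line_norm_affine: "line_norm (\<lambda>x. f (t + c * x)) = line_norm f"
proof -
  have c0: "c \<noteq> 0" using c by auto
  have [measurable]: "f \<in> borel_measurable borel" using f by (simp add: L2_line_def)
  show "L2_line (\<lambda>x. f (t + c * x))"
    using f lborel_integrable_real_affine[of "\<lambda>x. (cmod (f x))\<^sup>2" c t] c0 by (auto simp: L2_line_def)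
  show "line_norm (\<lambda>x. f (t + c * x)) = line_norm f"
    using lborel_integral_real_affine[OF c0, of "\<lambda>x. (cmod (f x))\<^sup>2" t] c by (simp add: line_norm_def)
qed

lemmas L2_line_shift = L2_line_affine[where c = 1, simplified]
  and line_norm_shift = line_norm_affine[where c = 1, simplified]
  and L2_line_reflect = L2_line_affine[where c = "-1", simplified]
  and line_norm_reflect = line_norm_affine[where c = "-1", simplified]

definition convol :: "(real \<Rightarrow> complex) \<Rightarrow> (real \<Rightarrow> complex) \<Rightarrow> real \<Rightarrow> complex" where
  "convol f g x = (\<integral>y. f y * g (x - y) \<partial>lborel)"

lemma borel_measurable_convol [measurable]:
  assumes [measurable]: "f \<in> borel_measurable borel" "g \<in> borel_measurable borel"
  shows "convol f g \<in> borel_measurable borel"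
  unfolding convol_def by measurable

lemma convol_commute: "convol f g = convol g f"
proof
  fix x
  show "convol f g x = convol g f x"
    unfolding convol_def
    by (subst lborel_integral_real_affine[of "-1" _ x]) (auto simp: mult.commute)
qed

lemma convol_nonpos:
  assumes "\<And>x. x \<le> 0 \<Longrightarrow> f x = 0" "\<And>x. x \<le> 0 \<Longrightarrow> g x = 0" "x \<le> 0"
  shows "convol f g x = 0"
proof -
  have "(\<lambda>y. f y * g (x - y)) = (\<lambda>y. 0)"
    using assms(1) assms(2) assms(3) by (auto simp: fun_eq_iff) (metis diff_le_0_iff_le le_cases order_trans)
  then show ?thesis by (simp add: convol_def)
qed

lemma convol_L2_integrable:
  "L2_line f \<Longrightarrow> L2_line g \<Longrightarrow> integrable lborel (\<lambda>y. f y * g (x - y))"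
  using L2_line_mult_integrable[OF _ L2_line_reflect] by simp

lemma convol_bound: "L2_line f \<Longrightarrow> L2_line g \<Longrightarrow> cmod (convol f g x) \<le> line_norm f * line_norm g"
  unfolding convol_def using L2_line_mult_integral_bound[OF _ L2_line_reflect[of g x], of f] line_norm_reflect[of g x]
  by simp

lemma convol_diff_right:
  "L2_line f \<Longrightarrow> L2_line g \<Longrightarrow> L2_line g' \<Longrightarrow> convol f (\<lambda>x. g x - g' x) x = convol f g x - convol f g' x"
  unfolding convol_def by (simp add: right_diff_distrib convol_L2_integrable)

lemma convol_diff_left:
  "L2_line f \<Longrightarrow> L2_line f' \<Longrightarrow> L2_line g \<Longrightarrow> convol (\<lambda>x. f x - f' x) g x = convol f g x - convol f' g x"
  unfolding convol_def by (simp add: left_diff_distrib convol_L2_integrable)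

lemma convol_add_right:
  "L2_line f \<Longrightarrow> L2_line g \<Longrightarrow> L2_line g' \<Longrightarrow> convol f (\<lambda>x. g x + g' x) x = convol f g x + convol f g' x"
  unfolding convol_def by (simp add: distrib_left convol_L2_integrable)

lemma convol_scaleR_right: "convol f (\<lambda>x. c *\<^sub>R g x) x = c *\<^sub>R convol f g x"
  unfolding convol_def by simp

text \<open>Young's inequality makes the trilinear form \<open>\<integral> (a * b) c\<close> absolutely convergent in each of
  these cases.\<close>

definition trilinear :: "(real \<Rightarrow> complex) \<Rightarrow> (real \<Rightarrow> complex) \<Rightarrow> (real \<Rightarrow> complex) \<Rightarrow> bool" where
  "trilinear a b c \<longleftrightarrow> integrable lborel a \<and> L2_line b \<and> L2_line c \<or>
    L2_line a \<and> integrable lborel b \<and> L2_line c \<or> L2_line a \<and> L2_line b \<and> integrable lborel c \<or>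
    a \<in> borel_measurable borel \<and> (\<exists>B. \<forall>x. cmod (a x) \<le> B) \<and> integrable lborel b \<and> integrable lborel c"

lemma trilinear_borel:
  assumes "trilinear a b c"
  shows "a \<in> borel_measurable borel" "b \<in> borel_measurable borel" "c \<in> borel_measurable borel"
  using assms by (auto simp: trilinear_def L2_line_def dest: borel_measurable_integrable)

text \<open>By Tonelli a finite iterated integral suffices. The order depends on the integrable
  factor: with a or b integrable, the other two are paired first over w by Cauchy-Schwarz; with only
  c integrable, a and b are paired over y.\<close>

lemma trilinear_integrable:
  assumes "trilinear a b c"
  shows "integrable (lborel \<Otimes>\<^sub>M lborel) (\<lambda>(w, y). a y * b (w - y) * c w)"
proof -
  define T :: "(real \<Rightarrow> complex) \<Rightarrow> (real \<Rightarrow> complex) \<Rightarrow> ennreal" where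
    "T a b = (\<integral>\<^sup>+w. \<integral>\<^sup>+y. ennreal (cmod (a y) * cmod (b (w - y)) * cmod (c w)) \<partial>lborel \<partial>lborel)" for a b
  note [measurable] = trilinear_borel[OF assms]
  \<comment> \<open>Stated for local \<open>a\<close> and \<open>b\<close>, so that the second case
    follows by exchanging them through the substitution y \<mapsto> w - y.\<close>
  have first: "T a b < \<infinity>" if ab: "integrable lborel a" "L2_line b" and c: "L2_line c" for a b
  proof -
    have [measurable]: "a \<in> borel_measurable borel" "b \<in> borel_measurable borel"
      using ab by (auto simp: L2_line_def dest: borel_measurable_integrable)
    have "T a b = (\<integral>\<^sup>+y. \<integral>\<^sup>+w. ennreal (cmod (a y) * cmod (b (w - y)) * cmod (c w)) \<partial>lborel \<partial>lborel)"
      unfolding T_def by (rule lborel_pair.Fubini') measurable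
    also have "\<dots> = (\<integral>\<^sup>+y. ennreal (cmod (a y)) * (\<integral>\<^sup>+w. ennreal (cmod (b (w - y)) * cmod (c w)) \<partial>lborel) \<partial>lborel)"
      by (subst nn_integral_cmult[symmetric]) (auto simp: ennreal_mult[symmetric] mult.assoc)
    also have "\<dots> \<le> (\<integral>\<^sup>+y. ennreal (cmod (a y)) * ennreal (line_norm b * line_norm c) \<partial>lborel)"
    proof (intro nn_integral_mono mult_left_mono)
      fix y
      have "(\<integral>\<^sup>+w. ennreal (cmod (b (- y + w)) * cmod (c w)) \<partial>lborel) \<le> ennreal (line_norm b * line_norm c)"
        using L2_line_mult_nn_bound[OF L2_line_shift[OF ab(2), of "-y"] c] line_norm_shift[OF ab(2), of "-y"] by simp
      then show "(\<integral>\<^sup>+w. ennreal (cmod (b (w - y)) * cmod (c w)) \<partial>lborel) \<le> ennreal (line_norm b * line_norm c)"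
        by simp
    qed simp
    also have "\<dots> = (\<integral>\<^sup>+y. ennreal (cmod (a y)) \<partial>lborel) * ennreal (line_norm b * line_norm c)"
      by (rule nn_integral_multc) measurable
    also have "\<dots> < \<infinity>"
      using ab(1) by (auto simp: integrable_iff_bounded ennreal_mult_less_top)
    finally show ?thesis .
  qed
  have "T a b < \<infinity>"
  proof -
    consider "integrable lborel a" "L2_line b" "L2_line c" | "L2_line a" "integrable lborel b" "L2_line c"
      | "L2_line a" "L2_line b" "integrable lborel c"
      | B where "\<And>x. cmod (a x) \<le> B" "integrable lborel b" "integrable lborel c"
      using assms by (auto simp: trilinear_def)
    then show ?thesis
    proof cases
      case 1 then show ?thesis by (rule first)
    next
      case 2
      have "(\<integral>\<^sup>+y. ennreal (cmod (a y) * cmod (b (w - y)) * cmod (c w)) \<partial>lborel)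
        = (\<integral>\<^sup>+y. ennreal (cmod (b y) * cmod (a (w - y)) * cmod (c w)) \<partial>lborel)" for w
        by (subst nn_integral_real_affine[of _ "-1" w]) (auto simp: mult_ac)
      then have "T a b = T b a" by (simp add: T_def)
      then show ?thesis using first[of b a] 2 by simp
    next
      case 3
      have "T a b = (\<integral>\<^sup>+w. (\<integral>\<^sup>+y. ennreal (cmod (a y) * cmod (b (w - y))) \<partial>lborel) * ennreal (cmod (c w)) \<partial>lborel)"
        unfolding T_def by (subst nn_integral_multc[symmetric]) (auto simp: ennreal_mult[symmetric])
      also have "\<dots> \<le> (\<integral>\<^sup>+w. ennreal (line_norm a * line_norm b) * ennreal (cmod (c w)) \<partial>lborel)"
      proof (intro nn_integral_mono mult_right_mono)
        fix w
        show "(\<integral>\<^sup>+y. ennreal (cmod (a y) * cmod (b (w - y))) \<partial>lborel) \<le> ennreal (line_norm a * line_norm b)"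
          using L2_line_mult_nn_bound[OF 3(1) L2_line_reflect[OF 3(2), of w]] line_norm_reflect[OF 3(2), of w] by simp
      qed simp
      also have "\<dots> = ennreal (line_norm a * line_norm b) * (\<integral>\<^sup>+w. ennreal (cmod (c w)) \<partial>lborel)"
        by (rule nn_integral_cmult) measurable
      also have "\<dots> < \<infinity>" using 3(3) by (auto simp: integrable_iff_bounded ennreal_mult_less_top)
      finally show ?thesis .
    next
      \<comment> \<open>This case serves the autocorrelation of a square integrable function, which
        is bounded but in general not integrable.\<close>
      case (4 B)
      let ?b = "\<integral>\<^sup>+y. ennreal (cmod (b y)) \<partial>lborel"
      have "0 \<le> B" using 4(1)[of 0] norm_ge_zero order_trans by blast
      have "T a b \<le> (\<integral>\<^sup>+w. (\<integral>\<^sup>+y. ennreal B * ennreal (cmod (b (w - y))) * ennreal (cmod (c w)) \<partial>lborel) \<partial>lborel)"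
        unfolding T_def using 4(1) \<open>0 \<le> B\<close>
        by (intro nn_integral_mono) (auto simp: ennreal_mult[symmetric] intro!: ennreal_leI mult_right_mono)
      also have "\<dots> = (\<integral>\<^sup>+w. ennreal B * ?b * ennreal (cmod (c w)) \<partial>lborel)"
      proof (rule nn_integral_cong)
        fix w
        have "?b = (\<integral>\<^sup>+y. ennreal (cmod (b (w - y))) \<partial>lborel)"
          by (subst nn_integral_real_affine[of _ "-1" w]) auto
        then show "(\<integral>\<^sup>+y. ennreal B * ennreal (cmod (b (w - y))) * ennreal (cmod (c w)) \<partial>lborel)
          = ennreal B * ?b * ennreal (cmod (c w))"
          by (simp add: nn_integral_multc nn_integral_cmult)
      qed
      also have "\<dots> = ennreal B * ?b * (\<integral>\<^sup>+w. ennreal (cmod (c w)) \<partial>lborel)"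
        by (rule nn_integral_cmult) measurable
      also have "\<dots> < \<infinity>" using 4 by (auto simp: integrable_iff_bounded ennreal_mult_less_top)
      finally show ?thesis .
    qed
  qed
  moreover have "(\<integral>\<^sup>+p. ennreal (norm (case p of (w, y) \<Rightarrow> a y * b (w - y) * c w)) \<partial>(lborel \<Otimes>\<^sub>M lborel)) = T a b"
    unfolding T_def
    by (subst lborel.nn_integral_fst[symmetric]) (auto simp: norm_mult)
  ultimately show ?thesis by (auto simp: integrable_iff_bounded)
qed

text \<open>After the substitution w = x + y the right-hand side is the Hankel form with kernel
  \<open>c\<close>. This is the link between Hankel operators and convolutions.\<close>

lemma integral_convol_mult:
  assumes "trilinear a b c"
  shows "(\<integral>w. convol a b w * c w \<partial>lborel) = (\<integral>y. a y * (\<integral>x. b x * c (x + y) \<partial>lborel) \<partial>lborel)"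
proof -
  have "(\<integral>w. convol a b w * c w \<partial>lborel) = (\<integral>w. \<integral>y. a y * b (w - y) * c w \<partial>lborel \<partial>lborel)"
    by (simp add: convol_def)
  also have "\<dots> = (\<integral>y. \<integral>w. a y * b (w - y) * c w \<partial>lborel \<partial>lborel)"
    by (rule lborel_pair.Fubini_integral[symmetric, OF trilinear_integrable[OF assms]])
  also have "\<dots> = (\<integral>y. a y * (\<integral>x. b x * c (x + y) \<partial>lborel) \<partial>lborel)"
  proof (rule Bochner_Integration.integral_cong)
    fix y
    show "(\<integral>w. a y * b (w - y) * c w \<partial>lborel) = a y * (\<integral>x. b x * c (x + y) \<partial>lborel)"
      by (subst lborel_integral_real_affine[of 1 _ y]) (auto simp: mult.assoc add.commute)
  qed simp
  finally show ?thesis .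
qed

text \<open>An instance of \<open>integral_convol_mult\<close> with third factor y \<mapsto>
  \<phi>(x - y). The product k * f may fail to be square integrable; bracketing the other way lets f
  absorb the integrable \<phi> first.\<close>

lemma convol_assoc:
  assumes k: "L2_line k" and f: "L2_line f" and \<phi>: "integrable lborel \<phi>"
  shows "convol (convol k f) \<phi> x = convol k (convol f \<phi>) x"
proof -
  have "integrable lborel (\<lambda>y. \<phi> (x + (-1) * y))"
    using \<phi> by (intro lborel_integrable_real_affine) auto
  then have "trilinear k f (\<lambda>y. \<phi> (x - y))" using k f by (simp add: trilinear_def)
  from integral_convol_mult[OF this] show ?thesis
    unfolding convol_def[of "convol k f"] convol_def[of k "convol f \<phi>"] convol_def[of f \<phi>]
    by (simp add: algebra_simps)
qed

text \<open>Splitting |\<phi>| into two square roots, Cauchy-Schwarz bounds |\<phi> * u|^2 by the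
  integral of |\<phi>| times |\<phi>| * |u|^2 wherever the latter is finite, hence almost
  everywhere; Tonelli integrates this bound.\<close>

lemma
  assumes \<phi>: "integrable lborel \<phi>" and u: "L2_line u"
  shows young_L2: "L2_line (convol \<phi> u)"
    and young_bound: "line_norm (convol \<phi> u) \<le> (\<integral>y. cmod (\<phi> y) \<partial>lborel) * line_norm u"
proof -
  have [measurable]: "\<phi> \<in> borel_measurable borel" "u \<in> borel_measurable borel"
    using \<phi> u by (auto simp: L2_line_def dest: borel_measurable_integrable)
  define A where "A = (\<integral>y. cmod (\<phi> y) \<partial>lborel)"
  have A0: "0 \<le> A" by (simp add: A_def)
  let ?U = "\<lambda>x. \<integral>\<^sup>+y. ennreal (cmod (\<phi> y) * (cmod (u (x - y)))\<^sup>2) \<partial>lborel"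
  have nnu: "(\<integral>\<^sup>+x. ennreal ((cmod (u x))\<^sup>2) \<partial>lborel) = ennreal ((line_norm u)\<^sup>2)"
    using u by (simp add: line_norm_def L2_line_def nn_integral_eq_integral)
  have U: "(\<integral>\<^sup>+x. ?U x \<partial>lborel) = ennreal (A * (line_norm u)\<^sup>2)"
  proof -
    have "(\<integral>\<^sup>+x. ?U x \<partial>lborel) = (\<integral>\<^sup>+y. \<integral>\<^sup>+x. ennreal (cmod (\<phi> y) * (cmod (u (x - y)))\<^sup>2) \<partial>lborel \<partial>lborel)"
      by (rule lborel_pair.Fubini') measurable
    also have "\<dots> = (\<integral>\<^sup>+y. ennreal (cmod (\<phi> y)) * (\<integral>\<^sup>+x. ennreal ((cmod (u (x - y)))\<^sup>2) \<partial>lborel) \<partial>lborel)"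
      by (subst nn_integral_cmult[symmetric]) (auto simp: ennreal_mult[symmetric])
    also have "\<dots> = (\<integral>\<^sup>+y. ennreal (cmod (\<phi> y)) * ennreal ((line_norm u)\<^sup>2) \<partial>lborel)"
    proof (rule nn_integral_cong)
      fix y
      have "(\<integral>\<^sup>+x. ennreal ((cmod (u (x - y)))\<^sup>2) \<partial>lborel) = ennreal ((line_norm u)\<^sup>2)"
        by (subst nn_integral_real_affine[of _ 1 y]) (auto simp: nnu)
      then show "ennreal (cmod (\<phi> y)) * (\<integral>\<^sup>+x. ennreal ((cmod (u (x - y)))\<^sup>2) \<partial>lborel)
        = ennreal (cmod (\<phi> y)) * ennreal ((line_norm u)\<^sup>2)" by simp
    qed
    also have "\<dots> = ennreal A * ennreal ((line_norm u)\<^sup>2)"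
      using \<phi> by (subst nn_integral_multc) (auto simp: A_def nn_integral_eq_integral)
    finally show ?thesis by (simp add: ennreal_mult A0)
  qed
  have "AE x in lborel. ?U x \<noteq> \<infinity>"
    by (rule nn_integral_PInf_AE) (auto simp: U)
  then have "AE x in lborel. ennreal ((cmod (convol \<phi> u x))\<^sup>2) \<le> ennreal A * ?U x"
  proof eventually_elim
    case (elim x)
    let ?p = "\<lambda>y. complex_of_real (sqrt (cmod (\<phi> y)))"
    let ?q = "\<lambda>y. complex_of_real (sqrt (cmod (\<phi> y)) * cmod (u (x - y)))"
    have p: "L2_line ?p" using integrable_norm[OF \<phi>] by (simp add: L2_line_def)
    have iq: "integrable lborel (\<lambda>y. cmod (\<phi> y) * (cmod (u (x - y)))\<^sup>2)"
      using elim by (auto simp: integrable_iff_bounded less_top abs_mult)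
    have q: "L2_line ?q"
      using iq by (simp add: L2_line_def norm_mult power_mult_distrib)
    have "cmod (convol \<phi> u x) \<le> (\<integral>y. cmod (\<phi> y * u (x - y)) \<partial>lborel)"
      unfolding convol_def by (rule integral_norm_bound)
    also have "\<dots> = (\<integral>y. cmod (?p y) * cmod (?q y) \<partial>lborel)"
      by (simp add: norm_mult abs_mult flip: mult.assoc)
    also have "\<dots> \<le> line_norm ?p * line_norm ?q" by (rule L2_line_mult_bound[OF p q])
    also have "\<dots> = sqrt A * sqrt (\<integral>y. cmod (\<phi> y) * (cmod (u (x - y)))\<^sup>2 \<partial>lborel)"
      by (simp add: line_norm_def A_def norm_mult power_mult_distrib)
    finally have "(cmod (convol \<phi> u x))\<^sup>2 \<le> (sqrt A * sqrt (\<integral>y. cmod (\<phi> y) * (cmod (u (x - y)))\<^sup>2 \<partial>lborel))\<^sup>2"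
      by (rule power_mono) simp
    also have "\<dots> = A * (\<integral>y. cmod (\<phi> y) * (cmod (u (x - y)))\<^sup>2 \<partial>lborel)"
      using A0 by (simp add: power_mult_distrib)
    finally show ?case
      using iq A0 by (subst nn_integral_eq_integral) (auto simp: ennreal_mult[symmetric] intro!: ennreal_leI)
  qed
  then have "(\<integral>\<^sup>+x. ennreal ((cmod (convol \<phi> u x))\<^sup>2) \<partial>lborel) \<le> (\<integral>\<^sup>+x. ennreal A * ?U x \<partial>lborel)"
    by (rule nn_integral_mono_AE)
  also have "\<dots> = ennreal A * ennreal (A * (line_norm u)\<^sup>2)"
    by (subst nn_integral_cmult) (simp_all only: U, measurable)
  also have "\<dots> = ennreal ((A * line_norm u)\<^sup>2)"
    using A0 by (simp add: ennreal_mult[symmetric] power2_eq_square mult_ac)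
  finally have le: "(\<integral>\<^sup>+x. ennreal ((cmod (convol \<phi> u x))\<^sup>2) \<partial>lborel) \<le> ennreal ((A * line_norm u)\<^sup>2)" .
  then show L: "L2_line (convol \<phi> u)"
    by (auto simp: L2_line_def integrable_iff_bounded intro: le_less_trans)
  then have "(\<integral>x. (cmod (convol \<phi> u x))\<^sup>2 \<partial>lborel) \<le> (A * line_norm u)\<^sup>2"
    using le by (subst (asm) nn_integral_eq_integral) (auto simp: L2_line_def)
  then show "line_norm (convol \<phi> u) \<le> A * line_norm u"
    unfolding line_norm_def[of "convol \<phi> u"] using A0 line_norm_nonneg[of u] by (intro real_le_lsqrt) auto
qed

section \<open>Density of the test functions in the Hilbert space\<close>

lemma subspace_Ccomp: "subspace Ccomp"
proof (rule subspaceI)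
  have "(\<lambda>x. 0 * (0::complex)) \<in> Ccomp_fun"
    by (rule Ccomp_funI[of _ 1 2]) (auto simp: smooth_def intro!: exI[of _ "\<lambda>n x. 0"])
  then show "0 \<in> Ccomp" unfolding Ccomp_def by (auto simp: image_iff l2_class_zero intro!: bexI[of _ "\<lambda>x. 0"])
  fix u v c assume "u \<in> Ccomp"
  then obtain f where f: "f \<in> Ccomp_fun" "u = l2_class f" by (auto simp: Ccomp_def)
  show "c *\<^sub>R u \<in> Ccomp"
    using f Ccomp_fun_mult_left[OF f(1), of "of_real c"]
    by (auto simp: Ccomp_def l2_class_scaleR square_integrable_Ccomp_fun scaleR_conv_of_real)
  assume "v \<in> Ccomp"
  then obtain g where "g \<in> Ccomp_fun" "v = l2_class g" by (auto simp: Ccomp_def)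
  then show "u + v \<in> Ccomp"
    using f Ccomp_fun_add[OF f(1)] by (auto simp: Ccomp_def l2_class_add square_integrable_Ccomp_fun)
qed

lemma subspace_closure:
  fixes S :: "'a::real_normed_vector set"
  assumes "subspace S" shows "subspace (closure S)"
proof (rule subspaceI)
  show "0 \<in> closure S" using subspace_0[OF assms] closure_subset by blast
  fix x y c assume x: "x \<in> closure S"
  obtain f where f: "\<And>n. f n \<in> S" "f \<longlonglongrightarrow> x" using x by (auto simp: closure_sequential)
  show "c *\<^sub>R x \<in> closure S"
    unfolding closure_sequential using f assms
    by (intro exI[of _ "\<lambda>n. c *\<^sub>R f n"]) (auto intro: tendsto_intros subspace_scale)
  assume "y \<in> closure S"
  then obtain g where g: "\<And>n. g n \<in> S" "g \<longlonglongrightarrow> y" by (auto simp: closure_sequential)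
  show "x + y \<in> closure S"
    unfolding closure_sequential using f g assms
    by (intro exI[of _ "\<lambda>n. f n + g n"]) (auto intro: tendsto_intros subspace_add)
qed

lemma L2_line_set_integrable:
  assumes "L2_line f" shows "set_integrable lborel {a..b} f"
proof -
  have "L2_line (\<lambda>x. complex_of_real (indicator {a..b} x))"
  proof -
    have "(\<lambda>x. (cmod (complex_of_real (indicator {a..b} x)))\<^sup>2) = indicat_real {a..b}"
      by (auto simp: indicator_def)
    moreover have "integrable lborel (indicat_real {a..b})"
      by (rule integrable_real_indicator) (simp, simp add: emeasure_lborel_Icc_eq)
    moreover have "(\<lambda>x. complex_of_real (indicator {a..b} x)) \<in> borel_measurable borel" by measurable
    ultimately show ?thesis by (simp only: L2_line_def simp_thms)
  qed
  from L2_line_mult_integrable[OF this assms] show ?thesis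
    by (simp add: set_integrable_def scaleR_conv_of_real)
qed

lemma orthogonal_Ccomp_fun_eq_0:
  assumes g: "L2_half g" and o: "\<And>\<phi>. \<phi> \<in> Ccomp_fun \<Longrightarrow> l2_class \<phi> \<bullet> l2_class g = 0"
  shows "l2_class g = 0"
proof -
  have "AE x in lborel. 0 < x \<longrightarrow> cnj (g x) = 0"
  proof (rule fundamental_lemma)
    show "(\<lambda>x. cnj (g x)) \<in> borel_measurable borel" using L2_half_borel[OF g] by measurable
    show "set_integrable lborel {a..b} (\<lambda>x. cnj (g x))" for a b
      by (intro L2_line_set_integrable L2_line_cnj L2_half_L2_line g)
    show "Re (\<integral>x. \<phi> x * cnj (g x) \<partial>lborel) = 0" if "\<phi> \<in> Ccomp_fun" for \<phi>
      using o[OF that] by (simp add: inner_l2_def cinner_l2_class_half Ccomp_fun_L2_half that g)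
  qed
  then show ?thesis
    using g by (simp add: l2_class_zero[symmetric] l2_class_eq_iff L2_half_square_integrable
        square_integrable_zero AE_Rpos_iff)
qed

text \<open>The residual of the projection onto the closure is orthogonal to all test functions, so
  the fundamental lemma annihilates it.\<close>

lemma closure_Ccomp: "closure Ccomp = UNIV"
proof -
  have "u \<in> closure Ccomp" for u
  proof -
    obtain y where y: "y \<in> closure Ccomp" "\<And>z. z \<in> closure Ccomp \<Longrightarrow> (u - y) \<bullet> z = 0"
      using closed_subspace_projection[OF subspace_closure[OF subspace_Ccomp] closed_closure] by blast
    obtain g where g: "L2_half g" "l2_class g = u - y" by (rule L2_half_representative)
    have "l2_class g = 0"
    proof (rule orthogonal_Ccomp_fun_eq_0[OF g(1)])
      fix \<phi> assume "\<phi> \<in> Ccomp_fun"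
      then have "l2_class \<phi> \<in> closure Ccomp"
        by (intro subsetD[OF closure_subset]) (simp add: Ccomp_def)
      then show "l2_class \<phi> \<bullet> l2_class g = 0" using y(2) by (simp add: g(2) inner_commute)
    qed
    then show ?thesis using g(2) y(1) by simp
  qed
  then show ?thesis by blast
qed

lemma Ccomp_fun_approx:
  obtains \<phi> where "\<And>n::nat. \<phi> n \<in> Ccomp_fun" "(\<lambda>n. l2_class (\<phi> n)) \<longlonglongrightarrow> u"
proof -
  have "u \<in> closure Ccomp" by (simp add: closure_Ccomp)
  then obtain v where v: "\<And>n::nat. v n \<in> Ccomp" "v \<longlonglongrightarrow> u" by (auto simp: closure_sequential)
  have "\<exists>\<phi>. \<phi> \<in> Ccomp_fun \<and> v n = l2_class \<phi>" for n
    using v(1)[of n] by (auto simp: Ccomp_def)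
  then obtain \<phi> where \<phi>: "\<And>n. \<phi> n \<in> Ccomp_fun" "\<And>n. v n = l2_class (\<phi> n)" by metis
  have "v = (\<lambda>n. l2_class (\<phi> n))" by (rule ext) (rule \<phi>(2))
  then show ?thesis using v(2) \<phi>(1) by (intro that[of \<phi>]) simp_all
qed

lemma integrable_bounded_support:
  fixes f :: "real \<Rightarrow> 'a::{banach, second_countable_topology}"
  assumes f[measurable]: "f \<in> borel_measurable borel" and B: "\<And>x. norm (f x) \<le> B"
    and z: "\<And>x. x \<notin> {a..b} \<Longrightarrow> f x = 0"
  shows "integrable lborel f"
proof (rule Bochner_Integration.integrable_bound)
  have "integrable lborel (indicat_real {a..b})"
    by (rule integrable_real_indicator) (simp, simp add: emeasure_lborel_Icc_eq)
  then show "integrable lborel (\<lambda>x. B * indicat_real {a..b} x)" by simp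
  show "AE x in lborel. norm (f x) \<le> norm (B * indicat_real {a..b} x)"
  proof (rule AE_I2)
    fix x
    have "0 \<le> B" using B[of x] norm_ge_zero order_trans by blast
    then show "norm (f x) \<le> norm (B * indicat_real {a..b} x)"
      using B[of x] z[of x] by (cases "x \<in> {a..b}") (auto simp: abs_mult)
  qed
qed measurable

lemma L2_line_bounded_support:
  assumes f[measurable]: "f \<in> borel_measurable borel" and B: "\<And>x. cmod (f x) \<le> B"
    and z: "\<And>x. x \<notin> {a..b} \<Longrightarrow> f x = 0"
  shows "L2_line f"
proof -
  have "integrable lborel (\<lambda>x. (cmod (f x))\<^sup>2)"
    by (rule integrable_bounded_support[where B = "B\<^sup>2" and a = a and b = b])
      (auto simp: z intro!: power_mono B)
  then show ?thesis by (simp add: L2_line_def)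
qed

lemma l2_class_half_add: "L2_half f \<Longrightarrow> L2_half g \<Longrightarrow> l2_class f + l2_class g = l2_class (\<lambda>x. f x + g x)"
  by (simp add: l2_class_add L2_half_square_integrable)
lemma l2_class_half_diff: "L2_half f \<Longrightarrow> L2_half g \<Longrightarrow> l2_class f - l2_class g = l2_class (\<lambda>x. f x - g x)"
  by (simp add: l2_class_diff L2_half_square_integrable)
lemma l2_class_half_scaleR: "L2_half f \<Longrightarrow> c *\<^sub>R l2_class f = l2_class (\<lambda>x. c *\<^sub>R f x)"
  by (simp add: l2_class_scaleR L2_half_square_integrable)
lemma inner_l2_class_half:
  "L2_half f \<Longrightarrow> L2_half g \<Longrightarrow> l2_class f \<bullet> l2_class g = Re (\<integral>x. f x * cnj (g x) \<partial>lborel)"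
  by (simp add: inner_l2_def cinner_l2_class_half)

lemma young_L2_half:
  assumes "integrable lborel \<phi>" "L2_half u" "\<And>x. x \<le> 0 \<Longrightarrow> \<phi> x = 0"
  shows "L2_half (convol \<phi> u)"
  using young_L2[OF assms(1) L2_half_L2_line[OF assms(2)]] convol_nonpos[of \<phi> u] assms
  by (simp add: L2_half_def)

subsection \<open>Bounded convolution operators\<close>

text \<open>The positive part \<open>\<psi>\<close> of the autocorrelation of \<open>\<phi>\<close> satisfies
  \<open>C\<^sub>\<phi>\<^sup>* C\<^sub>\<phi> = C\<^sub>\<psi> + C\<^sub>\<psi>\<^sup>*\<close>, where \<open>C\<^sub>\<phi>\<close> is convolution with \<open>\<phi>\<close>.\<close>

definition autocorr :: "(real \<Rightarrow> complex) \<Rightarrow> real \<Rightarrow> complex" where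
  "autocorr \<phi> t = (\<integral>x. \<phi> (x + t) * cnj (\<phi> x) \<partial>lborel)"

definition autocorr_pos :: "(real \<Rightarrow> complex) \<Rightarrow> real \<Rightarrow> complex" where
  "autocorr_pos \<phi> t = indicator {0<..} t * autocorr \<phi> t"

lemma autocorr_measurable [measurable]:
  assumes [measurable]: "\<phi> \<in> borel_measurable borel"
  shows "autocorr \<phi> \<in> borel_measurable borel" "autocorr_pos \<phi> \<in> borel_measurable borel"
proof -
  show m[measurable]: "autocorr \<phi> \<in> borel_measurable borel"
    unfolding autocorr_def by measurable
  show "autocorr_pos \<phi> \<in> borel_measurable borel"
    unfolding autocorr_pos_def by measurable
qed

lemma autocorr_minus: "autocorr \<phi> (- t) = cnj (autocorr \<phi> t)"
proof -
  have "autocorr \<phi> (- t) = (\<integral>x. \<phi> x * cnj (\<phi> (x + t)) \<partial>lborel)"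
    unfolding autocorr_def by (subst lborel_integral_real_affine[of 1 _ t]) (auto simp: add.commute)
  also have "\<dots> = (\<integral>x. cnj (\<phi> (x + t) * cnj (\<phi> x)) \<partial>lborel)"
    by (simp add: mult.commute)
  finally show ?thesis by (simp only: autocorr_def Bochner_Integration.integral_cnj)
qed

lemma autocorr_bound: 
  assumes "L2_line \<phi>" shows "cmod (autocorr \<phi> t) \<le> (line_norm \<phi>)\<^sup>2"
proof -
  have "line_norm (\<lambda>x. cnj (\<phi> x)) = line_norm \<phi>" by (simp add: line_norm_def)
  then show ?thesis
    using L2_line_mult_integral_bound[OF L2_line_shift[OF assms, of t] L2_line_cnj[OF assms]]
      line_norm_shift[OF assms, of t]
    by (simp add: autocorr_def power2_eq_square add.commute)
qed

lemma autocorr_Ccomp_fun: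
  assumes "\<phi> \<in> Ccomp_fun"
  shows "integrable lborel (autocorr \<phi>)" "integrable lborel (autocorr_pos \<phi>)" "L2_half (autocorr_pos \<phi>)"
proof -
  obtain a b where ab: "0 < a" "a < b" "\<And>x. x \<notin> {a..b} \<Longrightarrow> \<phi> x = 0"
    using assms by (rule Ccomp_funE) blast
  note L = L2_half_L2_line[OF Ccomp_fun_L2_half[OF assms]]
  have [measurable]: "\<phi> \<in> borel_measurable borel" using L by (rule L2_line_borel)
  have z: "autocorr \<phi> t = 0" if "t \<notin> {a - b..b - a}" for t
  proof -
    have "\<phi> (x + t) * cnj (\<phi> x) = 0" for x
    proof (cases "x \<in> {a..b}")
      case True
      then have "x + t \<notin> {a..b}" using that by auto
      then show ?thesis by (simp add: ab(3))
    qed (simp add: ab(3))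
    then show ?thesis by (simp only: autocorr_def integral_zero)
  qed
  have z': "autocorr_pos \<phi> t = 0" if "t \<notin> {a - b..b - a}" for t
    using z[OF that] by (simp add: autocorr_pos_def)
  have b: "cmod (autocorr_pos \<phi> t) \<le> (line_norm \<phi>)\<^sup>2" for t
    using autocorr_bound[OF L, of t] by (auto simp: autocorr_pos_def indicator_def)
  show "integrable lborel (autocorr \<phi>)"
    by (rule integrable_bounded_support[OF _ autocorr_bound[OF L] z]) measurable
  show "integrable lborel (autocorr_pos \<phi>)"
    by (rule integrable_bounded_support[OF _ b z']) measurable
  have "L2_line (autocorr_pos \<phi>)"
    by (rule L2_line_bounded_support[OF _ b z']) measurable
  then show "L2_half (autocorr_pos \<phi>)"
    by (auto simp: L2_half_def autocorr_pos_def)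
qed

text \<open>Both autocorrelations are Hermitian, so the integrand at -t is the conjugate of that at
  t. The two half-line integrals are conjugate to each other, and the point 0 is negligible.\<close>

lemma integral_autocorr_eq:
  assumes \<phi>: "\<phi> \<in> Ccomp_fun" and u: "L2_line u"
  shows "(\<integral>t. autocorr \<phi> t * cnj (autocorr u t) \<partial>lborel)
    = 2 * Re (\<integral>t. autocorr_pos \<phi> t * cnj (autocorr u t) \<partial>lborel)"
proof -
  let ?g = "\<lambda>t. autocorr \<phi> t * cnj (autocorr u t)"
  have [measurable]: "\<phi> \<in> borel_measurable borel" "u \<in> borel_measurable borel"
    using L2_half_borel[OF Ccomp_fun_L2_half[OF \<phi>]] L2_line_borel[OF u] by auto
  have g: "integrable lborel ?g"
  proof (rule Bochner_Integration.integrable_bound)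
    show "integrable lborel (\<lambda>t. (line_norm u)\<^sup>2 * cmod (autocorr \<phi> t))"
      using autocorr_Ccomp_fun(1)[OF \<phi>] by (intro integrable_mult_right integrable_norm)
    show "AE t in lborel. norm (?g t) \<le> norm ((line_norm u)\<^sup>2 * cmod (autocorr \<phi> t))"
      using autocorr_bound[OF u]
      by (intro AE_I2) (auto simp: norm_mult mult.commute[of "cmod (autocorr \<phi> _)"] intro!: mult_right_mono)
  qed measurable
  let ?p = "\<lambda>t. indicator {0<..} t *\<^sub>R ?g t" and ?n = "\<lambda>t. indicator {..0} t *\<^sub>R ?g t"
  have gp: "integrable lborel ?p" and gn: "integrable lborel ?n"
    using g by (auto intro!: integrable_mult_indicator)
  have "(\<integral>t. ?g t \<partial>lborel) = (\<integral>t. ?p t + ?n t \<partial>lborel)"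
    by (rule Bochner_Integration.integral_cong) (auto simp: indicator_def)
  also have "\<dots> = (\<integral>t. ?p t \<partial>lborel) + (\<integral>t. ?n t \<partial>lborel)"
    by (rule Bochner_Integration.integral_add[OF gp gn])
  also have "(\<integral>t. ?n t \<partial>lborel) = (\<integral>t. ?n (- t) \<partial>lborel)"
    by (subst lborel_integral_real_affine[of "-1" _ 0]) auto
  also have "\<dots> = (\<integral>t. cnj (?p t) \<partial>lborel)"
  proof (rule integral_cong_AE)
    show "AE t in lborel. ?n (- t) = cnj (?p t)"
      using AE_lborel_singleton[of 0]
      by eventually_elim (auto simp: indicator_def autocorr_minus)
  qed measurable
  also have "\<dots> = cnj (\<integral>t. ?p t \<partial>lborel)" by (rule Bochner_Integration.integral_cnj)
  also have "(\<integral>t. ?p t \<partial>lborel) + cnj (\<integral>t. ?p t \<partial>lborel) = 2 * Re (\<integral>t. ?p t \<partial>lborel)"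
    by (rule complex_add_cnj)
  also have "(\<integral>t. ?p t \<partial>lborel) = (\<integral>t. autocorr_pos \<phi> t * cnj (autocorr u t) \<partial>lborel)"
    by (rule Bochner_Integration.integral_cong) (auto simp: autocorr_pos_def indicator_def)
  finally show ?thesis .
qed

lemma integral_convol_cnj:
  assumes "trilinear \<phi> u (\<lambda>x. cnj (u x))"
  shows "(\<integral>x. convol \<phi> u x * cnj (u x) \<partial>lborel) = (\<integral>t. \<phi> t * cnj (autocorr u t) \<partial>lborel)"
proof -
  have "(\<integral>x. u x * cnj (u (x + t)) \<partial>lborel) = cnj (autocorr u t)" for t
    unfolding autocorr_def by (simp add: mult.commute flip: Bochner_Integration.integral_cnj)
  then show ?thesis using integral_convol_mult[OF assms] by simp
qed

text \<open>The quadratic form of the operator identity stated before \<open>autocorr\<close>. Both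
  sides are reduced to the integral of \<open>autocorr \<phi>\<close> against the conjugate of
  \<open>autocorr u\<close>. The gain is that \<open>autocorr_pos \<phi>\<close> lives on the
  half-line, so its convolution with \<open>u\<close> can be inserted into relations valid only
  there.\<close>

lemma norm_convol_eq_autocorr:
  assumes \<phi>: "\<phi> \<in> Ccomp_fun" and u: "L2_half u"
  shows "(norm (l2_class (convol \<phi> u)))\<^sup>2 = 2 * (l2_class (convol (autocorr_pos \<phi>) u) \<bullet> l2_class u)"
proof -
  note \<phi>L = L2_half_L2_line[OF Ccomp_fun_L2_half[OF \<phi>]] and \<phi>1 = Ccomp_fun_integrable[OF \<phi>]
  note uL = L2_half_L2_line[OF u]
  have [measurable]: "\<phi> \<in> borel_measurable borel" "u \<in> borel_measurable borel"
    using \<phi>L uL by (auto intro: L2_line_borel)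
  have c: "L2_half (convol \<phi> u)"
    by (rule young_L2_half[OF \<phi>1 u L2_half_nonpos[OF Ccomp_fun_L2_half[OF \<phi>]]])
  have c': "L2_half (convol (autocorr_pos \<phi>) u)"
    by (rule young_L2_half[OF autocorr_Ccomp_fun(2)[OF \<phi>] u L2_half_nonpos[OF autocorr_Ccomp_fun(3)[OF \<phi>]]])
  have "of_real ((norm (l2_class (convol \<phi> u)))\<^sup>2) = (\<integral>x. convol \<phi> u x * cnj (convol \<phi> u x) \<partial>lborel)"
    by (simp add: norm_l2_class_half[OF c] complex_norm_square[symmetric] del: of_real_power)
  also have "\<dots> = (\<integral>y. \<phi> y * (\<integral>x. u x * cnj (convol \<phi> u (x + y)) \<partial>lborel) \<partial>lborel)"
    by (rule integral_convol_mult) (simp add: trilinear_def \<phi>1 uL L2_line_cnj L2_half_L2_line[OF c])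
  \<comment> \<open>Expanding the second factor \<phi> * u as well leaves u only inside its
    autocorrelation.\<close>
  also have "\<dots> = (\<integral>y. \<phi> y * convol (\<lambda>t. cnj (autocorr u t)) (\<lambda>x. cnj (\<phi> x)) y \<partial>lborel)"
  proof (rule Bochner_Integration.integral_cong[OF refl])
    fix y
    have "(\<integral>x. u x * cnj (convol \<phi> u (x + y)) \<partial>lborel) = (\<integral>x. u (x - y) * cnj (convol \<phi> u x) \<partial>lborel)"
      by (subst lborel_integral_real_affine[of 1 _ "-y"]) (auto simp: algebra_simps)
    also have "\<dots> = cnj (\<integral>x. convol \<phi> u x * cnj (u (x - y)) \<partial>lborel)"
      by (simp add: mult.commute flip: Bochner_Integration.integral_cnj)
    also have "(\<integral>x. convol \<phi> u x * cnj (u (x - y)) \<partial>lborel) = (\<integral>z. \<phi> z * (\<integral>x. u x * cnj (u (x + z - y)) \<partial>lborel) \<partial>lborel)"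
      using L2_line_cnj[OF L2_line_shift[OF uL, of "-y"]]
      by (intro integral_convol_mult) (simp add: trilinear_def \<phi>1 uL)
    also have "cnj \<dots> = (\<integral>z. cnj (\<phi> z) * cnj (autocorr u (y - z)) \<partial>lborel)"
    proof -
      have "(\<integral>x. u x * cnj (u (x + z - y)) \<partial>lborel) = autocorr u (y - z)" for z
        unfolding autocorr_def by (subst lborel_integral_real_affine[of 1 _ "y - z"]) (auto simp: algebra_simps)
      then show ?thesis by (simp flip: Bochner_Integration.integral_cnj)
    qed
    also have "\<dots> = convol (\<lambda>x. cnj (\<phi> x)) (\<lambda>t. cnj (autocorr u t)) y" by (simp add: convol_def)
    finally show "\<phi> y * (\<integral>x. u x * cnj (convol \<phi> u (x + y)) \<partial>lborel)
      = \<phi> y * convol (\<lambda>t. cnj (autocorr u t)) (\<lambda>x. cnj (\<phi> x)) y"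
      by (simp only: convol_commute)
  qed
  also have "\<dots> = (\<integral>y. convol (\<lambda>t. cnj (autocorr u t)) (\<lambda>x. cnj (\<phi> x)) y * \<phi> y \<partial>lborel)"
    by (simp only: mult.commute)
  also have "\<dots> = (\<integral>t. cnj (autocorr u t) * (\<integral>x. cnj (\<phi> x) * \<phi> (x + t) \<partial>lborel) \<partial>lborel)"
  proof (rule integral_convol_mult)
    have "\<forall>t. cmod (cnj (autocorr u t)) \<le> (line_norm u)\<^sup>2" using autocorr_bound[OF uL] by simp
    moreover have "(\<lambda>t. cnj (autocorr u t)) \<in> borel_measurable borel" by measurable
    ultimately show "trilinear (\<lambda>t. cnj (autocorr u t)) (\<lambda>x. cnj (\<phi> x)) \<phi>"
      using \<phi>1 unfolding trilinear_def by (intro disjI2 conjI exI[of _ "(line_norm u)\<^sup>2"]) auto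
  qed
  also have "\<dots> = (\<integral>t. autocorr \<phi> t * cnj (autocorr u t) \<partial>lborel)"
    by (simp add: autocorr_def mult.commute)
  also have "\<dots> = 2 * Re (\<integral>t. autocorr_pos \<phi> t * cnj (autocorr u t) \<partial>lborel)"
    by (rule integral_autocorr_eq[OF \<phi> uL])
  also have "(\<integral>t. autocorr_pos \<phi> t * cnj (autocorr u t) \<partial>lborel) = (\<integral>x. convol (autocorr_pos \<phi>) u x * cnj (u x) \<partial>lborel)"
    by (rule integral_convol_cnj[symmetric]) (simp add: trilinear_def autocorr_Ccomp_fun[OF \<phi>] uL L2_line_cnj)
  finally have "of_real ((norm (l2_class (convol \<phi> u)))\<^sup>2)
    = complex_of_real (2 * Re (\<integral>x. convol (autocorr_pos \<phi>) u x * cnj (u x) \<partial>lborel))" by simp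
  then show ?thesis by (simp only: of_real_eq_iff inner_l2_class_half[OF c' u])
qed

text \<open>The inner product equals the real part of the pairing of k with the full
  autocorrelation, and k sees only the positive half of it.\<close>

lemma inner_convol_eq_autocorr:
  assumes \<phi>: "\<phi> \<in> Ccomp_fun" and k: "L2_half k"
  shows "l2_class \<phi> \<bullet> l2_class (convol \<phi> k) = l2_class (autocorr_pos \<phi>) \<bullet> l2_class k"
proof -
  note \<phi>L = Ccomp_fun_L2_half[OF \<phi>] and \<phi>1 = Ccomp_fun_integrable[OF \<phi>]
  have c: "L2_half (convol \<phi> k)" by (rule young_L2_half[OF \<phi>1 k L2_half_nonpos[OF \<phi>L]])
  have "l2_class \<phi> \<bullet> l2_class (convol \<phi> k) = Re (\<integral>x. convol k \<phi> x * cnj (\<phi> x) \<partial>lborel)"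
    unfolding convol_commute[of k] by (subst inner_commute) (rule inner_l2_class_half[OF c \<phi>L])
  also have "(\<integral>x. convol k \<phi> x * cnj (\<phi> x) \<partial>lborel) = (\<integral>t. k t * cnj (autocorr \<phi> t) \<partial>lborel)"
    by (rule integral_convol_cnj) (simp add: trilinear_def \<phi>1 L2_half_L2_line[OF \<phi>L] L2_half_L2_line[OF k] L2_line_cnj)
  also have "\<dots> = (\<integral>t. k t * cnj (autocorr_pos \<phi> t) \<partial>lborel)"
    by (rule Bochner_Integration.integral_cong)
      (auto simp: autocorr_pos_def indicator_def L2_half_nonpos[OF k])
  also have "Re \<dots> = l2_class k \<bullet> l2_class (autocorr_pos \<phi>)"
    by (rule inner_l2_class_half[symmetric, OF k autocorr_Ccomp_fun(3)[OF \<phi>]])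
  finally show ?thesis by (simp add: inner_commute)
qed

section \<open>Kernels whose convolution operator is bounded\<close>

text \<open>For square integrable k and q the convolution is defined at every point and bounded; its
  square integrability is the real demand.\<close>

definition conv_bounded :: "(real \<Rightarrow> complex) \<Rightarrow> real \<Rightarrow> bool" where
  "conv_bounded k C \<longleftrightarrow> L2_half k \<and>
    (\<forall>q. L2_half q \<longrightarrow> L2_half (convol k q) \<and> norm (l2_class (convol k q)) \<le> C * norm (l2_class q))"

lemma convol_tendsto:
  assumes k: "L2_half k" and q: "\<And>n. L2_half (q n)" "L2_half q'"
    and lim: "(\<lambda>n. l2_class (q n)) \<longlonglongrightarrow> l2_class q'"
  shows "(\<lambda>n. convol k (q n) x) \<longlonglongrightarrow> convol k q' x"
proof (rule LIM_zero_cancel, rule Lim_null_comparison)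
  have "(\<lambda>n. line_norm k * norm (l2_class (q n) - l2_class q')) \<longlonglongrightarrow> line_norm k * norm (l2_class q' - l2_class q')"
    by (intro tendsto_intros lim)
  then show "(\<lambda>n. line_norm k * norm (l2_class (q n) - l2_class q')) \<longlonglongrightarrow> 0" by simp
  show "\<forall>\<^sub>F n in sequentially. norm (convol k (q n) x - convol k q' x) \<le> line_norm k * norm (l2_class (q n) - l2_class q')"
  proof (rule always_eventually, rule allI)
    fix n
    have "L2_half (\<lambda>x. q n x - q' x)" using q by (intro L2_half_diff)
    then show "norm (convol k (q n) x - convol k q' x) \<le> line_norm k * norm (l2_class (q n) - l2_class q')"
      using convol_bound[of k "\<lambda>x. q n x - q' x" x] q k
      by (simp add: l2_class_half_diff norm_l2_class_eq_line_norm convol_diff_right L2_half_L2_line)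
  qed
qed

text \<open>Approximating q by test functions, the images form a Cauchy sequence, while the value of
  k * q at a point is continuous in q. Hence the norm limit of the images is k * q itself.\<close>

lemma conv_boundedI:
  assumes k: "L2_half k"
    and b: "\<And>\<phi>. \<phi> \<in> Ccomp_fun \<Longrightarrow> norm (l2_class (convol k \<phi>)) \<le> C * norm (l2_class \<phi>)"
  shows "conv_bounded k C"
proof -
  have "L2_half (convol k q) \<and> norm (l2_class (convol k q)) \<le> C * norm (l2_class q)" if q: "L2_half q" for q
  proof -
    obtain \<phi> where \<phi>: "\<And>n::nat. \<phi> n \<in> Ccomp_fun" and lim: "(\<lambda>n. l2_class (\<phi> n)) \<longlonglongrightarrow> l2_class q"
      using Ccomp_fun_approx[of "l2_class q"] by blast
    note \<phi>L = Ccomp_fun_L2_half[OF \<phi>]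
    have c: "L2_half (convol k (\<phi> n))" for n
      unfolding convol_commute[of k]
      by (rule young_L2_half[OF Ccomp_fun_integrable[OF \<phi>] k L2_half_nonpos[OF \<phi>L]])
    \<comment> \<open>The modulus appears because the sign of \<open>C\<close> is
      unspecified.\<close>
    have d: "norm (l2_class (convol k (\<phi> m)) - l2_class (convol k (\<phi> n))) \<le> \<bar>C\<bar> * norm (l2_class (\<phi> m) - l2_class (\<phi> n))" for m n
    proof -
      have "(\<lambda>x. \<phi> m x + (-1) * \<phi> n x) \<in> Ccomp_fun"
        by (intro Ccomp_fun_add Ccomp_fun_mult_left \<phi>)
      from b[OF this] have "norm (l2_class (convol k (\<lambda>x. \<phi> m x - \<phi> n x))) \<le> C * norm (l2_class (\<lambda>x. \<phi> m x - \<phi> n x))"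
        by simp
      also have "\<dots> \<le> \<bar>C\<bar> * norm (l2_class (\<lambda>x. \<phi> m x - \<phi> n x))" by (intro mult_right_mono) auto
      also have "convol k (\<lambda>x. \<phi> m x - \<phi> n x) = (\<lambda>x. convol k (\<phi> m) x - convol k (\<phi> n) x)"
        by (rule ext) (intro convol_diff_right L2_half_L2_line k \<phi>L)
      finally show ?thesis by (simp add: l2_class_half_diff c \<phi>L)
    qed
    have "Cauchy (\<lambda>n. l2_class (convol k (\<phi> n)))"
    proof (rule CauchyI)
      fix e :: real assume e: "0 < e"
      have "Cauchy (\<lambda>n. l2_class (\<phi> n))" using lim by (rule LIMSEQ_imp_Cauchy)
      moreover have "0 < e / (\<bar>C\<bar> + 1)" using e by (intro divide_pos_pos) auto
      ultimately obtain M where M: "\<And>m n. m \<ge> M \<Longrightarrow> n \<ge> M \<Longrightarrow> norm (l2_class (\<phi> m) - l2_class (\<phi> n)) < e / (\<bar>C\<bar> + 1)"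
        using CauchyD by blast
      have "norm (l2_class (convol k (\<phi> m)) - l2_class (convol k (\<phi> n))) < e" if "m \<ge> M" "n \<ge> M" for m n
      proof -
        have "norm (l2_class (convol k (\<phi> m)) - l2_class (convol k (\<phi> n))) \<le> (\<bar>C\<bar> + 1) * norm (l2_class (\<phi> m) - l2_class (\<phi> n))"
          by (rule order_trans[OF d]) (intro mult_right_mono, auto)
        also have "\<dots> < e" using M[OF that] by (simp add: field_simps)
        finally show ?thesis .
      qed
      then show "\<exists>M. \<forall>m\<ge>M. \<forall>n\<ge>M. norm (l2_class (convol k (\<phi> m)) - l2_class (convol k (\<phi> n))) < e" by blast
    qed
    then obtain w where w: "(\<lambda>n. l2_class (convol k (\<phi> n))) \<longlonglongrightarrow> w"
      using Cauchy_convergent convergent_def by blast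
    obtain v where v: "L2_half v" "l2_class v = w" by (rule L2_half_representative)
    have m: "convol k q \<in> borel_measurable borel"
      using L2_half_borel[OF k] L2_half_borel[OF q] by measurable
    have lim': "AE x in Rpos. (\<lambda>n. convol k (\<phi> n) x) \<longlonglongrightarrow> convol k q x"
      by (rule AE_I2) (rule convol_tendsto[OF k \<phi>L q lim])
    have "square_integrable (convol k q)" "l2_class (convol k q) = l2_class v"
      using l2_lim_AE_unique[OF L2_half_square_integrable[OF c] borel_imp_measurable_Rpos[OF m]
          L2_half_square_integrable[OF v(1)] lim'] w v(2) by auto
    moreover have "norm w \<le> C * norm (l2_class q)"
      by (rule LIMSEQ_le[OF tendsto_norm[OF w] tendsto_mult_left[OF tendsto_norm[OF lim]]])
        (use b[OF \<phi>] in auto)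
    ultimately show ?thesis
      using m convol_nonpos[of k q] k q v by (simp add: L2_half_iff)
  qed
  then show ?thesis using k by (simp add: conv_bounded_def)
qed

lemma
  assumes "conv_bounded k C"
  shows conv_bounded_L2_half: "L2_half k"
    and conv_bounded_convol: "L2_half q \<Longrightarrow> L2_half (convol k q)"
    and conv_bounded_norm: "L2_half q \<Longrightarrow> norm (l2_class (convol k q)) \<le> C * norm (l2_class q)"
  using assms by (auto simp: conv_bounded_def)

lemma young_Ccomp_bound:
  assumes \<phi>: "\<phi> \<in> Ccomp_fun" and k: "L2_half k"
  shows "L2_half (convol k \<phi>)"
    "norm (l2_class (convol k \<phi>)) \<le> (\<integral>y. cmod (\<phi> y) \<partial>lborel) * norm (l2_class k)"
proof -
  show c: "L2_half (convol k \<phi>)"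
    unfolding convol_commute[of k]
    by (rule young_L2_half[OF Ccomp_fun_integrable[OF \<phi>] k L2_half_nonpos[OF Ccomp_fun_L2_half[OF \<phi>]]])
  show "norm (l2_class (convol k \<phi>)) \<le> (\<integral>y. cmod (\<phi> y) \<partial>lborel) * norm (l2_class k)"
    using young_bound[OF Ccomp_fun_integrable[OF \<phi>] L2_half_L2_line[OF k]] c k
    by (simp add: norm_l2_class_eq_line_norm convol_commute[of k])
qed

text \<open>On a test function Young's inequality gives convergence, since the kernels tend to 0 in
  norm; the common bound \<open>C\<close> carries this over to the closure. The operators converge
  strongly, which is all that the limits below use.\<close>

lemma conv_bounded_strong_limit:
  assumes k: "\<And>n. conv_bounded (k n) C" and k0: "(\<lambda>n. l2_class (k n)) \<longlonglongrightarrow> 0" and q: "L2_half q"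
  shows "(\<lambda>n. l2_class (convol (k n) q)) \<longlonglongrightarrow> 0"
proof (rule tendstoI)
  fix e :: real assume e: "0 < e"
  have "l2_class q \<in> closure Ccomp" by (simp add: closure_Ccomp)
  moreover have "0 < e / (2 * (\<bar>C\<bar> + 1))" using e by (intro divide_pos_pos) auto
  ultimately obtain v where v: "v \<in> Ccomp" "dist v (l2_class q) < e / (2 * (\<bar>C\<bar> + 1))"
    unfolding closure_approachable by blast
  then obtain \<phi> where \<phi>: "\<phi> \<in> Ccomp_fun" "v = l2_class \<phi>" by (auto simp: Ccomp_def)
  note \<phi>L = Ccomp_fun_L2_half[OF \<phi>(1)] and kL = conv_bounded_L2_half[OF k]
  let ?A = "\<integral>y. cmod (\<phi> y) \<partial>lborel"
  have "(\<lambda>n. ?A * norm (l2_class (k n))) \<longlonglongrightarrow> ?A * norm (0::l2)" by (intro tendsto_intros k0)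
  then have "(\<lambda>n. ?A * norm (l2_class (k n))) \<longlonglongrightarrow> 0" by simp
  then have "\<forall>\<^sub>F n in sequentially. ?A * norm (l2_class (k n)) < e / 2"
    by (rule order_tendstoD(2)) (use e in simp)
  then show "\<forall>\<^sub>F n in sequentially. dist (l2_class (convol (k n) q)) 0 < e"
  proof eventually_elim
    case (elim n)
    have d: "L2_half (\<lambda>x. q x - \<phi> x)" by (rule L2_half_diff[OF q \<phi>L])
    have "l2_class (convol (k n) q) - l2_class (convol (k n) \<phi>) = l2_class (convol (k n) (\<lambda>x. q x - \<phi> x))"
    proof -
      have "convol (k n) (\<lambda>x. q x - \<phi> x) = (\<lambda>x. convol (k n) q x - convol (k n) \<phi> x)"
        by (rule ext) (intro convol_diff_right L2_half_L2_line kL q \<phi>L)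
      then show ?thesis
        by (simp add: l2_class_half_diff conv_bounded_convol[OF k] q \<phi>L)
    qed
    then have "norm (l2_class (convol (k n) q) - l2_class (convol (k n) \<phi>)) \<le> C * norm (l2_class (\<lambda>x. q x - \<phi> x))"
      using conv_bounded_norm[OF k d] by simp
    also have "\<dots> \<le> (\<bar>C\<bar> + 1) * norm (l2_class (\<lambda>x. q x - \<phi> x))"
      by (rule mult_right_mono) auto
    also have "norm (l2_class (\<lambda>x. q x - \<phi> x)) = dist v (l2_class q)"
      by (simp add: \<phi>(2) dist_norm norm_minus_commute l2_class_half_diff[symmetric] q \<phi>L)
    also have "(\<bar>C\<bar> + 1) * dist v (l2_class q) < e / 2" using v(2) by (simp add: field_simps)
    finally have "norm (l2_class (convol (k n) q) - l2_class (convol (k n) \<phi>)) < e / 2" .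
    moreover have "norm (l2_class (convol (k n) \<phi>)) < e / 2"
      using young_Ccomp_bound(2)[OF \<phi>(1) kL] elim by (rule le_less_trans)
    ultimately show ?case
      using norm_triangle_sub[of "l2_class (convol (k n) q)" "l2_class (convol (k n) \<phi>)"] by simp
  qed
qed

text \<open>The first identity behind the bounds says that |\<phi> - \<phi> * k|^2 and \<epsilon>^2
  |\<phi> * p|^2 add up to |\<phi>|^2. The first summand gives the constant 2 = 1 + 1 by the
  triangle inequality, the second gives 1/\<epsilon>. The bound on k itself holds because the
  residual is no longer than the projected vector (0, \<epsilon> f).\<close>

lemma bounded_multiplier:
  assumes f: "L2_half f" and \<epsilon>: "0 < \<epsilon>"
  obtains k where "conv_bounded k 2" "conv_bounded (\<lambda>x. f x - convol k f x) (1 / \<epsilon>)"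
    "norm (l2_class k) \<le> \<epsilon> * norm (l2_class f)"
proof -
  define M where "M = {(l2_class l, \<epsilon> *\<^sub>R l2_class (convol l f)) |l. L2_half l \<and> L2_half (convol l f)}"
  have MI: "(l2_class l, \<epsilon> *\<^sub>R l2_class (convol l f)) \<in> M" if "L2_half l" "L2_half (convol l f)" for l
    using that by (auto simp: M_def)
  have "subspace M"
  proof (rule subspaceI)
    have "L2_half (\<lambda>x. 0)" by (simp add: L2_half_iff square_integrable_zero)
    moreover have "convol (\<lambda>x. 0) f = (\<lambda>x. 0)" by (simp add: convol_def fun_eq_iff)
    ultimately show "0 \<in> M" using MI[of "\<lambda>x. 0"] by (simp add: l2_class_zero zero_prod_def)
    fix x y c assume "x \<in> M"
    then obtain l where l: "L2_half l" "L2_half (convol l f)" "x = (l2_class l, \<epsilon> *\<^sub>R l2_class (convol l f))"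
      by (auto simp: M_def)
    have "convol (\<lambda>x. c *\<^sub>R l x) f = (\<lambda>x. c *\<^sub>R convol l f x)"
      by (rule ext) (simp only: convol_commute[of _ f] convol_scaleR_right)
    then show "c *\<^sub>R x \<in> M"
      using MI[of "\<lambda>x. c *\<^sub>R l x"] l by (simp add: L2_half_scaleR l2_class_half_scaleR[symmetric] mult.commute)
    assume "y \<in> M"
    then obtain m where m: "L2_half m" "L2_half (convol m f)" "y = (l2_class m, \<epsilon> *\<^sub>R l2_class (convol m f))"
      by (auto simp: M_def)
    have "convol (\<lambda>x. l x + m x) f = (\<lambda>x. convol l f x + convol m f x)"
      by (rule ext, simp only: convol_commute[of _ f])
        (intro convol_add_right L2_half_L2_line f l m)
    then show "x + y \<in> M"
      using MI[of "\<lambda>x. l x + m x"] l m by (simp add: L2_half_add l2_class_half_add[symmetric] scaleR_add_right)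
  qed
  moreover have "closed M"
    unfolding closed_sequential_limits
  proof (intro allI impI, elim conjE)
    fix X w assume X: "\<forall>n. X n \<in> M" and lim: "X \<longlonglongrightarrow> w"
    then have "\<forall>n. \<exists>l. L2_half l \<and> L2_half (convol l f) \<and> X n = (l2_class l, \<epsilon> *\<^sub>R l2_class (convol l f))"
      by (auto simp: M_def)
    then obtain l where l: "\<And>n. L2_half (l n)" "\<And>n. L2_half (convol (l n) f)"
      and Xl: "\<And>n. X n = (l2_class (l n), \<epsilon> *\<^sub>R l2_class (convol (l n) f))" by metis
    obtain m where m: "L2_half m" "l2_class m = fst w" by (rule L2_half_representative)
    obtain v where v: "L2_half v" "l2_class v = (1 / \<epsilon>) *\<^sub>R snd w" by (rule L2_half_representative)
    have lm: "(\<lambda>n. l2_class (l n)) \<longlonglongrightarrow> l2_class m"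
      using tendsto_fst[OF lim] by (simp add: Xl m)
    have "(\<lambda>n. (1 / \<epsilon>) *\<^sub>R snd (X n)) \<longlonglongrightarrow> (1 / \<epsilon>) *\<^sub>R snd w"
      by (intro tendsto_intros lim)
    then have lv: "(\<lambda>n. l2_class (convol (l n) f)) \<longlonglongrightarrow> l2_class v"
      using \<epsilon> by (simp add: Xl v)
    have meas: "convol m f \<in> borel_measurable borel"
      using L2_half_borel[OF m(1)] L2_half_borel[OF f] by measurable
    have "AE x in Rpos. (\<lambda>n. convol (l n) f x) \<longlonglongrightarrow> convol m f x"
      unfolding convol_commute[of _ f] by (intro AE_I2 convol_tendsto f l m lm)
    from l2_lim_AE_unique[OF L2_half_square_integrable[OF l(2)] borel_imp_measurable_Rpos[OF meas]
        L2_half_square_integrable[OF v(1)] this lv]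
    have "L2_half (convol m f)" "l2_class (convol m f) = l2_class v"
      using meas convol_nonpos[of m f] m f by (auto simp: L2_half_iff)
    then show "w \<in> M" using MI[of m] m v \<epsilon> by (simp add: prod_eq_iff)
  qed
  ultimately obtain y where y: "y \<in> M" and orth: "\<And>z. z \<in> M \<Longrightarrow> ((0, \<epsilon> *\<^sub>R l2_class f) - y) \<bullet> z = 0"
    using closed_subspace_projection by blast
  obtain k where k: "L2_half k" and kf: "L2_half (convol k f)"
    and yk: "y = (l2_class k, \<epsilon> *\<^sub>R l2_class (convol k f))" using y by (auto simp: M_def)
  let ?p = "\<lambda>x. f x - convol k f x"
  have p: "L2_half ?p" by (rule L2_half_diff[OF f kf])
  have res: "(0, \<epsilon> *\<^sub>R l2_class f) - y = (- l2_class k, \<epsilon> *\<^sub>R l2_class ?p)"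
    by (simp add: yk l2_class_half_diff[OF f kf, symmetric] scaleR_diff_right)
  \<comment> \<open>The factor \<epsilon>^2 collects the \<epsilon> of the projected vector and that
    of the graph.\<close>
  have orth': "l2_class k \<bullet> l2_class l = \<epsilon>\<^sup>2 * (l2_class ?p \<bullet> l2_class (convol l f))"
    if "L2_half l" "L2_half (convol l f)" for l
    using orth[OF MI[OF that]] unfolding res by (simp add: power2_eq_square mult.assoc)
  have nk: "norm (l2_class k) \<le> \<epsilon> * norm (l2_class f)"
  proof -
    have "(norm ((0::l2, \<epsilon> *\<^sub>R l2_class f)))\<^sup>2 = (norm (((0, \<epsilon> *\<^sub>R l2_class f) - y) + y))\<^sup>2" by simp
    also have "\<dots> = (norm ((0, \<epsilon> *\<^sub>R l2_class f) - y))\<^sup>2 + (norm y)\<^sup>2"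
      using orth[OF y] by (intro norm_add_Pythagorean) (simp add: orthogonal_def)
    finally have "(norm (- l2_class k, \<epsilon> *\<^sub>R l2_class ?p))\<^sup>2 \<le> (norm ((0::l2, \<epsilon> *\<^sub>R l2_class f)))\<^sup>2"
      unfolding res by simp
    then have "(norm (l2_class k))\<^sup>2 + (norm (\<epsilon> *\<^sub>R l2_class ?p))\<^sup>2 \<le> (\<epsilon> * norm (l2_class f))\<^sup>2"
      using \<epsilon> by (simp add: norm_Pair)
    then have "(norm (l2_class k))\<^sup>2 \<le> (\<epsilon> * norm (l2_class f))\<^sup>2"
      using zero_le_power2[of "norm (\<epsilon> *\<^sub>R l2_class ?p)"] by linarith
    then show ?thesis by (rule power2_le_imp_le) (use \<epsilon> in simp)
  qed
  have id: "(norm (l2_class \<phi> - l2_class (convol \<phi> k)))\<^sup>2 + \<epsilon>\<^sup>2 * (norm (l2_class (convol \<phi> ?p)))\<^sup>2 = (norm (l2_class \<phi>))\<^sup>2"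
    if \<phi>: "\<phi> \<in> Ccomp_fun" for \<phi>
  proof -
    let ?\<psi> = "autocorr_pos \<phi>"
    note \<psi> = autocorr_Ccomp_fun(2,3)[OF \<phi>]
    have Y: "L2_half (convol ?\<psi> u)" if "L2_half u" for u
      by (rule young_L2_half[OF \<psi>(1) that L2_half_nonpos[OF \<psi>(2)]])
    have as: "convol (convol ?\<psi> k) f = convol ?\<psi> (convol k f)"
    proof
      fix x
      show "convol (convol ?\<psi> k) f x = convol ?\<psi> (convol k f) x"
        using convol_assoc[OF L2_half_L2_line[OF f] L2_half_L2_line[OF k] \<psi>(1), of x]
        by (simp add: convol_commute)
    qed
    \<comment> \<open>The relation is taken at \<psi> and at \<psi> * k and subtracted. Both lie in
      the domain of the graph by Young's inequality, since \<psi> is integrable, and on the right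
      \<psi> * f - \<psi> * k * f collapses to \<psi> * p.\<close>
    have "l2_class k \<bullet> l2_class ?\<psi> - l2_class k \<bullet> l2_class (convol ?\<psi> k)
      = \<epsilon>\<^sup>2 * (l2_class ?p \<bullet> (l2_class (convol ?\<psi> f) - l2_class (convol ?\<psi> (convol k f))))"
      using orth'[OF \<psi>(2) Y[OF f]] orth'[OF Y[OF k]] Y[OF kf] by (simp add: as inner_diff_right right_diff_distrib)
    also have "l2_class (convol ?\<psi> f) - l2_class (convol ?\<psi> (convol k f)) = l2_class (convol ?\<psi> ?p)"
    proof -
      have "convol ?\<psi> ?p = (\<lambda>x. convol ?\<psi> f x - convol ?\<psi> (convol k f) x)"
        by (rule ext) (intro convol_diff_right L2_half_L2_line \<psi> f kf)
      then show ?thesis by (simp add: l2_class_half_diff Y f kf)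
    qed
    finally have o: "l2_class k \<bullet> l2_class ?\<psi> - l2_class k \<bullet> l2_class (convol ?\<psi> k)
      = \<epsilon>\<^sup>2 * (l2_class ?p \<bullet> l2_class (convol ?\<psi> ?p))" .
    have "(norm (l2_class \<phi> - l2_class (convol \<phi> k)))\<^sup>2
      = (norm (l2_class \<phi>))\<^sup>2 - 2 * (l2_class \<phi> \<bullet> l2_class (convol \<phi> k)) + (norm (l2_class (convol \<phi> k)))\<^sup>2"
      by (simp add: power2_norm_eq_inner inner_diff_left inner_diff_right inner_commute)
    then show ?thesis
      unfolding norm_convol_eq_autocorr[OF \<phi> k] norm_convol_eq_autocorr[OF \<phi> p] inner_convol_eq_autocorr[OF \<phi> k]
      using o by (simp add: inner_commute algebra_simps)
  qed
  have "conv_bounded k 2"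
  proof (rule conv_boundedI[OF k])
    fix \<phi> assume \<phi>: "\<phi> \<in> Ccomp_fun"
    have "(norm (l2_class \<phi> - l2_class (convol \<phi> k)))\<^sup>2 \<le> (norm (l2_class \<phi>))\<^sup>2"
      unfolding id[OF \<phi>, symmetric] by simp
    then have "norm (l2_class \<phi> - l2_class (convol \<phi> k)) \<le> norm (l2_class \<phi>)"
      by (rule power2_le_imp_le) simp
    then show "norm (l2_class (convol k \<phi>)) \<le> 2 * norm (l2_class \<phi>)"
      using norm_triangle_sub[of "l2_class (convol \<phi> k)" "l2_class \<phi>"]
      by (simp add: convol_commute[of k] norm_minus_commute)
  qed
  moreover have "conv_bounded ?p (1 / \<epsilon>)"
  proof (rule conv_boundedI[OF p])
    fix \<phi> assume \<phi>: "\<phi> \<in> Ccomp_fun"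
    have "(\<epsilon> * norm (l2_class (convol \<phi> ?p)))\<^sup>2 \<le> (norm (l2_class \<phi>))\<^sup>2"
      unfolding id[OF \<phi>, symmetric] by (simp add: power_mult_distrib)
    then have "\<epsilon> * norm (l2_class (convol \<phi> ?p)) \<le> norm (l2_class \<phi>)"
      by (rule power2_le_imp_le) simp
    then show "norm (l2_class (convol ?p \<phi>)) \<le> 1 / \<epsilon> * norm (l2_class \<phi>)"
      using \<epsilon> by (simp add: convol_commute[of ?p] field_simps)
  qed
  ultimately show ?thesis using nk by (rule that)
qed

subsection \<open>Symmetry of the Hankel form\<close>

text \<open>The integral of d exp(-d T) over T \<ge> x is exp(-d x); Tonelli thus writes the
  exponential weight as an average of cut-offs at T.\<close>

lemma nn_integral_exp_weight:
  fixes g :: "real \<Rightarrow> ennreal"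
  assumes [measurable]: "g \<in> borel_measurable borel" and d: "0 < d"
  shows "(\<integral>\<^sup>+T. ennreal (d * exp (- d * T)) * (\<integral>\<^sup>+x. g x * indicator {..T} x \<partial>lborel) \<partial>lborel)
    = (\<integral>\<^sup>+x. ennreal (exp (- d * x)) * g x \<partial>lborel)"
proof -
  have [measurable]: "Measurable.pred (borel \<Otimes>\<^sub>M borel) (\<lambda>(x::real, T). x \<le> T)" by measurable
  have "(\<integral>\<^sup>+T. ennreal (d * exp (- d * T)) * (\<integral>\<^sup>+x. g x * indicator {..T} x \<partial>lborel) \<partial>lborel)
    = (\<integral>\<^sup>+T. \<integral>\<^sup>+x. g x * (ennreal (d * exp (- d * T)) * indicator {x..} T) \<partial>lborel \<partial>lborel)"
    by (intro nn_integral_cong, subst nn_integral_cmult[symmetric])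
      (auto intro!: nn_integral_cong simp: indicator_def mult.commute)
  also have "\<dots> = (\<integral>\<^sup>+x. \<integral>\<^sup>+T. g x * (ennreal (d * exp (- d * T)) * indicator {x..} T) \<partial>lborel \<partial>lborel)"
    unfolding indicator_def atLeast_iff by (rule lborel_pair.Fubini'[symmetric]) measurable
  also have "\<dots> = (\<integral>\<^sup>+x. g x * (\<integral>\<^sup>+T. ennreal (d * exp (- d * T)) * indicator {x..} T \<partial>lborel) \<partial>lborel)"
    by (intro nn_integral_cong nn_integral_cmult) measurable
  also have "\<dots> = (\<integral>\<^sup>+x. ennreal (exp (- d * x)) * g x \<partial>lborel)"
  proof (rule nn_integral_cong)
    fix x :: real
    have "((\<lambda>T. - exp (- d * T)) \<longlongrightarrow> - 0) at_top"
      using d by (intro tendsto_minus filterlim_compose[OF exp_at_bot] filterlim_tendsto_neg_mult_at_bot[OF tendsto_const])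
        (auto intro: filterlim_ident)
    then have "(\<integral>\<^sup>+T. ennreal (d * exp (- d * T)) * indicator {x..} T \<partial>lborel) = ennreal (0 - (- exp (- d * x)))"
      using d by (intro nn_integral_FTC_atLeast[where F = "\<lambda>T. - exp (- d * T)"])
        (auto intro!: derivative_eq_intros)
    then show "g x * (\<integral>\<^sup>+T. ennreal (d * exp (- d * T)) * indicator {x..} T \<partial>lborel) = ennreal (exp (- d * x)) * g x"
      by (simp add: mult.commute)
  qed
  finally show ?thesis .
qed

definition damp :: "real \<Rightarrow> (real \<Rightarrow> complex) \<Rightarrow> real \<Rightarrow> complex" where
  "damp d k x = of_real (exp (- d * x)) * k x"

lemma nn_integral_half:
  assumes "L2_half u"
  shows "(\<integral>\<^sup>+x. ennreal ((cmod (u x))\<^sup>2) \<partial>lborel) = ennreal ((norm (l2_class u))\<^sup>2)"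
  using L2_half_L2_line[OF assms]
  by (simp add: norm_l2_class_half[OF assms] L2_line_def nn_integral_eq_integral)

lemma L2_half_le:
  assumes k: "L2_half k" and [measurable]: "u \<in> borel_measurable borel" and le: "\<And>x. cmod (u x) \<le> cmod (k x)"
  shows "L2_half u"
proof -
  have "integrable lborel (\<lambda>x. (cmod (u x))\<^sup>2)"
  proof (rule Bochner_Integration.integrable_bound)
    show "integrable lborel (\<lambda>x. (cmod (k x))\<^sup>2)" using k by (simp add: L2_half_def L2_line_def)
    show "AE x in lborel. norm ((cmod (u x))\<^sup>2) \<le> norm ((cmod (k x))\<^sup>2)"
      using le by (intro AE_I2) (simp add: power_mono)
  qed measurable
  moreover have "u x = 0" if "x \<le> 0" for x using le[of x] L2_half_nonpos[OF k that] by simp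
  ultimately show ?thesis by (simp add: L2_half_def L2_line_def)
qed

lemma damp_measurable [measurable]:
  "k \<in> borel_measurable borel \<Longrightarrow> damp d k \<in> borel_measurable borel"
  unfolding damp_def by measurable

text \<open>Cauchy-Schwarz against the square integrable exponential makes the kernel integrable,
  which is the purpose of the damping.\<close>

lemma L2_half_damp:
  assumes k: "L2_half k" and d: "0 < d"
  shows "L2_half (damp d k)" "integrable lborel (damp d k)"
proof -
  have [measurable]: "k \<in> borel_measurable borel" by (rule L2_half_borel[OF k])
  have le: "cmod (damp d k x) \<le> cmod (k x)" for x
  proof (cases "x \<le> 0")
    case True then show ?thesis by (simp add: damp_def L2_half_nonpos[OF k])
  next
    case False
    then have "exp (- d * x) * cmod (k x) \<le> 1 * cmod (k x)" using d by (intro mult_right_mono) auto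
    then show ?thesis by (simp add: damp_def norm_mult)
  qed
  show "L2_half (damp d k)" by (rule L2_half_le[OF k _ le]) measurable
  let ?e = "\<lambda>x. complex_of_real (indicator {0..} x * exp (- d * x))"
  have "(\<integral>\<^sup>+x. ennreal (exp (- (2 * d) * x)) * indicator {0..} x \<partial>lborel) < \<infinity>"
  proof -
    have "((\<lambda>T. - exp (- (2 * d) * T) / (2 * d)) \<longlongrightarrow> - 0 / (2 * d)) at_top"
      using d by (intro tendsto_divide tendsto_minus tendsto_const filterlim_compose[OF exp_at_bot] filterlim_tendsto_neg_mult_at_bot[OF tendsto_const])
        (auto intro: filterlim_ident)
    then have "(\<integral>\<^sup>+x. ennreal (exp (- (2 * d) * x)) * indicator {0..} x \<partial>lborel) = ennreal (- 0 / (2 * d) - (- exp (- (2 * d) * 0) / (2 * d)))"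
      using d by (intro nn_integral_FTC_atLeast[where F = "\<lambda>T. - exp (- (2 * d) * T) / (2 * d)"])
        (auto intro!: derivative_eq_intros)
    then show ?thesis by simp
  qed
  also have "(\<integral>\<^sup>+x. ennreal (exp (- (2 * d) * x)) * indicator {0..} x \<partial>lborel) = (\<integral>\<^sup>+x. ennreal ((cmod (?e x))\<^sup>2) \<partial>lborel)"
    by (intro nn_integral_cong) (auto simp: indicator_def power2_eq_square exp_add[symmetric] norm_mult)
  finally have "L2_line ?e"
    by (auto simp: L2_line_def integrable_iff_bounded)
  from L2_line_mult_integrable[OF this L2_half_L2_line[OF k]]
  have "integrable lborel (\<lambda>x. ?e x * k x)" .
  also have "(\<lambda>x. ?e x * k x) = damp d k"
    by (auto simp: damp_def indicator_def fun_eq_iff L2_half_nonpos[OF k])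
  finally show "integrable lborel (damp d k)" .
qed

text \<open>Averaging the causal truncations with weight \<open>2 d exp(-2 d T)\<close> shows that damping a
  kernel does not increase the norm of its convolution operator.\<close>

lemma conv_bounded_damp:
  assumes k: "conv_bounded k C" and C: "0 \<le> C" and d: "0 < d"
  shows "conv_bounded (damp d k) C"
proof (rule conv_boundedI)
  note kL = conv_bounded_L2_half[OF k]
  show "L2_half (damp d k)" by (rule L2_half_damp[OF kL d])
  fix \<phi> assume \<phi>: "\<phi> \<in> Ccomp_fun"
  note \<phi>L = Ccomp_fun_L2_half[OF \<phi>]
  \<comment> \<open>Chosen so that the damped convolution of \<phi> equals exp(-d x) times (k *
    v)(x). Compact support of \<phi> keeps v square integrable despite the growing factor.\<close>
  define v where "v x = of_real (exp (d * x)) * \<phi> x" for x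
  have [measurable]: "k \<in> borel_measurable borel" "\<phi> \<in> borel_measurable borel"
    by (intro L2_half_borel kL \<phi>L)+
  have [measurable]: "v \<in> borel_measurable borel" unfolding v_def by measurable
  obtain a b where ab: "0 < a" "a < b" "\<And>x. x \<notin> {a..b} \<Longrightarrow> \<phi> x = 0" using \<phi> by (rule Ccomp_funE) blast
  obtain B where B: "\<And>x. cmod (\<phi> x) \<le> B" using \<phi> by (rule Ccomp_fun_bounded) blast
  have B0: "0 \<le> B" using B[of 0] norm_ge_zero order_trans by blast
  have v: "L2_half v"
  proof -
    have "cmod (v x) \<le> exp (d * b) * B" for x
    proof (cases "x \<in> {a..b}")
      case True
      then show ?thesis using d B[of x] unfolding v_def norm_mult by (intro mult_mono) auto
    next
      case False
      then show ?thesis using B0 by (simp add: v_def ab(3))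
    qed
    then have "L2_line v"
      by (intro L2_line_bounded_support[where a = a and b = b]) (auto simp: v_def ab(3))
    then show ?thesis using ab by (auto simp: L2_half_def v_def)
  qed
  have cd: "convol (damp d k) \<phi> x = of_real (exp (- d * x)) * convol k v x" for x
  proof -
    have "damp d k y * \<phi> (x - y) = of_real (exp (- d * x)) * (k y * v (x - y))" for y
    proof -
      have "exp (- d * x) * exp (d * (x - y)) = exp (- d * y)" by (simp add: exp_add[symmetric] algebra_simps)
      then show ?thesis unfolding damp_def v_def
        by (simp add: mult_ac flip: of_real_mult)
    qed
    then show ?thesis by (simp only: convol_def integral_mult_right_zero)
  qed
  \<comment> \<open>Since k vanishes on the left half-line, k * v up to T depends on v up to T only.
    The operator bound for the truncated function therefore controls the truncated image.\<close>
  have causal: "(\<integral>\<^sup>+x. ennreal ((cmod (convol k v x))\<^sup>2) * indicator {..T} x \<partial>lborel)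
    \<le> ennreal (C\<^sup>2) * (\<integral>\<^sup>+x. ennreal ((cmod (v x))\<^sup>2) * indicator {..T} x \<partial>lborel)" for T
  proof -
    let ?w = "\<lambda>x. indicator {..T} x * v x"
    have w: "L2_half ?w" by (rule L2_half_le[OF v]) (auto simp: indicator_def)
    have "convol k v x = convol k ?w x" if "x \<le> T" for x
      unfolding convol_def using that L2_half_nonpos[OF kL]
      by (intro Bochner_Integration.integral_cong) (auto simp: indicator_def)
    then have "(\<integral>\<^sup>+x. ennreal ((cmod (convol k v x))\<^sup>2) * indicator {..T} x \<partial>lborel)
      \<le> (\<integral>\<^sup>+x. ennreal ((cmod (convol k ?w x))\<^sup>2) \<partial>lborel)"
      by (intro nn_integral_mono) (auto simp: indicator_def)
    also have "\<dots> = ennreal ((norm (l2_class (convol k ?w)))\<^sup>2)"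
      by (rule nn_integral_half[OF conv_bounded_convol[OF k w]])
    also have "\<dots> \<le> ennreal ((C * norm (l2_class ?w))\<^sup>2)"
      by (intro ennreal_leI power_mono conv_bounded_norm[OF k w]) simp
    also have "\<dots> = ennreal (C\<^sup>2) * (\<integral>\<^sup>+x. ennreal ((cmod (?w x))\<^sup>2) \<partial>lborel)"
      by (simp add: nn_integral_half[OF w] power_mult_distrib ennreal_mult)
    also have "(\<integral>\<^sup>+x. ennreal ((cmod (?w x))\<^sup>2) \<partial>lborel) = (\<integral>\<^sup>+x. ennreal ((cmod (v x))\<^sup>2) * indicator {..T} x \<partial>lborel)"
      by (intro nn_integral_cong) (auto simp: indicator_def)
    finally show ?thesis .
  qed
  \<comment> \<open>Squaring doubles the rate, hence the weight with 2 d.\<close>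
  have sq: "ennreal ((cmod (of_real (exp (- d * x)) * z))\<^sup>2) = ennreal (exp (- (2 * d) * x)) * ennreal ((cmod z)\<^sup>2)" for x z
    by (simp add: norm_mult power_mult_distrib ennreal_mult[symmetric])
      (simp add: power2_eq_square exp_add[symmetric])
  have d2: "0 < 2 * d" using d by simp
  have c: "L2_half (convol (damp d k) \<phi>)" by (rule young_Ccomp_bound(1)[OF \<phi> L2_half_damp(1)[OF kL d]])
  have "ennreal ((norm (l2_class (convol (damp d k) \<phi>)))\<^sup>2)
    = (\<integral>\<^sup>+x. ennreal (exp (- (2 * d) * x)) * ennreal ((cmod (convol k v x))\<^sup>2) \<partial>lborel)"
    unfolding nn_integral_half[OF c, symmetric] cd sq ..
  also have "\<dots> = (\<integral>\<^sup>+T. ennreal (2 * d * exp (- (2 * d) * T)) *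
      (\<integral>\<^sup>+x. ennreal ((cmod (convol k v x))\<^sup>2) * indicator {..T} x \<partial>lborel) \<partial>lborel)"
    by (rule nn_integral_exp_weight[symmetric, OF _ d2]) measurable
  also have "\<dots> \<le> (\<integral>\<^sup>+T. ennreal (2 * d * exp (- (2 * d) * T)) *
      (ennreal (C\<^sup>2) * (\<integral>\<^sup>+x. ennreal ((cmod (v x))\<^sup>2) * indicator {..T} x \<partial>lborel)) \<partial>lborel)"
    by (intro nn_integral_mono mult_left_mono causal) simp
  also have "\<dots> = (\<integral>\<^sup>+T. ennreal (2 * d * exp (- (2 * d) * T)) *
      (\<integral>\<^sup>+x. (ennreal (C\<^sup>2) * ennreal ((cmod (v x))\<^sup>2)) * indicator {..T} x \<partial>lborel) \<partial>lborel)"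
    by (simp add: nn_integral_cmult[symmetric] mult.assoc)
  also have "\<dots> = (\<integral>\<^sup>+x. ennreal (exp (- (2 * d) * x)) * (ennreal (C\<^sup>2) * ennreal ((cmod (v x))\<^sup>2)) \<partial>lborel)"
    by (rule nn_integral_exp_weight[OF _ d2]) measurable
  also have "\<dots> = (\<integral>\<^sup>+x. ennreal (C\<^sup>2) * ennreal ((cmod (\<phi> x))\<^sup>2) \<partial>lborel)"
  proof (rule nn_integral_cong)
    fix x
    have "\<phi> x = of_real (exp (- d * x)) * v x"
      by (simp add: v_def exp_add[symmetric] flip: of_real_mult mult.assoc)
    then have "ennreal ((cmod (\<phi> x))\<^sup>2) = ennreal (exp (- (2 * d) * x)) * ennreal ((cmod (v x))\<^sup>2)"
      by (simp only: sq)
    then show "ennreal (exp (- (2 * d) * x)) * (ennreal (C\<^sup>2) * ennreal ((cmod (v x))\<^sup>2)) = ennreal (C\<^sup>2) * ennreal ((cmod (\<phi> x))\<^sup>2)"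
      by (simp add: mult_ac)
  qed
  also have "\<dots> = ennreal (C\<^sup>2) * ennreal ((norm (l2_class \<phi>))\<^sup>2)"
    by (subst nn_integral_cmult) (auto simp: nn_integral_half[OF \<phi>L])
  also have "\<dots> = ennreal ((C * norm (l2_class \<phi>))\<^sup>2)"
    by (simp add: ennreal_mult power_mult_distrib)
  finally have "(norm (l2_class (convol (damp d k) \<phi>)))\<^sup>2 \<le> (C * norm (l2_class \<phi>))\<^sup>2"
    by (simp add: ennreal_le_iff)
  then show "norm (l2_class (convol (damp d k) \<phi>)) \<le> C * norm (l2_class \<phi>)"
    by (rule power2_le_imp_le) (simp add: C)
qed

lemma damp_tendsto:
  assumes k: "L2_half k"
  shows "(\<lambda>n. l2_class (damp (1 / real (Suc n)) k)) \<longlonglongrightarrow> l2_class k"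
proof -
  have [measurable]: "k \<in> borel_measurable borel" by (rule L2_half_borel[OF k])
  let ?d = "\<lambda>n. 1 / real (Suc n)"
  have dL: "L2_half (damp (?d n) k)" for n by (rule L2_half_damp[OF k]) simp
  have "(\<lambda>n. \<integral>x. (cmod (damp (?d n) k x - k x))\<^sup>2 \<partial>lborel) \<longlonglongrightarrow> (\<integral>x. 0 \<partial>(lborel :: real measure))"
  proof (rule integral_dominated_convergence)
    show "integrable lborel (\<lambda>x. (cmod (k x))\<^sup>2)" using k by (simp add: L2_half_def L2_line_def)
    show "AE x in lborel. (\<lambda>n. (cmod (damp (?d n) k x - k x))\<^sup>2) \<longlonglongrightarrow> 0"
    proof (rule AE_I2)
      fix x
      have "(\<lambda>n. (cmod (of_real (exp (- ?d n * x)) * k x - k x))\<^sup>2) \<longlonglongrightarrow> (cmod (of_real (exp (- 0 * x)) * k x - k x))\<^sup>2"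
        by (intro tendsto_intros LIMSEQ_Suc[OF lim_1_over_n])
      then show "(\<lambda>n. (cmod (damp (?d n) k x - k x))\<^sup>2) \<longlonglongrightarrow> 0" by (simp add: damp_def)
    qed
    show "AE x in lborel. norm ((cmod (damp (?d n) k x - k x))\<^sup>2) \<le> (cmod (k x))\<^sup>2" for n
    proof (rule AE_I2)
      fix x
      have "damp (?d n) k x - k x = of_real (exp (- ?d n * x) - 1) * k x"
        by (simp add: damp_def algebra_simps)
      moreover have "cmod (of_real (exp (- ?d n * x) - 1) * k x) \<le> cmod (k x)"
      proof (cases "x \<le> 0")
        case False
        then have "\<bar>exp (- ?d n * x) - 1\<bar> * cmod (k x) \<le> 1 * cmod (k x)" by (intro mult_right_mono) auto
        then show ?thesis by (simp only: norm_mult norm_of_real)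
      qed (simp add: L2_half_nonpos[OF k])
      ultimately show "norm ((cmod (damp (?d n) k x - k x))\<^sup>2) \<le> (cmod (k x))\<^sup>2"
        by (simp add: power_mono)
    qed
  qed measurable
  then have "(\<lambda>n. sqrt (\<integral>x. (cmod (damp (?d n) k x - k x))\<^sup>2 \<partial>lborel)) \<longlonglongrightarrow> sqrt 0"
    by (intro tendsto_real_sqrt) simp
  then have "(\<lambda>n. norm (l2_class (damp (?d n) k) - l2_class k)) \<longlonglongrightarrow> 0"
    unfolding l2_class_half_diff[OF dL k] norm_l2_class_half[OF L2_half_diff[OF dL k]] by simp
  then show ?thesis using LIM_zero_cancel tendsto_norm_zero_iff by blast
qed

section \<open>Continuity of pairings and convolutions in each argument\<close>

lemma pairing_tendsto:
  assumes a: "\<And>n. L2_half (a n)" "L2_half a'" and b: "L2_half b"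
    and lim: "(\<lambda>n. l2_class (a n)) \<longlonglongrightarrow> l2_class a'"
  shows "(\<lambda>n. \<integral>x. a n x * b x \<partial>lborel) \<longlonglongrightarrow> (\<integral>x. a' x * b x \<partial>lborel)"
proof (rule LIM_zero_cancel, rule Lim_null_comparison)
  have "(\<lambda>n. norm (l2_class (a n) - l2_class a') * line_norm b) \<longlonglongrightarrow> norm (l2_class a' - l2_class a') * line_norm b"
    by (intro tendsto_intros lim)
  then show "(\<lambda>n. norm (l2_class (a n) - l2_class a') * line_norm b) \<longlonglongrightarrow> 0" by simp
  show "\<forall>\<^sub>F n in sequentially. norm ((\<integral>x. a n x * b x \<partial>lborel) - (\<integral>x. a' x * b x \<partial>lborel))
      \<le> norm (l2_class (a n) - l2_class a') * line_norm b"
  proof (rule always_eventually, rule allI)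
    fix n
    have d: "L2_half (\<lambda>x. a n x - a' x)" by (rule L2_half_diff[OF a])
    have "(\<integral>x. a n x * b x \<partial>lborel) - (\<integral>x. a' x * b x \<partial>lborel) = (\<integral>x. (a n x - a' x) * b x \<partial>lborel)"
      using L2_line_mult_integrable[OF L2_half_L2_line[OF a(1)] L2_half_L2_line[OF b]]
        L2_line_mult_integrable[OF L2_half_L2_line[OF a(2)] L2_half_L2_line[OF b]]
      by (simp add: left_diff_distrib)
    then show "norm ((\<integral>x. a n x * b x \<partial>lborel) - (\<integral>x. a' x * b x \<partial>lborel))
      \<le> norm (l2_class (a n) - l2_class a') * line_norm b"
      using L2_line_mult_integral_bound[OF L2_half_L2_line[OF d] L2_half_L2_line[OF b]]
      by (simp add: l2_class_half_diff a norm_l2_class_eq_line_norm d)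
  qed
qed

lemma l2_class_convol_diff_right:
  assumes "conv_bounded k C" "L2_half q" "L2_half r"
  shows "l2_class (convol k (\<lambda>x. q x - r x)) = l2_class (convol k q) - l2_class (convol k r)"
proof -
  have "convol k (\<lambda>x. q x - r x) = (\<lambda>x. convol k q x - convol k r x)"
    by (rule ext) (intro convol_diff_right L2_half_L2_line assms conv_bounded_L2_half[OF assms(1)])
  then show ?thesis using assms by (simp add: l2_class_half_diff conv_bounded_convol)
qed

lemma conv_bounded_tendsto:
  assumes k: "conv_bounded k C" and q: "\<And>n. L2_half (q n)" "L2_half q'"
    and lim: "(\<lambda>n. l2_class (q n)) \<longlonglongrightarrow> l2_class q'"
  shows "(\<lambda>n. l2_class (convol k (q n))) \<longlonglongrightarrow> l2_class (convol k q')"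
proof (rule LIM_zero_cancel, rule Lim_null_comparison)
  have "(\<lambda>n. C * norm (l2_class (q n) - l2_class q')) \<longlonglongrightarrow> C * norm (l2_class q' - l2_class q')"
    by (intro tendsto_intros lim)
  then show "(\<lambda>n. C * norm (l2_class (q n) - l2_class q')) \<longlonglongrightarrow> 0" by simp
  show "\<forall>\<^sub>F n in sequentially. norm (l2_class (convol k (q n)) - l2_class (convol k q')) \<le> C * norm (l2_class (q n) - l2_class q')"
    using conv_bounded_norm[OF k L2_half_diff[OF q]]
    by (simp add: l2_class_convol_diff_right[OF k q] l2_class_half_diff[OF q])
qed

lemma conv_bounded_diff:
  assumes k: "conv_bounded k C" and l: "conv_bounded l D"
  shows "conv_bounded (\<lambda>x. k x - l x) (C + D)"
proof -
  note kL = conv_bounded_L2_half[OF k] and lL = conv_bounded_L2_half[OF l]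
  have "L2_half (convol (\<lambda>x. k x - l x) q) \<and> norm (l2_class (convol (\<lambda>x. k x - l x) q)) \<le> (C + D) * norm (l2_class q)"
    if q: "L2_half q" for q
  proof -
    have eq: "convol (\<lambda>x. k x - l x) q = (\<lambda>x. convol k q x - convol l q x)"
      by (rule ext) (intro convol_diff_left L2_half_L2_line kL lL q)
    have "norm (l2_class (convol k q) - l2_class (convol l q)) \<le> C * norm (l2_class q) + D * norm (l2_class q)"
      by (rule order_trans[OF norm_triangle_ineq4]) (intro add_mono conv_bounded_norm[OF k q] conv_bounded_norm[OF l q])
    then show ?thesis
      using conv_bounded_convol[OF k q] conv_bounded_convol[OF l q]
      by (simp add: eq L2_half_diff l2_class_half_diff distrib_right)
  qed
  then show ?thesis using kL lL by (simp add: conv_bounded_def L2_half_diff)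
qed

lemma young_tendsto:
  assumes \<phi>: "\<phi> \<in> Ccomp_fun" and k: "\<And>n. L2_half (k n)" "L2_half k'"
    and lim: "(\<lambda>n. l2_class (k n)) \<longlonglongrightarrow> l2_class k'"
  shows "(\<lambda>n. l2_class (convol (k n) \<phi>)) \<longlonglongrightarrow> l2_class (convol k' \<phi>)"
proof (rule LIM_zero_cancel, rule Lim_null_comparison)
  let ?A = "\<integral>y. cmod (\<phi> y) \<partial>lborel"
  have "(\<lambda>n. ?A * norm (l2_class (k n) - l2_class k')) \<longlonglongrightarrow> ?A * norm (l2_class k' - l2_class k')"
    by (intro tendsto_intros lim)
  then show "(\<lambda>n. ?A * norm (l2_class (k n) - l2_class k')) \<longlonglongrightarrow> 0" by simp
  show "\<forall>\<^sub>F n in sequentially. norm (l2_class (convol (k n) \<phi>) - l2_class (convol k' \<phi>)) \<le> ?A * norm (l2_class (k n) - l2_class k')"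
  proof (rule always_eventually, rule allI)
    fix n
    have eq: "convol (\<lambda>x. k n x - k' x) \<phi> = (\<lambda>x. convol (k n) \<phi> x - convol k' \<phi> x)"
      by (rule ext) (intro convol_diff_left L2_half_L2_line k Ccomp_fun_L2_half \<phi>)
    show "norm (l2_class (convol (k n) \<phi>) - l2_class (convol k' \<phi>)) \<le> ?A * norm (l2_class (k n) - l2_class k')"
      using young_Ccomp_bound(2)[OF \<phi> L2_half_diff[OF k], of n]
      by (simp add: eq l2_class_half_diff k young_Ccomp_bound(1)[OF \<phi>])
  qed
qed

text \<open>Since \<open>|k| * |f|\<close> need not be square integrable, Fubini only applies to the damped kernel.\<close>

lemma hankel_form_convol_Ccomp:
  assumes h: "L2_half h" and f: "L2_half f" and F: "L2_half F"
    and Fh: "\<And>t. 0 < t \<Longrightarrow> F t = (\<integral>s. h (t + s) * f s \<partial>lborel)"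
    and k: "conv_bounded k C" and C: "0 \<le> C" and \<phi>: "\<phi> \<in> Ccomp_fun"
  shows "(\<integral>x. convol k \<phi> x * F x \<partial>lborel) = (\<integral>x. convol (convol k f) \<phi> x * h x \<partial>lborel)"
proof -
  note kL = conv_bounded_L2_half[OF k] and \<phi>L = Ccomp_fun_L2_half[OF \<phi>] and \<phi>1 = Ccomp_fun_integrable[OF \<phi>]
  note hl = L2_half_L2_line[OF h] and fl = L2_half_L2_line[OF f] and Fl = L2_half_L2_line[OF F]
    and \<phi>l = L2_half_L2_line[OF \<phi>L]
  let ?k = "\<lambda>n. damp (1 / real (Suc n)) k"
  have kn: "conv_bounded (?k n) C" for n by (rule conv_bounded_damp[OF k C]) simp
  have k1: "integrable lborel (?k n)" for n by (rule L2_half_damp[OF kL]) simp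
  have knL: "L2_half (?k n)" for n by (rule conv_bounded_L2_half[OF kn])
  have eq: "(\<integral>x. convol (?k n) \<phi> x * F x \<partial>lborel) = (\<integral>x. convol (convol (?k n) f) \<phi> x * h x \<partial>lborel)" for n
  proof -
    \<comment> \<open>Here the integrable factor is the damped kernel, paired with two square
      integrable ones.\<close>
    have "(\<integral>x. convol (?k n) \<phi> x * F x \<partial>lborel) = (\<integral>y. ?k n y * (\<integral>x. \<phi> x * F (x + y) \<partial>lborel) \<partial>lborel)"
      by (rule integral_convol_mult) (use k1[of n] \<phi>l Fl in \<open>unfold trilinear_def, blast\<close>)
    also have "\<dots> = (\<integral>y. ?k n y * (\<integral>w. convol \<phi> f w * h (w + y) \<partial>lborel) \<partial>lborel)"
    proof (rule Bochner_Integration.integral_cong[OF refl])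
      fix y
      show "?k n y * (\<integral>x. \<phi> x * F (x + y) \<partial>lborel) = ?k n y * (\<integral>w. convol \<phi> f w * h (w + y) \<partial>lborel)"
      \<comment> \<open>For y \<le> 0 the kernel vanishes. For y > 0 the point x + y is positive
        wherever \<phi> x is nonzero, as \<open>Fh\<close> requires.\<close>
      proof (cases "y \<le> 0")
        case False
        have "(\<integral>w. convol \<phi> f w * h (w + y) \<partial>lborel) = (\<integral>x. \<phi> x * (\<integral>s. f s * h (s + x + y) \<partial>lborel) \<partial>lborel)"
          using L2_line_shift[OF hl, of y] by (intro integral_convol_mult) (simp add: trilinear_def \<phi>1 fl add.commute)
        also have "\<dots> = (\<integral>x. \<phi> x * F (x + y) \<partial>lborel)"
        proof (rule Bochner_Integration.integral_cong[OF refl])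
          fix x
          show "\<phi> x * (\<integral>s. f s * h (s + x + y) \<partial>lborel) = \<phi> x * F (x + y)"
            using False Fh[of "x + y"] L2_half_nonpos[OF \<phi>L, of x]
            by (cases "x \<le> 0") (auto simp: mult.commute add_ac)
        qed
        finally show ?thesis by simp
      qed (simp only: L2_half_nonpos[OF knL] mult_zero_left)
    qed
    also have "\<dots> = (\<integral>x. convol (?k n) (convol \<phi> f) x * h x \<partial>lborel)"
      by (rule integral_convol_mult[symmetric])
        (use k1[of n] young_L2[OF \<phi>1 fl] hl in \<open>unfold trilinear_def, blast\<close>)
    also have "convol (?k n) (convol \<phi> f) = convol (convol (?k n) f) \<phi>"
      by (rule ext) (simp only: convol_commute[of \<phi>] convol_assoc[OF L2_half_L2_line[OF knL] fl \<phi>1])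
    finally show ?thesis .
  qed
  have "(\<lambda>n. \<integral>x. convol (?k n) \<phi> x * F x \<partial>lborel) \<longlonglongrightarrow> (\<integral>x. convol k \<phi> x * F x \<partial>lborel)"
    by (intro pairing_tendsto F young_Ccomp_bound(1)[OF \<phi>] knL kL young_tendsto[OF \<phi>] damp_tendsto)
  moreover have "(\<lambda>n. \<integral>x. convol (convol (?k n) f) \<phi> x * h x \<partial>lborel) \<longlonglongrightarrow> (\<integral>x. convol (convol k f) \<phi> x * h x \<partial>lborel)"
  \<comment> \<open>The damped kernels must converge on f in norm, not only as functions. The
    differences to k tend to 0 and have operator bound C + C by \<open>conv_bounded_damp\<close>, so
    \<open>conv_bounded_strong_limit\<close> applies.\<close>
  proof (intro pairing_tendsto h young_Ccomp_bound(1)[OF \<phi>] young_tendsto[OF \<phi>] conv_bounded_convol[OF kn] conv_bounded_convol[OF k] f)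
    have "(\<lambda>n. l2_class (convol (\<lambda>x. ?k n x - k x) f)) \<longlonglongrightarrow> 0"
    proof (rule conv_bounded_strong_limit[OF conv_bounded_diff[OF kn k] _ f])
      show "(\<lambda>n. l2_class (\<lambda>x. ?k n x - k x)) \<longlonglongrightarrow> 0"
        using LIM_zero[OF damp_tendsto[OF kL]] by (simp only: l2_class_half_diff[OF knL kL])
    qed
    moreover have "convol (\<lambda>x. ?k n x - k x) f = (\<lambda>x. convol (?k n) f x - convol k f x)" for n
      by (rule ext) (intro convol_diff_left L2_half_L2_line knL kL f)
    ultimately have "(\<lambda>n. l2_class (convol (?k n) f) - l2_class (convol k f)) \<longlonglongrightarrow> 0"
      by (simp only: l2_class_half_diff[OF conv_bounded_convol[OF kn f] conv_bounded_convol[OF k f]])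
    then show "(\<lambda>n. l2_class (convol (?k n) f)) \<longlonglongrightarrow> l2_class (convol k f)" by (rule LIM_zero_cancel)
  qed
  ultimately show ?thesis unfolding eq by (rule LIMSEQ_unique)
qed

text \<open>For test functions the identity is the Fubini identity for f minus that for k * f.
  Boundedness of k and of p makes both sides continuous in q. In particular p * q is square
  integrable, which f * q need not be, so q may become the regularised second vector.\<close>

lemma hankel_form_multiplier:
  assumes h: "L2_half h" and f: "L2_half f" and F: "L2_half F"
    and Fh: "\<And>t. 0 < t \<Longrightarrow> F t = (\<integral>s. h (t + s) * f s \<partial>lborel)"
    and k: "conv_bounded k C" and C: "0 \<le> C"
    and p: "conv_bounded (\<lambda>x. f x - convol k f x) D" and q: "L2_half q"
  shows "(\<integral>x. (q x - convol k q x) * F x \<partial>lborel) = (\<integral>x. convol (\<lambda>x. f x - convol k f x) q x * h x \<partial>lborel)"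
proof -
  let ?p = "\<lambda>x. f x - convol k f x"
  note kL = conv_bounded_L2_half[OF k] and kf = conv_bounded_convol[OF k f]
  have eq: "(\<integral>x. (\<phi> x - convol k \<phi> x) * F x \<partial>lborel) = (\<integral>x. convol ?p \<phi> x * h x \<partial>lborel)" if \<phi>: "\<phi> \<in> Ccomp_fun" for \<phi>
  proof -
    note \<phi>L = Ccomp_fun_L2_half[OF \<phi>] and \<phi>1 = Ccomp_fun_integrable[OF \<phi>]
    have 1: "(\<integral>x. \<phi> x * F x \<partial>lborel) = (\<integral>x. convol f \<phi> x * h x \<partial>lborel)"
    proof -
      have "(\<integral>x. convol \<phi> f x * h x \<partial>lborel) = (\<integral>y. \<phi> y * (\<integral>x. f x * h (x + y) \<partial>lborel) \<partial>lborel)"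
        by (rule integral_convol_mult) (simp add: trilinear_def \<phi>1 L2_half_L2_line[OF f] L2_half_L2_line[OF h])
      also have "\<dots> = (\<integral>y. \<phi> y * F y \<partial>lborel)"
      proof (rule Bochner_Integration.integral_cong[OF refl])
        fix y
        show "\<phi> y * (\<integral>x. f x * h (x + y) \<partial>lborel) = \<phi> y * F y"
          using Fh[of y] L2_half_nonpos[OF \<phi>L, of y] by (cases "y \<le> 0") (auto simp: mult.commute add.commute)
      qed
      finally show ?thesis by (simp add: convol_commute)
    qed
    have i: "integrable lborel (\<lambda>x. a x * b x)" if "L2_half a" "L2_half b" for a b
      by (intro L2_line_mult_integrable L2_half_L2_line that)
    note y = young_Ccomp_bound(1)[OF \<phi>]
    have "(\<integral>x. (\<phi> x - convol k \<phi> x) * F x \<partial>lborel) = (\<integral>x. \<phi> x * F x \<partial>lborel) - (\<integral>x. convol k \<phi> x * F x \<partial>lborel)"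
      using i[OF \<phi>L F] i[OF y[OF kL] F] by (simp add: left_diff_distrib)
    also have "\<dots> = (\<integral>x. convol f \<phi> x * h x \<partial>lborel) - (\<integral>x. convol (convol k f) \<phi> x * h x \<partial>lborel)"
      by (simp only: 1 hankel_form_convol_Ccomp[OF h f F Fh k C \<phi>])
    also have "\<dots> = (\<integral>x. (convol f \<phi> x - convol (convol k f) \<phi> x) * h x \<partial>lborel)"
      using i[OF y[OF f] h] i[OF y[OF kf] h] by (simp add: left_diff_distrib)
    also have "(\<lambda>x. convol f \<phi> x - convol (convol k f) \<phi> x) = convol ?p \<phi>"
      by (rule ext, rule convol_diff_left[symmetric]) (intro L2_half_L2_line f kf \<phi>L)+
    finally show ?thesis .
  qed
  obtain \<phi> where \<phi>: "\<And>n::nat. \<phi> n \<in> Ccomp_fun" and lim: "(\<lambda>n. l2_class (\<phi> n)) \<longlonglongrightarrow> l2_class q"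
    using Ccomp_fun_approx[of "l2_class q"] by blast
  note \<phi>L = Ccomp_fun_L2_half[OF \<phi>]
  have "(\<lambda>n. \<integral>x. (\<phi> n x - convol k (\<phi> n) x) * F x \<partial>lborel) \<longlonglongrightarrow> (\<integral>x. (q x - convol k q x) * F x \<partial>lborel)"
  proof (intro pairing_tendsto F L2_half_diff \<phi>L q conv_bounded_convol[OF k])
    have "(\<lambda>n. l2_class (\<phi> n) - l2_class (convol k (\<phi> n))) \<longlonglongrightarrow> l2_class q - l2_class (convol k q)"
      by (intro tendsto_diff lim conv_bounded_tendsto[OF k] \<phi>L q)
    then show "(\<lambda>n. l2_class (\<lambda>x. \<phi> n x - convol k (\<phi> n) x)) \<longlonglongrightarrow> l2_class (\<lambda>x. q x - convol k q x)"
      by (simp add: l2_class_half_diff \<phi>L q conv_bounded_convol[OF k])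
  qed
  moreover have "(\<lambda>n. \<integral>x. convol ?p (\<phi> n) x * h x \<partial>lborel) \<longlonglongrightarrow> (\<integral>x. convol ?p q x * h x \<partial>lborel)"
    by (intro pairing_tendsto h conv_bounded_convol[OF p] \<phi>L q conv_bounded_tendsto[OF p] lim)
  ultimately show ?thesis unfolding eq[OF \<phi>] by (rule LIMSEQ_unique)
qed

text \<open>Both vectors are regularised with \<epsilon> = 1/(n+1). The bounds n + 1 for the
  regularised vectors blow up but enter only the identity at fixed n; the passage to the limit uses
  the uniform bound 2 for \<open>k n\<close> and \<open>l n\<close>.\<close>

lemma hankel_form_symmetric_L2:
  assumes h: "L2_half h" and f: "L2_half f" and F: "L2_half F" and g: "L2_half g" and G: "L2_half G"
    and Fh: "\<And>t. 0 < t \<Longrightarrow> F t = (\<integral>s. h (t + s) * f s \<partial>lborel)"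
    and Gh: "\<And>t. 0 < t \<Longrightarrow> G t = (\<integral>s. h (t + s) * g s \<partial>lborel)"
  shows "(\<integral>x. g x * F x \<partial>lborel) = (\<integral>x. f x * G x \<partial>lborel)"
proof -
  have ex: "\<exists>k. \<forall>n. conv_bounded (k n) 2 \<and> conv_bounded (\<lambda>x. u x - convol (k n) u x) (1 / (1 / Suc n)) \<and>
      norm (l2_class (k n)) \<le> 1 / Suc n * norm (l2_class u)" if u: "L2_half u" for u
  proof (rule choice, rule allI)
    fix n :: nat
    have "0 < 1 / real (Suc n)" by simp
    from bounded_multiplier[OF u this] show "\<exists>k. conv_bounded k 2 \<and>
      conv_bounded (\<lambda>x. u x - convol k u x) (1 / (1 / Suc n)) \<and> norm (l2_class k) \<le> 1 / Suc n * norm (l2_class u)"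
      by blast
  qed
  obtain k where k: "\<And>n. conv_bounded (k n) 2"
    and p: "\<And>n. conv_bounded (\<lambda>x. f x - convol (k n) f x) (1 / (1 / Suc n))"
    and nk: "\<And>n. norm (l2_class (k n)) \<le> 1 / Suc n * norm (l2_class f)" using ex[OF f] by blast
  obtain l where l: "\<And>n. conv_bounded (l n) 2"
    and r: "\<And>n. conv_bounded (\<lambda>x. g x - convol (l n) g x) (1 / (1 / Suc n))"
    and nl: "\<And>n. norm (l2_class (l n)) \<le> 1 / Suc n * norm (l2_class g)" using ex[OF g] by blast
  have to0: "(\<lambda>n. l2_class (k n)) \<longlonglongrightarrow> 0" if "\<And>n. norm (l2_class (k n)) \<le> 1 / Suc n * c" for k c
  proof (rule Lim_null_comparison)
    show "\<forall>\<^sub>F n in sequentially. norm (l2_class (k n)) \<le> 1 / Suc n * c" using that by simp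
    show "(\<lambda>n. 1 / real (Suc n) * c) \<longlonglongrightarrow> 0"
      by (rule tendsto_mult_left_zero[OF LIMSEQ_Suc[OF lim_1_over_n]])
  qed
  let ?p = "\<lambda>n x. f x - convol (k n) f x" and ?r = "\<lambda>n x. g x - convol (l n) g x"
  note pL = conv_bounded_L2_half[OF p] and rL = conv_bounded_L2_half[OF r]
  \<comment> \<open>By \<open>hankel_form_multiplier\<close> the two sides are the pairings of h
    with \<open>convol (?p n) (?r n)\<close> and with \<open>convol (?r n) (?p n)\<close>.\<close>
  have eq: "(\<integral>x. (?r n x - convol (k n) (?r n) x) * F x \<partial>lborel) = (\<integral>x. (?p n x - convol (l n) (?p n) x) * G x \<partial>lborel)" for n
    unfolding hankel_form_multiplier[OF h f F Fh k _ p rL, of n n, simplified]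
      hankel_form_multiplier[OF h g G Gh l _ r pL, of n n, simplified]
    by (simp add: convol_commute)
  \<comment> \<open>Stated with the two kernel sequences as variables because the two sides of
    \<open>eq\<close> apply them in opposite order.\<close>
  have lim: "(\<lambda>n. \<integral>x. ((u x - convol (l n) u x) - convol (k n) (\<lambda>x. u x - convol (l n) u x) x) * H x \<partial>lborel) \<longlonglongrightarrow> (\<integral>x. u x * H x \<partial>lborel)"
    if u: "L2_half u" and H: "L2_half H" and k: "\<And>n. conv_bounded (k n) 2" "(\<lambda>n. l2_class (k n)) \<longlonglongrightarrow> 0"
      and l: "\<And>n. conv_bounded (l n) 2" "(\<lambda>n. l2_class (l n)) \<longlonglongrightarrow> 0" for u H k l
  proof -
    let ?u = "\<lambda>n x. u x - convol (l n) u x"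
    have uL: "L2_half (?u n)" for n by (intro L2_half_diff u conv_bounded_convol[OF l(1)])
    have "(\<lambda>n. l2_class u - l2_class (convol (l n) u)) \<longlonglongrightarrow> l2_class u - 0"
      by (intro tendsto_diff tendsto_const conv_bounded_strong_limit[OF l u])
    then have ulim: "(\<lambda>n. l2_class (?u n)) \<longlonglongrightarrow> l2_class u"
      by (simp add: l2_class_half_diff u conv_bounded_convol[OF l(1)])
    have "(\<lambda>n. l2_class (convol (k n) (?u n)) - l2_class (convol (k n) u)) \<longlonglongrightarrow> 0"
    proof (rule Lim_null_comparison)
      have "(\<lambda>n. 2 * norm (l2_class (?u n) - l2_class u)) \<longlonglongrightarrow> 2 * norm (l2_class u - l2_class u)"
        by (intro tendsto_intros ulim)
      then show "(\<lambda>n. 2 * norm (l2_class (?u n) - l2_class u)) \<longlonglongrightarrow> 0" by simp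
      show "\<forall>\<^sub>F n in sequentially. norm (l2_class (convol (k n) (?u n)) - l2_class (convol (k n) u)) \<le> 2 * norm (l2_class (?u n) - l2_class u)"
        unfolding l2_class_convol_diff_right[OF k(1) uL u, symmetric] l2_class_half_diff[OF uL u]
        by (intro always_eventually allI conv_bounded_norm[OF k(1)] L2_half_diff uL u)
    qed
    from tendsto_add[OF this conv_bounded_strong_limit[OF k u]]
    have "(\<lambda>n. l2_class (convol (k n) (?u n))) \<longlonglongrightarrow> 0" by simp
    from tendsto_diff[OF ulim this]
    have "(\<lambda>n. l2_class (\<lambda>x. ?u n x - convol (k n) (?u n) x)) \<longlonglongrightarrow> l2_class u"
      by (simp add: l2_class_half_diff uL conv_bounded_convol[OF k(1) uL])
    then show ?thesis
      by (intro pairing_tendsto u H L2_half_diff uL conv_bounded_convol[OF k(1) uL])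
  qed
  note lim1 = lim[OF g F k to0[OF nk] l to0[OF nl]] and lim2 = lim[OF f G l to0[OF nl] k to0[OF nk]]
  show ?thesis using lim1 lim2 unfolding eq by (rule LIMSEQ_unique)
qed

section \<open>Restriction to the half-line and strong continuity of right translations\<close>

lemma L2_half_restrict:
  assumes "L2_line u" shows "L2_half (\<lambda>x. if 0 < x then u x else 0)"
proof -
  have [measurable]: "u \<in> borel_measurable borel" using assms by (rule L2_line_borel)
  have "integrable lborel (\<lambda>x. (cmod (if 0 < x then u x else 0))\<^sup>2)"
    by (rule Bochner_Integration.integrable_bound[where f = "\<lambda>x. (cmod (u x))\<^sup>2"])
      (use assms in \<open>auto simp: L2_line_def\<close>)
  then show ?thesis by (simp add: L2_half_def L2_line_def)
qed

lemma L2_half_right_shift: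
  assumes "L2_half g" "0 \<le> \<tau>"
  shows "L2_half (\<lambda>x. g (x - \<tau>))" "norm (l2_class (\<lambda>x. g (x - \<tau>))) = norm (l2_class g)"
proof -
  show L: "L2_half (\<lambda>x. g (x - \<tau>))"
    using L2_line_shift[OF L2_half_L2_line[OF assms(1)], of "- \<tau>"] L2_half_nonpos[OF assms(1)] assms(2)
    by (auto simp: L2_half_def)
  show "norm (l2_class (\<lambda>x. g (x - \<tau>))) = norm (l2_class g)"
    using line_norm_shift[OF L2_half_L2_line[OF assms(1)], of "- \<tau>"]
    by (simp add: norm_l2_class_eq_line_norm L assms(1))
qed

lemma Ccomp_fun_shift_tendsto:
  assumes \<phi>: "\<phi> \<in> Ccomp_fun"
  shows "(\<lambda>n. l2_class (\<lambda>x. \<phi> (x - 1 / Suc n))) \<longlonglongrightarrow> l2_class \<phi>"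
proof -
  note \<phi>L = Ccomp_fun_L2_half[OF \<phi>]
  have [measurable]: "\<phi> \<in> borel_measurable borel" by (rule L2_half_borel[OF \<phi>L])
  obtain a b where ab: "0 < a" "a < b" "\<And>x. x \<notin> {a..b} \<Longrightarrow> \<phi> x = 0" using \<phi> by (rule Ccomp_funE) blast
  obtain B where B: "\<And>x. cmod (\<phi> x) \<le> B" using \<phi> by (rule Ccomp_fun_bounded) blast
  let ?s = "\<lambda>n x. \<phi> (x - 1 / Suc n)"
  have sL: "L2_half (?s n)" for n
    by (rule L2_half_right_shift(1)[OF \<phi>L]) simp
  have "(\<lambda>n. \<integral>x. (cmod (?s n x - \<phi> x))\<^sup>2 \<partial>lborel) \<longlonglongrightarrow> (\<integral>x. 0 \<partial>(lborel :: real measure))"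
  proof (rule integral_dominated_convergence)
    \<comment> \<open>The shifts are at most 1, so all translates are supported in this common
      interval.\<close>
    show "integrable lborel (\<lambda>x. (2 * B)\<^sup>2 * indicat_real {a..b + 1} x)"
      by (intro integrable_mult_right integrable_real_indicator) (simp, simp add: emeasure_lborel_Icc_eq)
    show "AE x in lborel. (\<lambda>n. (cmod (?s n x - \<phi> x))\<^sup>2) \<longlonglongrightarrow> 0"
    proof (rule AE_I2)
      fix x
      have "(\<lambda>n. x - 1 / Suc n) \<longlonglongrightarrow> x - 0"
        by (intro tendsto_intros LIMSEQ_Suc[OF lim_1_over_n])
      then have "(\<lambda>n. ?s n x) \<longlonglongrightarrow> \<phi> (x - 0)"
        using continuous_on_tendsto_compose[OF Ccomp_fun_continuous[OF \<phi>]] by simp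
      then have "(\<lambda>n. (cmod (?s n x - \<phi> x))\<^sup>2) \<longlonglongrightarrow> (cmod (\<phi> (x - 0) - \<phi> x))\<^sup>2"
        by (intro tendsto_intros)
      then show "(\<lambda>n. (cmod (?s n x - \<phi> x))\<^sup>2) \<longlonglongrightarrow> 0" by simp
    qed
    show "AE x in lborel. norm ((cmod (?s n x - \<phi> x))\<^sup>2) \<le> (2 * B)\<^sup>2 * indicat_real {a..b + 1} x" for n
    proof (rule AE_I2)
      fix x
      show "norm ((cmod (?s n x - \<phi> x))\<^sup>2) \<le> (2 * B)\<^sup>2 * indicat_real {a..b + 1} x"
      proof (cases "x \<in> {a..b + 1}")
        case True
        have "cmod (?s n x - \<phi> x) \<le> 2 * B"
          using norm_triangle_ineq4[of "?s n x" "\<phi> x"] B[of x] B[of "x - 1 / Suc n"] by linarith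
        then have "(cmod (?s n x - \<phi> x))\<^sup>2 \<le> (2 * B)\<^sup>2" by (rule power_mono) simp
        then show ?thesis using True by simp
      next
        case False
        have "0 < 1 / real (Suc n)" "1 / real (Suc n) \<le> 1" by auto
        then have "x - 1 / Suc n \<notin> {a..b}" "x \<notin> {a..b}" using False
          unfolding atLeastAtMost_iff by linarith+
        then show ?thesis using False by (simp add: ab(3))
      qed
    qed
  qed measurable
  then have "(\<lambda>n. sqrt (\<integral>x. (cmod (?s n x - \<phi> x))\<^sup>2 \<partial>lborel)) \<longlonglongrightarrow> sqrt 0"
    by (intro tendsto_real_sqrt) simp
  then have "(\<lambda>n. norm (l2_class (?s n) - l2_class \<phi>)) \<longlonglongrightarrow> 0"
    unfolding l2_class_half_diff[OF sL \<phi>L] norm_l2_class_half[OF L2_half_diff[OF sL \<phi>L]] by simp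
  then show ?thesis using LIM_zero_cancel tendsto_norm_zero_iff by blast
qed

text \<open>Density and isometry of the translations: e/3 for approximating g, again e/3 after
  shifting, and e/3 for the test function itself.\<close>

lemma right_shift_tendsto:
  assumes g: "L2_half g"
  shows "(\<lambda>n. l2_class (\<lambda>x. g (x - 1 / Suc n))) \<longlonglongrightarrow> l2_class g"
proof (rule tendstoI)
  fix e :: real assume e: "0 < e"
  have "l2_class g \<in> closure Ccomp" by (simp add: closure_Ccomp)
  moreover have "0 < e / 3" using e by simp
  ultimately obtain v where v: "v \<in> Ccomp" "dist v (l2_class g) < e / 3"
    unfolding closure_approachable by blast
  then obtain \<phi> where \<phi>: "\<phi> \<in> Ccomp_fun" "v = l2_class \<phi>" by (auto simp: Ccomp_def)
  note \<phi>L = Ccomp_fun_L2_half[OF \<phi>(1)]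
  have s: "L2_half (\<lambda>x. u (x - 1 / Suc n))" if "L2_half u" for u and n :: nat
    by (rule L2_half_right_shift[OF that]) simp
  have "\<forall>\<^sub>F n in sequentially. dist (l2_class (\<lambda>x. \<phi> (x - 1 / Suc n))) (l2_class \<phi>) < e / 3"
    using Ccomp_fun_shift_tendsto[OF \<phi>(1)] e by (intro tendstoD) auto
  then show "\<forall>\<^sub>F n in sequentially. dist (l2_class (\<lambda>x. g (x - 1 / Suc n))) (l2_class g) < e"
  proof eventually_elim
    case (elim n)
    have "dist (l2_class (\<lambda>x. g (x - 1 / Suc n))) (l2_class (\<lambda>x. \<phi> (x - 1 / Suc n)))
      = norm (l2_class (\<lambda>x. g (x - 1 / Suc n) - \<phi> (x - 1 / Suc n)))"
      unfolding dist_norm by (subst l2_class_half_diff[OF s[OF g] s[OF \<phi>L]]) (rule refl)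
    also have "\<dots> = norm (l2_class (\<lambda>x. g x - \<phi> x))"
      by (rule L2_half_right_shift(2)[OF L2_half_diff[OF g \<phi>L]]) simp
    also have "\<dots> = dist v (l2_class g)"
      by (simp add: \<phi>(2) dist_norm norm_minus_commute l2_class_half_diff[OF g \<phi>L, symmetric])
    finally have "dist (l2_class (\<lambda>x. g (x - 1 / Suc n))) (l2_class (\<lambda>x. \<phi> (x - 1 / Suc n))) < e / 3"
      using v(2) by simp
    with elim v(2) show ?case unfolding \<phi>(2)
      using dist_triangle[of "l2_class (\<lambda>x. g (x - 1 / Suc n))" "l2_class g" "l2_class (\<lambda>x. \<phi> (x - 1 / Suc n))"]
        dist_triangle[of "l2_class (\<lambda>x. \<phi> (x - 1 / Suc n))" "l2_class g" "l2_class \<phi>"] by linarith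
  qed
qed

subsection \<open>Hankel operators\<close>

text \<open>The kernel need not be square integrable near 0, as the Carleman kernel 1/x shows; only
  the tails beyond each t > 0 are controlled.\<close>

definition hankel_kernel :: "(real \<Rightarrow> complex) \<Rightarrow> bool" where
  "hankel_kernel h \<longleftrightarrow> h \<in> borel_measurable borel \<and> (\<forall>x\<le>0. h x = 0) \<and>
     (\<forall>t>0. L2_half (\<lambda>s. if 0 < s then h (t + s) else 0))"

definition half_hankel :: "(real \<Rightarrow> complex) \<Rightarrow> (real \<Rightarrow> complex) \<Rightarrow> real \<Rightarrow> complex" where
  "half_hankel h f t = (if 0 < t then \<integral>s. h (t + s) * f s \<partial>lborel else 0)"

lemma hankel_kernel_borel: "hankel_kernel h \<Longrightarrow> h \<in> borel_measurable borel"
  by (simp add: hankel_kernel_def)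

lemma hankel_kernel_shift:
  "hankel_kernel h \<Longrightarrow> 0 < t \<Longrightarrow> L2_half (\<lambda>s. if 0 < s then h (t + s) else 0)"
  by (simp add: hankel_kernel_def)

lemma hankel_kernel_cnj:
  assumes "hankel_kernel h" shows "hankel_kernel (\<lambda>x. cnj (h x))"
proof -
  have "L2_half (\<lambda>s. if 0 < s then cnj (h (t + s)) else 0)" if "0 < t" for t
  proof -
    have "(\<lambda>s. if 0 < s then cnj (h (t + s)) else 0) = (\<lambda>s. cnj (if 0 < s then h (t + s) else 0))" by auto
    then show ?thesis using L2_half_cnj[OF hankel_kernel_shift[OF assms that]] by simp
  qed
  then show ?thesis using assms by (auto simp: hankel_kernel_def intro!: borel_measurable_cnj)
qed

text \<open>The tail condition at t = a, translated back. It replaces h by a square integrable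
  kernel whenever one argument is supported in [a,\<infinity>).\<close>

lemma hankel_kernel_cut:
  assumes h: "hankel_kernel h" and a: "0 < a"
  shows "L2_half (\<lambda>x. indicator {a<..} x * h x)"
proof -
  have "L2_line (\<lambda>x. if 0 < - a + x then h (a + (- a + x)) else 0)"
    using L2_line_shift[OF L2_half_L2_line[OF hankel_kernel_shift[OF h a]], of "- a"] by simp
  also have "(\<lambda>x. if 0 < - a + x then h (a + (- a + x)) else 0) = (\<lambda>x. indicator {a<..} x * h x)"
    by (auto simp: indicator_def fun_eq_iff)
  finally show ?thesis using a by (auto simp: L2_half_def)
qed

lemma half_hankel_measurable [measurable]:
  assumes [measurable]: "h \<in> borel_measurable borel" "f \<in> borel_measurable borel"
  shows "half_hankel h f \<in> borel_measurable borel"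
  unfolding half_hankel_def by measurable

lemma half_hankel_eq:
  assumes "L2_half f" "0 < t"
  shows "half_hankel h f t = (\<integral>s. f s * (if 0 < s then h (t + s) else 0) \<partial>lborel)"
  unfolding half_hankel_def using assms
  by (auto intro!: Bochner_Integration.integral_cong simp: L2_half_nonpos)

lemma half_hankel_integrable:
  assumes h: "hankel_kernel h" and f: "L2_half f" and t: "0 < t"
  shows "integrable lborel (\<lambda>s. h (t + s) * f s)"
proof -
  have "integrable lborel (\<lambda>s. f s * (if 0 < s then h (t + s) else 0))"
    by (intro L2_line_mult_integrable L2_half_L2_line f hankel_kernel_shift[OF h t])
  also have "(\<lambda>s. f s * (if 0 < s then h (t + s) else 0)) = (\<lambda>s. h (t + s) * f s)"
    using L2_half_nonpos[OF f] by auto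
  finally show ?thesis .
qed

lemma half_hankel_add:
  assumes "hankel_kernel h" "L2_half f" "L2_half g"
  shows "half_hankel h (\<lambda>x. f x + g x) = (\<lambda>t. half_hankel h f t + half_hankel h g t)"
  by (rule ext) (simp add: half_hankel_def distrib_left half_hankel_integrable assms)

lemma half_hankel_scaleR: "half_hankel h (\<lambda>x. c *\<^sub>R f x) = (\<lambda>t. c *\<^sub>R half_hankel h f t)"
  by (rule ext) (simp add: half_hankel_def)

lemma half_hankel_cnj:
  "half_hankel (\<lambda>x. cnj (h x)) (\<lambda>x. cnj (f x)) = (\<lambda>t. cnj (half_hankel h f t))"
  by (rule ext) (simp add: half_hankel_def flip: complex_cnj_mult)

lemma hankel_l2_class_half:
  assumes h: "hankel_kernel h" and f: "L2_half f"
  shows "hankel h (l2_class f) =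
    (if L2_half (half_hankel h f) then Some (l2_class (half_hankel h f)) else None)"
proof -
  have [measurable]: "h \<in> borel_measurable borel" "f \<in> borel_measurable borel"
    using h f by (auto intro: hankel_kernel_borel L2_half_borel)
  have eq: "hankel_integral h f t = half_hankel h f t" if "0 < t" for t
    unfolding hankel_integral_def half_hankel_def using that L2_half_nonpos[OF f]
    by (auto intro!: integral_Rpos_eq_lborel)
  have sh: "square_integrable (\<lambda>s. h (t + s))" if "0 < t" for t
  proof -
    have "integrable Rpos (\<lambda>s. (cmod (if 0 < s then h (t + s) else 0))\<^sup>2)"
      using L2_half_square_integrable[OF hankel_kernel_shift[OF h that]] by (simp add: square_integrable_def)
    also have "integrable Rpos (\<lambda>s. (cmod (if 0 < s then h (t + s) else 0))\<^sup>2) \<longleftrightarrow> integrable Rpos (\<lambda>s. (cmod (h (t + s)))\<^sup>2)"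
      by (rule Bochner_Integration.integrable_cong) auto
    finally show ?thesis
      by (simp add: square_integrable_def borel_imp_measurable_Rpos)
  qed
  have m: "half_hankel h f \<in> borel_measurable borel" by measurable
  have "square_integrable (hankel_integral h f) \<longleftrightarrow> square_integrable (half_hankel h f)"
    unfolding square_integrable_def using eq
    by (intro arg_cong2[where f = conj] measurable_cong Bochner_Integration.integrable_cong) auto
  also have "\<dots> \<longleftrightarrow> L2_half (half_hankel h f)"
    using m by (auto simp: L2_half_iff half_hankel_def)
  finally have si: "square_integrable (hankel_integral h f) \<longleftrightarrow> L2_half (half_hankel h f)" .
  moreover have "l2_class (hankel_integral h f) = l2_class (half_hankel h f)" if "L2_half (half_hankel h f)"
    using that si by (subst l2_class_eq_iff) (auto simp: L2_half_square_integrable eq intro!: AE_I2)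
  moreover have "hankel h (l2_class f) = (if square_integrable (hankel_integral h f) then
      Some (l2_class (hankel_integral h f)) else None)"
    by (rule hankel_l2_class[OF sh L2_half_square_integrable[OF f]])
  ultimately show ?thesis by auto
qed

lemma hankel_SomeE:
  assumes h: "hankel_kernel h" and u: "hankel h u = Some v"
  obtains f where "L2_half f" "u = l2_class f" "L2_half (half_hankel h f)" "v = l2_class (half_hankel h f)"
proof -
  obtain f where f: "L2_half f" "l2_class f = u" by (rule L2_half_representative)
  then show ?thesis
    using u that[of f] hankel_l2_class_half[OF h f(1)] by (auto split: if_splits)
qed

lemma hankel_Some_half:
  "hankel_kernel h \<Longrightarrow> L2_half f \<Longrightarrow> L2_half (half_hankel h f) \<Longrightarrow>
    hankel h (l2_class f) = Some (l2_class (half_hankel h f))"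
  by (simp add: hankel_l2_class_half)

lemma subspace_graph_hankel:
  assumes h: "hankel_kernel h" shows "subspace (Map.graph (hankel h))"
proof (rule subspaceI)
  note z = half_hankel_scaleR[of h 0 "\<lambda>x. 0"]
  have "L2_half (\<lambda>x. 0)" by (simp add: L2_half_iff square_integrable_zero)
  then show "0 \<in> Map.graph (hankel h)"
    using hankel_Some_half[OF h, of "\<lambda>x. 0"] z
    by (simp add: Map.graph_def zero_prod_def l2_class_zero)
  fix x y c assume "x \<in> Map.graph (hankel h)"
  then obtain f where f: "L2_half f" "L2_half (half_hankel h f)" "x = (l2_class f, l2_class (half_hankel h f))"
    by (auto simp: Map.graph_def elim: hankel_SomeE[OF h])
  show "c *\<^sub>R x \<in> Map.graph (hankel h)"
    using f hankel_Some_half[OF h, of "\<lambda>x. c *\<^sub>R f x"]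
    by (simp add: Map.graph_def half_hankel_scaleR L2_half_scaleR l2_class_half_scaleR)
  assume "y \<in> Map.graph (hankel h)"
  then obtain g where g: "L2_half g" "L2_half (half_hankel h g)" "y = (l2_class g, l2_class (half_hankel h g))"
    by (auto simp: Map.graph_def elim: hankel_SomeE[OF h])
  show "x + y \<in> Map.graph (hankel h)"
    using f g hankel_Some_half[OF h, of "\<lambda>x. f x + g x"]
    by (simp add: Map.graph_def half_hankel_add[OF h] L2_half_add l2_class_half_add)
qed

text \<open>At each t > 0 the Hankel integral is a continuous functional of f by Cauchy-Schwarz.
  Norm convergence of the arguments thus gives pointwise convergence of the images, to be compared
  with their norm limit.\<close>

lemma closed_operator_hankel:
  assumes h: "hankel_kernel h" shows "closed_operator (hankel h)"
  unfolding closed_operator_def closed_sequential_limits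
proof (intro allI impI, elim conjE)
  fix X w assume X: "\<forall>n. X n \<in> Map.graph (hankel h)" and lim: "X \<longlonglongrightarrow> w"
  have "\<exists>f. L2_half f \<and> L2_half (half_hankel h f) \<and> X n = (l2_class f, l2_class (half_hankel h f))" for n
    using X[rule_format, of n] by (cases "X n") (auto simp: Map.graph_def elim: hankel_SomeE[OF h])
  then obtain f where f: "\<And>n. L2_half (f n)" "\<And>n. L2_half (half_hankel h (f n))"
    and Xf: "\<And>n. X n = (l2_class (f n), l2_class (half_hankel h (f n)))" by metis
  obtain u where u: "L2_half u" "l2_class u = fst w" by (rule L2_half_representative)
  obtain v where v: "L2_half v" "l2_class v = snd w" by (rule L2_half_representative)
  have lu: "(\<lambda>n. l2_class (f n)) \<longlonglongrightarrow> l2_class u"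
    using tendsto_fst[OF lim] by (simp add: Xf u)
  have lv: "(\<lambda>n. l2_class (half_hankel h (f n))) \<longlonglongrightarrow> l2_class v"
    using tendsto_snd[OF lim] by (simp add: Xf v)
  have m: "half_hankel h u \<in> borel_measurable borel"
    using hankel_kernel_borel[OF h] L2_half_borel[OF u(1)] by measurable
  have "AE t in Rpos. (\<lambda>n. half_hankel h (f n) t) \<longlonglongrightarrow> half_hankel h u t"
  proof (rule AE_I2)
    fix t assume "t \<in> space Rpos"
    then have t: "0 < t" by simp
    show "(\<lambda>n. half_hankel h (f n) t) \<longlonglongrightarrow> half_hankel h u t"
      unfolding half_hankel_eq[OF f(1) t] half_hankel_eq[OF u(1) t]
      by (rule pairing_tendsto[OF f(1) u(1) hankel_kernel_shift[OF h t] lu])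
  qed
  note l2_lim_AE_unique[OF L2_half_square_integrable[OF f(2)] borel_imp_measurable_Rpos[OF m]
      L2_half_square_integrable[OF v(1)] this lv]
  moreover have "\<forall>t\<le>0. half_hankel h u t = 0" by (simp add: half_hankel_def)
  ultimately have "L2_half (half_hankel h u)" "l2_class (half_hankel h u) = l2_class v"
    using m by (simp_all add: L2_half_iff)
  then show "w \<in> Map.graph (hankel h)"
    using hankel_Some_half[OF h u(1)] u v by (cases w) (simp add: Map.graph_def)
qed

text \<open>The shifted kernel is square integrable, so the previous case applies to it. A
  substitution moves the shift from the images to the arguments, where it disappears by continuity
  of translations.\<close>

lemma hankel_form_symmetric:
  assumes h: "hankel_kernel h" and f: "L2_half f" and F: "L2_half (half_hankel h f)"
    and g: "L2_half g" and G: "L2_half (half_hankel h g)"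
  shows "(\<integral>x. g x * half_hankel h f x \<partial>lborel) = (\<integral>x. f x * half_hankel h g x \<partial>lborel)"
proof -
  have eq: "(\<integral>x. g (x - \<tau>) * half_hankel h f x \<partial>lborel) = (\<integral>x. f (x - \<tau>) * half_hankel h g x \<partial>lborel)"
    if \<tau>: "0 < \<tau>" for \<tau>
  proof -
    let ?h = "\<lambda>s. if 0 < s then h (\<tau> + s) else 0"
    \<comment> \<open>The Hankel image for the shifted kernel is the image for h shifted by the same
      amount, hence still square integrable.\<close>
    let ?R = "\<lambda>f t. if 0 < t then half_hankel h f (\<tau> + t) else 0"
    have R: "L2_half (?R f)" if "L2_half (half_hankel h f)" for f
      by (rule L2_half_restrict[OF L2_line_shift[OF L2_half_L2_line[OF that]]])
    have Rh: "?R f t = (\<integral>s. ?h (t + s) * f s \<partial>lborel)" if "0 < t" "L2_half f" for f t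
      using that \<tau> L2_half_nonpos[OF that(2)]
      by (auto simp: half_hankel_def add.assoc intro!: Bochner_Integration.integral_cong)
    have sh: "(\<integral>x. g x * ?R f x \<partial>lborel) = (\<integral>x. g (x - \<tau>) * half_hankel h f x \<partial>lborel)" if "L2_half g" for f g
    proof -
      have "(\<integral>x. g x * ?R f x \<partial>lborel) = (\<integral>x. g x * half_hankel h f (\<tau> + x) \<partial>lborel)"
        using L2_half_nonpos[OF that] by (intro Bochner_Integration.integral_cong) auto
      also have "\<dots> = (\<integral>x. g (x - \<tau>) * half_hankel h f x \<partial>lborel)"
        by (subst lborel_integral_real_affine[of 1 _ "- \<tau>"]) auto
      finally show ?thesis .
    qed
    have "(\<integral>x. g x * ?R f x \<partial>lborel) = (\<integral>x. f x * ?R g x \<partial>lborel)"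
      by (rule hankel_form_symmetric_L2[OF hankel_kernel_shift[OF h \<tau>] f R[OF F] g R[OF G] Rh[OF _ f] Rh[OF _ g]])
    then show ?thesis unfolding sh[OF f] sh[OF g] .
  qed
  have "(\<lambda>n. \<integral>x. u (x - 1 / Suc n) * v x \<partial>lborel) \<longlonglongrightarrow> (\<integral>x. u x * v x \<partial>lborel)"
    if "L2_half u" "L2_half v" for u v
    by (intro pairing_tendsto that right_shift_tendsto L2_half_right_shift) simp
  note lim = this[OF g F] this[OF f G]
  have "(\<integral>x. g (x - 1 / Suc n) * half_hankel h f x \<partial>lborel) = (\<integral>x. f (x - 1 / Suc n) * half_hankel h g x \<partial>lborel)" for n
    by (rule eq) simp
  then show ?thesis using lim by (auto intro: LIMSEQ_unique)
qed

section \<open>Test functions in the domain and the weak form of the operator\<close>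

text \<open>For t > 0 the Hankel integral is the convolution of the reflected test function with h
  cut off below its support, so Young's inequality applies.\<close>

lemma half_hankel_Ccomp_fun:
  assumes h: "hankel_kernel h" and \<phi>: "\<phi> \<in> Ccomp_fun"
  shows "L2_half (half_hankel h \<phi>)"
proof -
  obtain a b where ab: "0 < a" "a < b" "\<And>x. x \<notin> {a..b} \<Longrightarrow> \<phi> x = 0" using \<phi> by (rule Ccomp_funE) blast
  let ?h = "\<lambda>x. indicator {a<..} x * h x"
  have "integrable lborel (\<lambda>x. \<phi> (0 + (- 1) * x))"
    by (rule lborel_integrable_real_affine[OF Ccomp_fun_integrable[OF \<phi>]]) simp
  then have "integrable lborel (\<lambda>x. \<phi> (- x))" by simp
  from L2_half_restrict[OF young_L2[OF this L2_half_L2_line[OF hankel_kernel_cut[OF h ab(1)]]]]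
  have "L2_half (\<lambda>t. if 0 < t then convol (\<lambda>x. \<phi> (- x)) ?h t else 0)" .
  also have "(\<lambda>t. if 0 < t then convol (\<lambda>x. \<phi> (- x)) ?h t else 0) = half_hankel h \<phi>"
  proof
    fix t :: real
    have "convol (\<lambda>x. \<phi> (- x)) ?h t = half_hankel h \<phi> t" if t: "0 < t"
    proof -
      have "convol (\<lambda>x. \<phi> (- x)) ?h t = (\<integral>s. \<phi> s * ?h (t + s) \<partial>lborel)"
        unfolding convol_def by (subst lborel_integral_real_affine[of "-1" _ 0]) auto
      also have "\<dots> = (\<integral>s. h (t + s) * \<phi> s \<partial>lborel)"
        using t ab(3) by (intro Bochner_Integration.integral_cong) (force simp: indicator_def)+
      finally show ?thesis using t by (simp add: half_hankel_def)
    qed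
    then show "(if 0 < t then convol (\<lambda>x. \<phi> (- x)) ?h t else 0) = half_hankel h \<phi> t"
      by (simp add: half_hankel_def)
  qed
  finally show ?thesis .
qed

text \<open>The support of \<phi> lets the cut-off kernel replace h, and then Fubini is legitimate.
  Both sides equal the pairing of \<phi> * v with the cut-off kernel.\<close>

lemma hankel_form_Ccomp_fun:
  assumes h: "hankel_kernel h" and \<phi>: "\<phi> \<in> Ccomp_fun" and v: "L2_half v"
  shows "(\<integral>x. half_hankel h \<phi> x * v x \<partial>lborel) = (\<integral>x. \<phi> x * half_hankel h v x \<partial>lborel)"
proof -
  obtain a b where ab: "0 < a" "a < b" "\<And>x. x \<notin> {a..b} \<Longrightarrow> \<phi> x = 0" using \<phi> by (rule Ccomp_funE) blast
  let ?h = "\<lambda>x. indicator {a<..} x * h x"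
  note tri = Ccomp_fun_integrable[OF \<phi>] L2_half_L2_line[OF v] L2_half_L2_line[OF hankel_kernel_cut[OF h ab(1)]]
  \<comment> \<open>A nonzero product needs y \<ge> a and x > 0, hence x + y > a.\<close>
  have cut: "\<phi> y * (v x * ?h (x + y)) = \<phi> y * (v x * h (x + y))" for x y
    using ab(3)[of y] L2_half_nonpos[OF v, of x] by (cases "x \<le> 0") (auto simp: indicator_def)
  have "(\<integral>x. half_hankel h \<phi> x * v x \<partial>lborel) = (\<integral>x. v x * (\<integral>y. \<phi> y * ?h (y + x) \<partial>lborel) \<partial>lborel)"
  proof (rule Bochner_Integration.integral_cong[OF refl])
    fix x
    have "(\<integral>y. v x * (\<phi> y * ?h (y + x)) \<partial>lborel) = (\<integral>y. v x * (\<phi> y * h (y + x)) \<partial>lborel)"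
      using cut[of _ x] by (intro Bochner_Integration.integral_cong[OF refl]) (simp only: mult.left_commute[of "v x"] add.commute)
    then have "v x * (\<integral>y. \<phi> y * ?h (y + x) \<partial>lborel) = v x * (\<integral>y. \<phi> y * h (y + x) \<partial>lborel)"
      by (simp only: integral_mult_right_zero)
    then show "half_hankel h \<phi> x * v x = v x * (\<integral>y. \<phi> y * ?h (y + x) \<partial>lborel)"
      using L2_half_nonpos[OF v, of x]
      by (cases "x \<le> 0") (auto simp: half_hankel_def mult.commute[of _ "\<phi> _"] add.commute mult.commute[of _ "v x"])
  qed
  also have "\<dots> = (\<integral>w. convol v \<phi> w * ?h w \<partial>lborel)"
    by (rule integral_convol_mult[symmetric]) (use tri in \<open>unfold trilinear_def, blast\<close>)
  also have "\<dots> = (\<integral>w. convol \<phi> v w * ?h w \<partial>lborel)" by (simp only: convol_commute)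
  also have "\<dots> = (\<integral>y. \<phi> y * (\<integral>x. v x * ?h (x + y) \<partial>lborel) \<partial>lborel)"
    by (rule integral_convol_mult) (use tri in \<open>unfold trilinear_def, blast\<close>)
  also have "\<dots> = (\<integral>y. \<phi> y * half_hankel h v y \<partial>lborel)"
  proof (rule Bochner_Integration.integral_cong[OF refl])
    fix y
    have "\<phi> y * (\<integral>x. v x * ?h (x + y) \<partial>lborel) = \<phi> y * (\<integral>x. v x * h (x + y) \<partial>lborel)"
      by (simp only: integral_mult_right_zero[symmetric] cut)
    then show "\<phi> y * (\<integral>x. v x * ?h (x + y) \<partial>lborel) = \<phi> y * half_hankel h v y"
      using L2_half_nonpos[OF Ccomp_fun_L2_half[OF \<phi>], of y]
      by (simp add: half_hankel_def mult.commute add.commute)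
  qed
  finally show ?thesis .
qed

text \<open>Gives local integrability on (0,\<infinity>) of the Hankel integral of an arbitrary
  square integrable function, including those outside the domain.\<close>

lemma half_hankel_bounded:
  assumes h: "hankel_kernel h" and v: "L2_half v" and a: "0 < a" "a \<le> t"
  shows "cmod (half_hankel h v t) \<le> line_norm v * line_norm (\<lambda>x. indicator {a<..} x * h x)"
proof -
  let ?h = "\<lambda>x. indicator {a<..} x * h x"
  note hL = L2_half_L2_line[OF hankel_kernel_cut[OF h a(1)]]
  have "half_hankel h v t = (\<integral>s. v s * ?h (t + s) \<partial>lborel)"
    unfolding half_hankel_def using a L2_half_nonpos[OF v]
    by (auto simp: indicator_def intro!: Bochner_Integration.integral_cong)
  then show ?thesis
    using L2_line_mult_integral_bound[OF L2_half_L2_line[OF v] L2_line_shift[OF hL, of t]]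
    unfolding line_norm_shift[OF hL] by simp
qed

text \<open>The adjoint of the restriction to test functions: Fubini moves the operator onto v, and
  the fundamental lemma identifies the locally bounded function \<open>?G\<close> with w almost
  everywhere. Only then does \<open>?G\<close> become square integrable, that is, v a member of the
  domain.\<close>

lemma hankel_cnj_weak:
  assumes h: "hankel_kernel h"
    and weak: "\<And>\<phi>. \<phi> \<in> Ccomp_fun \<Longrightarrow> l2_class (half_hankel h \<phi>) \<bullet> v = l2_class \<phi> \<bullet> w"
  shows "hankel (\<lambda>x. cnj (h x)) v = Some w"
proof -
  obtain v' where v: "L2_half v'" "l2_class v' = v" by (rule L2_half_representative)
  obtain w' where w: "L2_half w'" "l2_class w' = w" by (rule L2_half_representative)
  let ?G = "half_hankel (\<lambda>x. cnj (h x)) v'"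
  note hc = hankel_kernel_cnj[OF h]
  have [measurable]: "h \<in> borel_measurable borel" "v' \<in> borel_measurable borel" "w' \<in> borel_measurable borel"
    using h v w by (auto intro: hankel_kernel_borel L2_half_borel)
  have Gc: "half_hankel h (\<lambda>x. cnj (v' x)) = (\<lambda>t. cnj (?G t))"
    using half_hankel_cnj[of "\<lambda>x. cnj (h x)" v'] by simp
  have Gm: "set_integrable lborel {a..b} ?G" if "0 < a" for a b
    unfolding set_integrable_def
  proof (rule integrable_bounded_support[where a = a and b = b])
    show "norm (indicator {a..b} t *\<^sub>R ?G t) \<le> line_norm v' * line_norm (\<lambda>x. indicator {a<..} x * cnj (h x))" for t
      using half_hankel_bounded[OF hc v(1) that, of t] line_norm_nonneg
      by (cases "t \<in> {a..b}") auto
  qed auto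
  have "AE x in lborel. 0 < x \<longrightarrow> cnj (?G x - w' x) = 0"
  proof (rule fundamental_lemma)
    show "(\<lambda>x. cnj (?G x - w' x)) \<in> borel_measurable borel" by measurable
    show "set_integrable lborel {a..b} (\<lambda>x. cnj (?G x - w' x))" if "0 < a" for a b
    proof -
      have "set_integrable lborel {a..b} (\<lambda>x. ?G x - w' x)"
        by (intro set_integral_diff Gm that L2_line_set_integrable L2_half_L2_line w)
      from integrable_cnj[OF this[unfolded set_integrable_def]] show ?thesis
        by (simp add: set_integrable_def)
    qed
    fix \<phi> assume \<phi>: "\<phi> \<in> Ccomp_fun"
    note \<phi>L = Ccomp_fun_L2_half[OF \<phi>]
    have [measurable]: "\<phi> \<in> borel_measurable borel" by (rule L2_half_borel[OF \<phi>L])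
    obtain a b where ab: "0 < a" "a < b" "\<And>x. x \<notin> {a..b} \<Longrightarrow> \<phi> x = 0" using \<phi> by (rule Ccomp_funE) blast
    obtain B where B: "\<And>x. cmod (\<phi> x) \<le> B" using \<phi> by (rule Ccomp_fun_bounded) blast
    have 1: "integrable lborel (\<lambda>x. \<phi> x * cnj (?G x))"
    proof (rule Bochner_Integration.integrable_bound)
      show "integrable lborel (\<lambda>x. B * norm (indicator {a..b} x *\<^sub>R ?G x))"
        using Gm[OF ab(1), of b] unfolding set_integrable_def by (intro integrable_mult_right integrable_norm)
      show "AE x in lborel. norm (\<phi> x * cnj (?G x)) \<le> norm (B * norm (indicator {a..b} x *\<^sub>R ?G x))"
      proof (rule AE_I2)
        fix x
        have "0 \<le> B" using B[of x] norm_ge_zero order_trans by blast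
        then show "norm (\<phi> x * cnj (?G x)) \<le> norm (B * norm (indicator {a..b} x *\<^sub>R ?G x))"
          using ab(3)[of x] B[of x] by (cases "x \<in> {a..b}") (auto simp: norm_mult abs_mult intro!: mult_right_mono)
      qed
    qed measurable
    have 2: "integrable lborel (\<lambda>x. \<phi> x * cnj (w' x))"
      by (intro L2_line_mult_integrable L2_line_cnj L2_half_L2_line \<phi>L w)
    have "(\<integral>x. \<phi> x * cnj (?G x - w' x) \<partial>lborel) = (\<integral>x. \<phi> x * cnj (?G x) \<partial>lborel) - (\<integral>x. \<phi> x * cnj (w' x) \<partial>lborel)"
      using 1 2 by (simp add: right_diff_distrib)
    also have "(\<integral>x. \<phi> x * cnj (?G x) \<partial>lborel) = (\<integral>x. half_hankel h \<phi> x * cnj (v' x) \<partial>lborel)"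
      using hankel_form_Ccomp_fun[OF h \<phi> L2_half_cnj[OF v(1)]] by (simp add: Gc)
    finally have "Re (\<integral>x. \<phi> x * cnj (?G x - w' x) \<partial>lborel)
      = l2_class (half_hankel h \<phi>) \<bullet> l2_class v' - l2_class \<phi> \<bullet> l2_class w'"
      by (simp add: inner_l2_class_half[OF half_hankel_Ccomp_fun[OF h \<phi>] v(1)] inner_l2_class_half[OF \<phi>L w(1)])
    then show "Re (\<integral>x. \<phi> x * cnj (?G x - w' x) \<partial>lborel) = 0" using weak[OF \<phi>] by (simp add: v w)
  qed
  then have "AE x in lborel. w' x = ?G x"
  proof eventually_elim
    case (elim x)
    then show ?case using L2_half_nonpos[OF w(1), of x] by (cases "0 < x") (auto simp: half_hankel_def)
  qed
  moreover have "?G \<in> borel_measurable borel" by measurable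
  ultimately have "L2_half ?G" "l2_class ?G = l2_class w'"
    by (auto intro!: L2_half_cong_AE[OF w(1)] simp: half_hankel_def)
  then show ?thesis using hankel_Some_half[OF hc v(1)] by (simp add: v w)
qed

text \<open>The symmetric form is bilinear; putting the conjugate of g into it produces the
  sesquilinear pairing and the conjugate kernel.\<close>

lemma hankel_cinner_symmetric:
  assumes h: "hankel_kernel h" and u: "hankel h u = Some u'" and v: "hankel (\<lambda>x. cnj (h x)) v = Some v'"
  shows "cinner u' v = cinner u v'"
proof -
  obtain f where f: "L2_half f" "u = l2_class f" "L2_half (half_hankel h f)" "u' = l2_class (half_hankel h f)"
    using u by (rule hankel_SomeE[OF h])
  obtain g where g: "L2_half g" "v = l2_class g" "L2_half (half_hankel (\<lambda>x. cnj (h x)) g)"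
    "v' = l2_class (half_hankel (\<lambda>x. cnj (h x)) g)"
    using v by (rule hankel_SomeE[OF hankel_kernel_cnj[OF h]])
  have c: "half_hankel h (\<lambda>x. cnj (g x)) = (\<lambda>t. cnj (half_hankel (\<lambda>x. cnj (h x)) g t))"
    using half_hankel_cnj[of "\<lambda>x. cnj (h x)" g] by simp
  have "(\<integral>x. cnj (g x) * half_hankel h f x \<partial>lborel) = (\<integral>x. f x * half_hankel h (\<lambda>x. cnj (g x)) x \<partial>lborel)"
    by (rule hankel_form_symmetric[OF h f(1,3) L2_half_cnj[OF g(1)]]) (simp add: c L2_half_cnj g(3))
  then show ?thesis
    by (simp add: f(2,4) g(2,4) cinner_l2_class_half f g c mult.commute)
qed

lemma hankel_Ccomp:
  assumes "hankel_kernel h" "\<phi> \<in> Ccomp_fun"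
  shows "hankel h (l2_class \<phi>) = Some (l2_class (half_hankel h \<phi>))"
  by (intro hankel_Some_half assms Ccomp_fun_L2_half half_hankel_Ccomp_fun)

section \<open>The adjoint and density in the graph norm\<close>

text \<open>Symmetry shows that the conjugate operator provides an adjoint vector. Conversely an
  adjoint vector can be tested on test functions, which determines it as the value of the conjugate
  operator; this also yields the uniqueness that \<open>adjoint_operator\<close> demands.\<close>

lemma adjoint_operator_hankel:
  assumes h: "hankel_kernel h"
  shows "adjoint_operator (hankel h) = hankel (\<lambda>x. cnj (h x))"
proof
  fix v
  define P where "P w \<longleftrightarrow> (\<forall>u\<in>dom (hankel h). cinner (the (hankel h u)) v = cinner u w)" for w
  have PI: "P w" if "hankel (\<lambda>x. cnj (h x)) v = Some w" for w
    unfolding P_def using hankel_cinner_symmetric[OF h _ that] by auto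
  have PD: "hankel (\<lambda>x. cnj (h x)) v = Some w" if "P w" for w
  proof (rule hankel_cnj_weak[OF h])
    fix \<phi> assume "\<phi> \<in> Ccomp_fun"
    note \<phi> = hankel_Ccomp[OF h this]
    then have "l2_class \<phi> \<in> dom (hankel h)" by auto
    from that[unfolded P_def, rule_format, OF this]
    show "l2_class (half_hankel h \<phi>) \<bullet> v = l2_class \<phi> \<bullet> w"
      using \<phi> by (simp add: inner_l2_def)
  qed
  have "adjoint_operator (hankel h) v = (if \<exists>!w. P w then Some (THE w. P w) else None)"
    by (simp add: adjoint_operator_def P_def)
  also have "\<dots> = hankel (\<lambda>x. cnj (h x)) v"
  proof (cases "hankel (\<lambda>x. cnj (h x)) v")
    case None
    then show ?thesis using PD by fastforce
  next
    case (Some w)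
    have "w' = w" if "P w'" for w' using PD[OF that] Some by simp
    note uniq = ex1I[of P, OF PI[OF Some] this] the_equality[of P, OF PI[OF Some] this]
    show ?thesis using Some by (simp add: uniq)
  qed
  finally show "adjoint_operator (hankel h) v = hankel (\<lambda>x. cnj (h x)) v" .
qed

text \<open>The residual (a,b) of the projection onto the closed graph over test functions lies in
  the graph and is orthogonal to it. The orthogonality says that the conjugate operator maps b to
  -a, and symmetry then gives |b|^2 = -|a|^2.\<close>

lemma graph_norm_dense_hankel:
  assumes h: "hankel_kernel h"
  shows "graph_norm_dense (hankel h) Ccomp"
  unfolding graph_norm_dense_def
proof (intro ballI allI impI)
  fix u and e :: real assume "u \<in> dom (hankel h)" and e: "0 < e"
  then obtain u' where u: "hankel h u = Some u'" by blast
  let ?\<Gamma> = "Map.graph (hankel h)"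
  have mem: "(x, y) \<in> ?\<Gamma> \<longleftrightarrow> hankel h x = Some y" for x y by (simp add: Map.graph_def)
  define S where "S = {(x, y) \<in> ?\<Gamma>. x \<in> Ccomp}"
  have S\<Gamma>: "S \<subseteq> ?\<Gamma>" by (auto simp: S_def)
  have sub: "subspace S"
  proof -
    have "subspace (Ccomp \<times> (UNIV :: l2 set))" by (intro subspace_Times subspace_Ccomp subspace_UNIV)
    moreover have "S = ?\<Gamma> \<inter> (Ccomp \<times> UNIV)" by (auto simp: S_def)
    ultimately show ?thesis using subspace_graph_hankel[OF h] by (simp add: subspace_inter)
  qed
  obtain y where y: "y \<in> closure S" and orth: "\<And>z. z \<in> closure S \<Longrightarrow> ((u, u') - y) \<bullet> z = 0"
    using closed_subspace_projection[OF subspace_closure[OF sub] closed_closure] by blast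
  obtain a b where r: "(u, u') - y = (a, b)" by (cases "(u, u') - y")
  \<comment> \<open>Closedness of the operator keeps the residual inside the graph, where the
    symmetry is available.\<close>
  have "closure S \<subseteq> ?\<Gamma>"
    using S\<Gamma> closed_operator_hankel[OF h] by (intro closure_minimal) (auto simp: closed_operator_def)
  then have "(u, u') - y \<in> ?\<Gamma>"
    using y u by (intro subspace_diff[OF subspace_graph_hankel[OF h]]) (auto simp: mem)
  then have ab: "hankel h a = Some b" by (simp add: r mem)
  have "hankel (\<lambda>x. cnj (h x)) b = Some (- a)"
  proof (rule hankel_cnj_weak[OF h])
    fix \<phi> assume \<phi>: "\<phi> \<in> Ccomp_fun"
    then have "(l2_class \<phi>, l2_class (half_hankel h \<phi>)) \<in> S"
      using hankel_Ccomp[OF h \<phi>] by (auto simp: S_def mem Ccomp_def)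
    then have "(l2_class \<phi>, l2_class (half_hankel h \<phi>)) \<in> closure S" by (rule subsetD[OF closure_subset])
    from orth[OF this] show "l2_class (half_hankel h \<phi>) \<bullet> b = l2_class \<phi> \<bullet> - a"
      by (simp add: r inner_commute)
  qed
  from hankel_cinner_symmetric[OF h ab this] have "b \<bullet> b = a \<bullet> - a"
    by (simp add: inner_l2_def)
  then have "b \<bullet> b + a \<bullet> a = 0" by simp
  then have "a = 0" "b = 0"
    using inner_ge_zero[of a] inner_ge_zero[of b] by (simp_all add: add_nonneg_eq_0_iff)
  then have "(u, u') \<in> closure S" using r y by (simp add: zero_prod_def[symmetric])
  then obtain p where p: "p \<in> S" "dist p (u, u') < e" using e unfolding closure_approachable by blast
  obtain v v' where pv: "p = (v, v')" by (cases p)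
  have "(u, u') - p \<in> ?\<Gamma>"
    using p(1) S\<Gamma> u by (intro subspace_diff[OF subspace_graph_hankel[OF h]]) (auto simp: mem)
  then have "hankel h (u - v) = Some (u' - v')" by (simp add: pv mem)
  then have "graph_norm (hankel h) (u - v) = dist p (u, u')"
    by (simp add: graph_norm_def pv dist_Pair_Pair dist_norm[symmetric] dist_commute)
  then show "\<exists>v\<in>Ccomp. graph_norm (hankel h) (u - v) < e"
    using p pv by (intro bexI[of _ v]) (auto simp: S_def)
qed

section \<open>From Borel kernels to Lebesgue measurable ones\<close>

lemma AE_shift:
  fixes t :: real
  assumes "AE x in lborel. P x" shows "AE s in lborel. P (t + s)"
proof -
  obtain N where N: "{x. \<not> P x} \<subseteq> N" "N \<in> sets lborel" "emeasure lborel N = 0"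
    using assms by (auto elim: AE_E)
  then have "AE x in lborel. x \<notin> N" by (intro AE_not_in) (auto simp: null_sets_def)
  then have "AE s in lborel. t + 1 * s \<notin> N"
    using N(2) by (intro AE_borel_affine) auto
  then show ?thesis by eventually_elim (use N(1) in auto)
qed

text \<open>Translation preserves null sets, and t > 0 keeps the argument in (0,\<infinity>).
  Completeness of Lebesgue measure then transfers measurability from the Borel kernel to the one
  that agrees with it almost everywhere.\<close>

lemma
  fixes h h' :: "real \<Rightarrow> complex"
  assumes h: "h \<in> borel_measurable borel" and ae: "AE x in lborel. 0 < x \<longrightarrow> h' x = h x" and t: "0 < t"
  shows AE_kernel_shift: "AE s in Rpos. h' (t + s) = h (t + s)"
    and measurable_kernel_shift: "(\<lambda>s. h' (t + s)) \<in> borel_measurable Rpos"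
proof -
  have a: "AE s in lborel. 0 < s \<longrightarrow> h' (t + s) = h (t + s)"
    using AE_shift[OF ae, of t] by eventually_elim (use t in auto)
  then show "AE s in Rpos. h' (t + s) = h (t + s)" by (simp add: AE_Rpos_iff)
  have "AE s in lebesgue. indicator {0<..} s *\<^sub>R h (t + s) = indicator {0<..} s *\<^sub>R h' (t + s)"
    unfolding AE_completion_iff using a by eventually_elim (auto simp: indicator_def)
  moreover have "(\<lambda>s. indicator {0<..} s *\<^sub>R h (t + s)) \<in> borel_measurable lebesgue"
    using h by (intro measurable_completion) simp
  ultimately have "(\<lambda>s. indicator {0<..} s *\<^sub>R h' (t + s)) \<in> borel_measurable lebesgue"
    by (rule borel_measurable_AE[rotated])
  then show "(\<lambda>s. h' (t + s)) \<in> borel_measurable Rpos"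
    by (subst borel_measurable_restrict_space_iff) auto
qed

text \<open>For every single t > 0 the integrands agree almost everywhere, so the Hankel integrals
  agree at all t > 0 and the operators have equal domains and values.\<close>

lemma hankel_cong_AE:
  assumes k: "hankel_kernel h" and ae: "AE x in lborel. 0 < x \<longrightarrow> h' x = h x"
  shows "hankel h' = hankel h"
proof
  fix u
  note h = hankel_kernel_borel[OF k]
  have [measurable]: "l2_fun u \<in> borel_measurable Rpos"
    using square_integrable_l2_fun by (simp add: square_integrable_def)
  have eq: "hankel_integral h' (l2_fun u) t = hankel_integral h (l2_fun u) t" if t: "0 < t" for t
  proof -
    note [measurable] = measurable_kernel_shift[OF h ae t]
    have "(\<lambda>s. h (t + s)) \<in> borel_measurable borel" using h by measurable
    then have [measurable]: "(\<lambda>s. h (t + s)) \<in> borel_measurable Rpos" by (rule borel_imp_measurable_Rpos)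
    show ?thesis
      unfolding hankel_integral_def
    proof (rule integral_cong_AE)
      show "AE s in Rpos. h' (t + s) * l2_fun u s = h (t + s) * l2_fun u s"
        using AE_kernel_shift[OF h ae t] by eventually_elim simp
    qed measurable
  qed
  have si: "square_integrable (hankel_integral h' (l2_fun u)) \<longleftrightarrow> square_integrable (hankel_integral h (l2_fun u))"
    unfolding square_integrable_def using eq
    by (intro arg_cong2[where f = conj] measurable_cong Bochner_Integration.integrable_cong) auto
  have "AE t in Rpos. hankel_integral h' (l2_fun u) t = hankel_integral h (l2_fun u) t"
    by (rule AE_I2) (auto intro: eq)
  then show "hankel h' u = hankel h u"
    using si by (auto simp: hankel_def Let_def l2_class_eq_iff)
qed

theorem theorem2p3:
  fixes h :: "real \<Rightarrow> complex"
  assumes "h \<in> borel_measurable (lebesgue_on {0<..})"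
    and "\<And>t. t > 0 \<Longrightarrow> integrable (lebesgue_on {0<..}) (\<lambda>s. (cmod (h (t + s)))\<^sup>2)"
  shows "closed_operator (hankel h)
    \<and> (Ccomp \<subseteq> dom (hankel h) \<and> graph_norm_dense (hankel h) Ccomp)
    \<and> adjoint_operator (hankel h) = hankel (\<lambda>t. cnj (h t))"
proof -
  \<comment> \<open>All three assertions see h only through its operator and that of its conjugate,
    so a Borel representative may take its place.\<close>
  obtain k where k: "k \<in> borel_measurable borel" "\<forall>x\<le>0. k x = 0" and ae: "AE x in lborel. 0 < x \<longrightarrow> h x = k x"
    using borel_representative[OF assms(1)] by blast
  have kernel: "hankel_kernel k"
    unfolding hankel_kernel_def
  proof (intro conjI allI impI k(1))
    show "k x = 0" if "x \<le> 0" for x using k(2) that by blast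
    fix t :: real assume t: "0 < t"
    let ?k = "\<lambda>s. if 0 < s then k (t + s) else 0"
    have km: "?k \<in> borel_measurable borel" using k(1) by measurable
    have "AE s in Rpos. (cmod (h (t + s)))\<^sup>2 = (cmod (?k s))\<^sup>2"
    proof -
      have "AE s in Rpos. 0 < s" by (rule AE_I2) simp
      with AE_kernel_shift[OF k(1) ae t] show ?thesis by eventually_elim simp
    qed
    then have "integrable Rpos (\<lambda>s. (cmod (?k s))\<^sup>2)"
      using assms(2)[OF t] measurable_kernel_shift[OF k(1) ae t] borel_imp_measurable_Rpos[OF km]
      by (subst integrable_cong_AE[symmetric, where f = "\<lambda>s. (cmod (h (t + s)))\<^sup>2"]) auto
    then show "L2_half ?k"
      using km by (simp add: L2_half_iff square_integrable_def borel_imp_measurable_Rpos)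
  qed
  have "AE x in lborel. 0 < x \<longrightarrow> cnj (h x) = cnj (k x)" using ae by eventually_elim simp
  then have hc: "hankel (\<lambda>x. cnj (h x)) = hankel (\<lambda>x. cnj (k x))"
    by (rule hankel_cong_AE[OF hankel_kernel_cnj[OF kernel]])
  have "Ccomp \<subseteq> dom (hankel k)" using hankel_Ccomp[OF kernel] by (auto simp: Ccomp_def)
  then show ?thesis
    unfolding hankel_cong_AE[OF kernel ae] hc
    using closed_operator_hankel[OF kernel] graph_norm_dense_hankel[OF kernel] adjoint_operator_hankel[OF kernel]
    by blast
qed

end
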